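(* Given an input graph $G$ and an input set $F\subseteq\{B_1,B_2,B_3,T_3\}$, it is in $\mathrm{P}$ to test if $G$ admits an $F$-free orientation. In particular, the constraint-digraph algorithm described in the context (Algorithm 1) decides if $G$ admits an $F$-free orientation in cubic time.
   Context: Graphs are finite and simple. $B_1,B_2,B_3$ are the orientations of the path $P_3$ on three vertices: in $B_1$ both arcs are directed into the middle vertex, in $B_2$ both arcs are directed out of the middle vertex, and $B_3$ is the directed path. $T_3$ is the transitive tournament on three vertices. An orientation of $G$ is $F$-free if no induced oriented subgraph of it is isomorphic to a member of $F$. Constraint digraph $D^+$ of $G$ and $F$: its vertices are the ordered pairs $(x,y)$ with $xy\in E(G)$, so each edge gives both $(x,y)$ and $(y,x)$. Its arcs are the following. (i) If $B_1\in F$: all arcs $((x,y),(y,z))$ with $xy,yz\in E(G)$, $zx\notin E(G)$. (ii) If $B_2\in F$: all arcs $((y,x),(z,y))$ with $xy,yz\in E(G)$, $zx\notin E(G)$. (iii) If $B_3\in F$: all arcs $((x,y),(z,y))$ and $((y,x),(y,z))$ with $xy,yz\in E(G)$, $zx\notin E(G)$. (iv) If $T_3\in F$: all arcs $((x,y),(y,z))$ and $((y,x),(x,z))$ with $xy,yz,zx\in E(G)$. Here $x,y,z$ are distinct vertices. For a strong component $S$ of $D^+$, its dual component $\overline{S}$ is the strong component induced by the vertices $(y,x)$ with $(x,y)\in S$. Algorithm 1, on input $G$ and $F$: construct $D^+$; generate the strong components of $D^+$ in reverse topological order (if $S_1$ reaches $S_2$, then $S_2$ is generated before $S_1$), using Tarjan's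 algorithm; process the strong components $S$ in this order. If $S=\overline{S}$, stop and return $S$ (in which case $G$ has no $F$-free orientation). Otherwise, if the vertices of $S$ are not yet marked, mark every vertex of $S$ true and every vertex of $\overline{S}$ false. If all components are processed, return the resulting true/false colouring of the vertices of $D^+$; orienting $xy$ from $x$ to $y$ whenever $(x,y)$ is marked true then gives an $F$-free orientation of $G$. Cubic time means cubic in the number of vertices of $G$, including the construction of $D^+$. *)

theory Defs
  imports "Graph_Theory.Graph_Theory" "HOL-Computational_Algebra.Polynomial"
    "HOL-Library.Discrete_Functions"
begin

section \<open>Oriented graphs and F-free orientations\<close>

text \<open>A finite simple graph is a \<^locale>\<open>pair_graph\<close>: the edge \<open>xy\<close> is
  represented by its two arcs \<open>(x,y)\<close> and \<open>(y,x)\<close>.\<close>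

definition B1 :: "nat pair_pre_digraph" where
  "B1 = \<lparr>pverts = {0,1,2}, parcs = {(0,1), (2,1)}\<rparr>"

definition B2 :: "nat pair_pre_digraph" where
  "B2 = \<lparr>pverts = {0,1,2}, parcs = {(1,0), (1,2)}\<rparr>"

definition B3 :: "nat pair_pre_digraph" where
  "B3 = \<lparr>pverts = {0,1,2}, parcs = {(0,1), (1,2)}\<rparr>"

definition T3 :: "nat pair_pre_digraph" where
  "T3 = \<lparr>pverts = {0,1,2}, parcs = {(0,1), (1,2), (0,2)}\<rparr>"

definition orientation_of :: "'a pair_pre_digraph \<Rightarrow> 'a pair_pre_digraph \<Rightarrow> bool" where
  "orientation_of G D \<longleftrightarrow> pverts D = pverts G \<and>
     parcs D \<union> (parcs D)\<inverse> = parcs G \<and> parcs D \<inter> (parcs D)\<inverse> = {}"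

definition F_free :: "nat pair_pre_digraph set \<Rightarrow> 'a pair_pre_digraph \<Rightarrow> bool" where
  "F_free F D \<longleftrightarrow>
     \<not> (\<exists>W H. W \<subseteq> pverts D \<and> H \<in> F \<and> digraph_iso (with_proj H) (with_proj D \<restriction> W))"

definition F_free_orientation ::
    "'a pair_pre_digraph \<Rightarrow> nat pair_pre_digraph set \<Rightarrow> 'a pair_pre_digraph \<Rightarrow> bool" where
  "F_free_orientation G F D \<longleftrightarrow> orientation_of G D \<and> F_free F D"


section \<open>The constraint digraph and the marking algorithm\<close>

definition constraint_digraph ::
    "'a pair_pre_digraph \<Rightarrow> nat pair_pre_digraph set \<Rightarrow> ('a \<times> 'a) pair_pre_digraph" where
  "constraint_digraph G F = \<lparr>pverts = parcs G, parcs =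
     {((x,y),(y,z)) | x y z. B1 \<in> F \<and> distinct [x,y,z] \<and>
        (x,y) \<in> parcs G \<and> (y,z) \<in> parcs G \<and> (z,x) \<notin> parcs G} \<union>
     {((y,x),(z,y)) | x y z. B2 \<in> F \<and> distinct [x,y,z] \<and>
        (x,y) \<in> parcs G \<and> (y,z) \<in> parcs G \<and> (z,x) \<notin> parcs G} \<union>
     {((x,y),(z,y)) | x y z. B3 \<in> F \<and> distinct [x,y,z] \<and>
        (x,y) \<in> parcs G \<and> (y,z) \<in> parcs G \<and> (z,x) \<notin> parcs G} \<union>
     {((y,x),(y,z)) | x y z. B3 \<in> F \<and> distinct [x,y,z] \<and>
        (x,y) \<in> parcs G \<and> (y,z) \<in> parcs G \<and> (z,x) \<notin> parcs G} \<union>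
     {((x,y),(y,z)) | x y z. T3 \<in> F \<and> distinct [x,y,z] \<and>
        (x,y) \<in> parcs G \<and> (y,z) \<in> parcs G \<and> (z,x) \<in> parcs G} \<union>
     {((y,x),(x,z)) | x y z. T3 \<in> F \<and> distinct [x,y,z] \<and>
        (x,y) \<in> parcs G \<and> (y,z) \<in> parcs G \<and> (z,x) \<in> parcs G}\<rparr>"

text \<open>Strong components are identified with their vertex sets.\<close>

definition reverse_topological :: "'v pair_pre_digraph \<Rightarrow> 'v set list \<Rightarrow> bool" where
  "reverse_topological D Ss \<longleftrightarrow>
     distinct Ss \<and> set Ss = pre_digraph.sccs_verts (with_proj D) \<and>
     (\<forall>i j. i < length Ss \<and> j < length Ss \<and>
        (\<exists>u \<in> Ss ! i. \<exists>v \<in> Ss ! j. u \<rightarrow>\<^sup>*\<^bsub>with_proj D\<^esub> v) \<longrightarrow> j \<le> i)"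

definition dual :: "('a \<times> 'a) set \<Rightarrow> ('a \<times> 'a) set" where
  "dual S = prod.swap ` S"

datatype 'a result =
    Self_Dual "('a \<times> 'a) set"
  | Colouring "('a \<times> 'a) \<rightharpoonup> bool"

fun process_components :: "('a \<times> 'a) set list \<Rightarrow> (('a \<times> 'a) \<rightharpoonup> bool) \<Rightarrow> 'a result" where
  "process_components [] m = Colouring m"
| "process_components (S # Ss) m =
    (if S = dual S then Self_Dual S
     else if \<forall>v\<in>S. m v = None then
       process_components Ss
         (\<lambda>v. if v \<in> S then Some True else if v \<in> dual S then Some False else m v)
     else process_components Ss m)"

text \<open>What the algorithm may return, irrespective of how the strong components are
  generated; ties in the reverse topological order are broken arbitrarily.\<close>

definition algorithm1_outcome ::
    "'a pair_pre_digraph \<Rightarrow> nat pair_pre_digraph set \<Rightarrow> 'a result \<Rightarrow> bool" where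
  "algorithm1_outcome G F r \<longleftrightarrow>
     (\<exists>Ss. reverse_topological (constraint_digraph G F) Ss \<and>
           r = process_components Ss Map.empty)"

definition orient ::
    "'a pair_pre_digraph \<Rightarrow> (('a \<times> 'a) \<rightharpoonup> bool) \<Rightarrow> 'a pair_pre_digraph" where
  "orient G m = \<lparr>pverts = pverts G, parcs = {a \<in> parcs G. m a = Some True}\<rparr>"


section \<open>Random access machines\<close>

text \<open>RAM programs in structured form. The memory consists of named banks of cells addressed
  by natural numbers; each program names finitely many banks, and a scalar variable is cell 0
  of its bank. The only arithmetic operations are addition and truncated subtraction, so the
  bit length of the numbers grows by at most one per operation, as usual for RAMs with unit
  cost.

  The running time is parameterised by the cost \<open>w v\<close> of handling a number \<open>v\<close>. With
  \<open>unit_cost\<close> every evaluation of an operator, constant or memory cell and every store and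
  test takes constant time. With \<open>log_cost\<close> each evaluation is charged the bit length of the
  resulting number (for a memory access, of the address and the content), so that
  polynomial time means polynomial time in bit operations.\<close>

type_synonym vname = string
type_synonym mem = "vname \<Rightarrow> nat \<Rightarrow> nat"

datatype aexp =
    N nat
  | Cell vname aexp  ("_\<langle>_\<rangle>" [1000, 0] 999)
  | Plus aexp aexp   (infixl "\<boxplus>" 65)
  | Minus aexp aexp  (infixl "\<boxminus>" 65)

datatype bexp =
    Eq aexp aexp     (infix "\<doteq>" 50)
  | Less aexp aexp   (infix "\<prec>" 50)
  | Neg bexp
  | Conj bexp bexp   (infixr "AND" 35)

datatype com =
    SKIP
  | Store vname aexp aexp  ("_\<langle>_\<rangle> ::= _" [1000, 0, 61] 61)
  | Seq com com            (infixr ";;" 60)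
  | If bexp com com        ("(IF _/ THEN _/ ELSE _)" [0, 0, 61] 61)
  | While bexp com         ("(WHILE _/ DO _)" [0, 61] 61)

abbreviation V :: "vname \<Rightarrow> aexp" where
  "V x \<equiv> Cell x (N 0)"

abbreviation Assign :: "vname \<Rightarrow> aexp \<Rightarrow> com" ("_ ::= _" [1000, 61] 61) where
  "x ::= e \<equiv> Store x (N 0) e"

primrec aval :: "aexp \<Rightarrow> mem \<Rightarrow> nat" where
  "aval (N k) s = k"
| "aval (Cell x a) s = s x (aval a s)"
| "aval (Plus a b) s = aval a s + aval b s"
| "aval (Minus a b) s = aval a s - aval b s"

primrec bval :: "bexp \<Rightarrow> mem \<Rightarrow> bool" where
  "bval (Eq a b) s \<longleftrightarrow> aval a s = aval b s"
| "bval (Less a b) s \<longleftrightarrow> aval a s < aval b s"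
| "bval (Neg b) s \<longleftrightarrow> \<not> bval b s"
| "bval (Conj b c) s \<longleftrightarrow> bval b s \<and> bval c s"

primrec acost :: "(nat \<Rightarrow> nat) \<Rightarrow> aexp \<Rightarrow> mem \<Rightarrow> nat" where
  "acost w (N k) s = w k"
| "acost w (Cell x a) s = acost w a s + w (s x (aval a s))"
| "acost w (Plus a b) s = acost w a s + acost w b s + w (aval a s + aval b s)"
| "acost w (Minus a b) s = acost w a s + acost w b s + w (aval a s - aval b s)"

primrec bcost :: "(nat \<Rightarrow> nat) \<Rightarrow> bexp \<Rightarrow> mem \<Rightarrow> nat" where
  "bcost w (Eq a b) s = acost w a s + acost w b s + 1"
| "bcost w (Less a b) s = acost w a s + acost w b s + 1"
| "bcost w (Neg b) s = bcost w b s + 1"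
| "bcost w (Conj b c) s = bcost w b s + bcost w c s + 1"

text \<open>\<open>exec w c s t s'\<close>: started in memory \<open>s\<close>, the program \<open>c\<close> terminates after time \<open>t\<close> in
  memory \<open>s'\<close>.\<close>

inductive exec :: "(nat \<Rightarrow> nat) \<Rightarrow> com \<Rightarrow> mem \<Rightarrow> nat \<Rightarrow> mem \<Rightarrow> bool"
  for w :: "nat \<Rightarrow> nat" where
  Skip: "exec w SKIP s 1 s"
| Store: "exec w (Store x i e) s (acost w i s + acost w e s + 1)
            (s(x := (s x)(aval i s := aval e s)))"
| Seq: "exec w c1 s1 t1 s2 \<Longrightarrow> exec w c2 s2 t2 s3 \<Longrightarrow> exec w (c1;; c2) s1 (t1 + t2) s3"
| IfTrue: "bval b s \<Longrightarrow> exec w c1 s t s' \<Longrightarrow>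
    exec w (IF b THEN c1 ELSE c2) s (bcost w b s + t) s'"
| IfFalse: "\<not> bval b s \<Longrightarrow> exec w c2 s t s' \<Longrightarrow>
    exec w (IF b THEN c1 ELSE c2) s (bcost w b s + t) s'"
| WhileFalse: "\<not> bval b s \<Longrightarrow> exec w (WHILE b DO c) s (bcost w b s) s"
| WhileTrue: "bval b s1 \<Longrightarrow> exec w c s1 t1 s2 \<Longrightarrow> exec w (WHILE b DO c) s2 t2 s3 \<Longrightarrow>
    exec w (WHILE b DO c) s1 (bcost w b s1 + t1 + t2) s3"

inductive_cases SkipE: "exec w SKIP s t s'"
inductive_cases StoreE: "exec w (Store x i e) s t s'"
inductive_cases SeqE: "exec w (c1;; c2) s t s'"
inductive_cases IfE: "exec w (IF b THEN c1 ELSE c2) s t s'"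
inductive_cases WhileE: "exec w (WHILE b DO c) s t s'"

lemma exec_deterministic:
  "exec w c s t s' \<Longrightarrow> exec w c s u s'' \<Longrightarrow> t = u \<and> s' = s''"
proof (induction arbitrary: u s'' rule: exec.induct)
  case (Seq c1 s1 t1 s2 c2 t2 s3)
  from Seq.prems Seq.IH show ?case by (blast elim: SeqE)
next
  case (IfTrue b s c1 t s' c2)
  from IfTrue.prems IfTrue.hyps IfTrue.IH show ?case by (blast elim: IfE)
next
  case (IfFalse b s c2 t s' c1)
  from IfFalse.prems IfFalse.hyps IfFalse.IH show ?case by (blast elim: IfE)
next
  case (WhileFalse b s c)
  from WhileFalse.prems WhileFalse.hyps show ?case by (blast elim: WhileE)
next
  case (WhileTrue b s1 c t1 s2 t2 s3)
  from WhileTrue.prems WhileTrue.hyps WhileTrue.IH show ?case by (blast elim: WhileE)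
qed (auto elim: SkipE StoreE)

definition unit_cost :: "nat \<Rightarrow> nat" where
  "unit_cost v = 1"

definition log_cost :: "nat \<Rightarrow> nat" where
  "log_cost v = floor_log v + 1"


section \<open>The class P\<close>

definition word_mem :: "bool list \<Rightarrow> mem" where
  "word_mem u = (\<lambda>x i.
     if x = ''in'' \<and> i < length u then of_bool (u ! i)
     else if x = ''len'' \<and> i = 0 then length u
     else 0)"

definition class_P :: "bool list set set" where
  "class_P = {L. \<exists>c (p :: nat poly). \<forall>u. \<exists>t s.
     exec log_cost c (word_mem u) t s \<and> t \<le> poly p (length u) \<and>
     s ''out'' 0 = (if u \<in> L then 1 else 0)}"

text \<open>Four bits for \<open>F\<close>, followed by the rows of the adjacency matrix of a graph on
  \<open>{..<n}\<close>; the length of the word determines \<open>n\<close>.\<close>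

definition encode :: "nat \<Rightarrow> nat pair_pre_digraph \<Rightarrow> nat pair_pre_digraph set \<Rightarrow> bool list" where
  "encode n G F = [B1 \<in> F, B2 \<in> F, B3 \<in> F, T3 \<in> F] @
     map (\<lambda>i. (i div n, i mod n) \<in> parcs G) [0..<n * n]"

definition free_orientation_problem :: "bool list set" where
  "free_orientation_problem = {encode n G F | n G F.
     pair_graph G \<and> pverts G = {..<n} \<and> F \<subseteq> {B1, B2, B3, T3} \<and>
     (\<exists>D. F_free_orientation G F D)}"


section \<open>The algorithm as a RAM program\<close>

definition input_mem :: "nat \<Rightarrow> nat pair_pre_digraph \<Rightarrow> nat pair_pre_digraph set \<Rightarrow> mem" where
  "input_mem n G F = (\<lambda>x i.
     if x = ''n'' \<and> i = 0 then n
     else if x = ''adj'' \<and> i < n * n then of_bool ((i div n, i mod n) \<in> parcs G)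
     else if x = ''F'' \<and> i < 4 then of_bool ([B1, B2, B3, T3] ! i \<in> F)
     else 0)"

definition FOR :: "vname \<Rightarrow> aexp \<Rightarrow> com \<Rightarrow> com" where
  "FOR i b c = (i ::= N 0;; WHILE V i \<prec> b DO (c;; i ::= V i \<boxplus> N 1))"

text \<open>The vertex \<open>(x,y)\<close> of the constraint digraph is numbered \<open>x * n + y\<close>; \<open>row\<close> holds the
  multiples of \<open>n\<close>, and \<open>rev\<close> maps the number of \<open>(x,y)\<close> to that of \<open>(y,x)\<close>.\<close>

definition pair :: "vname \<Rightarrow> vname \<Rightarrow> aexp" where
  "pair x y = ''row''\<langle>V x\<rangle> \<boxplus> V y"

definition edge :: "vname \<Rightarrow> vname \<Rightarrow> bexp" where
  "edge x y = (''adj''\<langle>pair x y\<rangle> \<doteq> N 1)"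

definition initialise :: com where
  "initialise =
    (''size'' ::= N 0;;
     FOR ''x'' (V ''n'')
       (''row''\<langle>V ''x''\<rangle> ::= V ''size'';;
        ''size'' ::= V ''size'' \<boxplus> V ''n'');;
     FOR ''x'' (V ''n'') (FOR ''y'' (V ''n'')
       (''rev''\<langle>pair ''x'' ''y''\<rangle> ::= pair ''y'' ''x''));;
     FOR ''v'' (V ''size'')
       (''first''\<langle>V ''v''\<rangle> ::= N 0;;
        ''num''\<langle>V ''v''\<rangle> ::= N 0;;
        ''comp''\<langle>V ''v''\<rangle> ::= N 0;;
        ''mark''\<langle>V ''v''\<rangle> ::= N 0))"

text \<open>The arcs are numbered from 1. The out-arcs of \<open>v\<close> form a linked list that starts with
  arc \<open>first v\<close>; arc \<open>e\<close> ends in \<open>target e\<close> and is followed by arc \<open>next e\<close>, 0 being the end of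
  the list. An arc that arises from several triples \<open>(x,y,z)\<close> is listed repeatedly.\<close>

definition add_arc :: "aexp \<Rightarrow> aexp \<Rightarrow> com" where
  "add_arc u v =
    (''arcs'' ::= V ''arcs'' \<boxplus> N 1;;
     ''target''\<langle>V ''arcs''\<rangle> ::= v;;
     ''next''\<langle>V ''arcs''\<rangle> ::= ''first''\<langle>u\<rangle>;;
     ''first''\<langle>u\<rangle> ::= V ''arcs'')"

definition construct_constraint_digraph :: com where
  "construct_constraint_digraph =
    (''arcs'' ::= N 0;;
     FOR ''x'' (V ''n'') (FOR ''y'' (V ''n'') (FOR ''z'' (V ''n'')
       (IF edge ''x'' ''y'' AND edge ''y'' ''z'' AND Neg (V ''x'' \<doteq> V ''z'') THEN
         (IF edge ''z'' ''x'' THEN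
           (IF ''F''\<langle>N 3\<rangle> \<doteq> N 1 THEN
              (add_arc (pair ''x'' ''y'') (pair ''y'' ''z'');;
               add_arc (pair ''y'' ''x'') (pair ''x'' ''z''))
            ELSE SKIP)
          ELSE
           ((IF ''F''\<langle>N 0\<rangle> \<doteq> N 1 THEN
              add_arc (pair ''x'' ''y'') (pair ''y'' ''z'')
            ELSE SKIP);;
           (IF ''F''\<langle>N 1\<rangle> \<doteq> N 1 THEN
              add_arc (pair ''y'' ''x'') (pair ''z'' ''y'')
            ELSE SKIP);;
           (IF ''F''\<langle>N 2\<rangle> \<doteq> N 1 THEN
              (add_arc (pair ''x'' ''y'') (pair ''z'' ''y'');;
               add_arc (pair ''y'' ''x'') (pair ''y'' ''z''))
            ELSE SKIP)))
        ELSE SKIP))))"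

text \<open>Tarjan's algorithm with an explicit call stack \<open>call\<close> of height \<open>depth\<close>.
  \<open>stack\<close> (of height \<open>height\<close>) is Tarjan's stack, \<open>num\<close> the visiting order (0 if unvisited),
  \<open>low\<close> the low-link, and \<open>todo v\<close> the next arc to be explored from \<open>v\<close>. The strong components
  are numbered \<open>1, ..., comps\<close> in the order in which they are generated, \<open>comp v\<close> being that
  of \<open>v\<close> (0 if not yet generated); \<open>member\<close> lists the vertices by component, those of
  component \<open>k\<close> at the positions from \<open>start k\<close> up to but excluding \<open>start (k + 1)\<close>.\<close>

definition visit :: "vname \<Rightarrow> com" where
  "visit u =
    (''clock'' ::= V ''clock'' \<boxplus> N 1;;
     ''num''\<langle>V u\<rangle> ::= V ''clock'';;
     ''low''\<langle>V u\<rangle> ::= V ''clock'';;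
     ''todo''\<langle>V u\<rangle> ::= ''first''\<langle>V u\<rangle>;;
     ''stack''\<langle>V ''height''\<rangle> ::= V u;;
     ''height'' ::= V ''height'' \<boxplus> N 1;;
     ''call''\<langle>V ''depth''\<rangle> ::= V u;;
     ''depth'' ::= V ''depth'' \<boxplus> N 1)"

definition lower :: "vname \<Rightarrow> aexp \<Rightarrow> com" where
  "lower v e =
    (IF e \<prec> ''low''\<langle>V v\<rangle> THEN ''low''\<langle>V v\<rangle> ::= e ELSE SKIP)"

definition explore_arc :: com where
  "explore_arc =
    (''u'' ::= ''target''\<langle>V ''e''\<rangle>;;
     ''todo''\<langle>V ''v''\<rangle> ::= ''next''\<langle>V ''e''\<rangle>;;
     IF ''num''\<langle>V ''u''\<rangle> \<doteq> N 0 THEN visit ''u''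
     ELSE IF ''comp''\<langle>V ''u''\<rangle> \<doteq> N 0 THEN lower ''v'' (''num''\<langle>V ''u''\<rangle>)
     ELSE SKIP)"

definition pop_component :: com where
  "pop_component =
    (''comps'' ::= V ''comps'' \<boxplus> N 1;;
     ''start''\<langle>V ''comps''\<rangle> ::= V ''members'';;
     WHILE ''comp''\<langle>V ''v''\<rangle> \<doteq> N 0 DO
       (''height'' ::= V ''height'' \<boxminus> N 1;;
        ''u'' ::= ''stack''\<langle>V ''height''\<rangle>;;
        ''comp''\<langle>V ''u''\<rangle> ::= V ''comps'';;
        ''member''\<langle>V ''members''\<rangle> ::= V ''u'';;
        ''members'' ::= V ''members'' \<boxplus> N 1);;
     ''start''\<langle>V ''comps'' \<boxplus> N 1\<rangle> ::= V ''members'')"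

definition finish_vertex :: com where
  "finish_vertex =
    (''depth'' ::= V ''depth'' \<boxminus> N 1;;
     (IF ''low''\<langle>V ''v''\<rangle> \<doteq> ''num''\<langle>V ''v''\<rangle> THEN pop_component ELSE SKIP);;
     IF N 0 \<prec> V ''depth'' THEN
       (''p'' ::= ''call''\<langle>V ''depth'' \<boxminus> N 1\<rangle>;;
        lower ''p'' (''low''\<langle>V ''v''\<rangle>))
     ELSE SKIP)"

definition tarjan :: com where
  "tarjan =
    (''clock'' ::= N 0;; ''height'' ::= N 0;; ''depth'' ::= N 0;;
     ''comps'' ::= N 0;; ''members'' ::= N 0;;
     FOR ''r'' (V ''size'')
       (IF ''adj''\<langle>V ''r''\<rangle> \<doteq> N 1 AND ''num''\<langle>V ''r''\<rangle> \<doteq> N 0 THEN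
         (visit ''r'';;
          WHILE N 0 \<prec> V ''depth'' DO
            (''v'' ::= ''call''\<langle>V ''depth'' \<boxminus> N 1\<rangle>;;
             ''e'' ::= ''todo''\<langle>V ''v''\<rangle>;;
             IF V ''e'' \<doteq> N 0 THEN finish_vertex ELSE explore_arc))
        ELSE SKIP))"

text \<open>The marks are 1 for true, 2 for false and 0 for unmarked. A strong component equals
  its dual iff it contains the reverse of its first member. The number of the component
  at which the algorithm stops is stored in \<open>fail\<close>.\<close>

definition mark_component :: com where
  "mark_component =
    (''i'' ::= ''start''\<langle>V ''k''\<rangle>;;
     WHILE V ''i'' \<prec> ''start''\<langle>V ''k'' \<boxplus> N 1\<rangle> DO
       (''v'' ::= ''member''\<langle>V ''i''\<rangle>;;
        ''mark''\<langle>V ''v''\<rangle> ::= N 1;;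
        ''mark''\<langle>''rev''\<langle>V ''v''\<rangle>\<rangle> ::= N 2;;
        ''i'' ::= V ''i'' \<boxplus> N 1))"

definition process :: com where
  "process =
    (''fail'' ::= N 0;;
     ''k'' ::= N 1;;
     WHILE V ''k'' \<prec> V ''comps'' \<boxplus> N 1 AND V ''fail'' \<doteq> N 0 DO
       (''v'' ::= ''member''\<langle>''start''\<langle>V ''k''\<rangle>\<rangle>;;
        (IF ''comp''\<langle>''rev''\<langle>V ''v''\<rangle>\<rangle> \<doteq> V ''k'' THEN ''fail'' ::= V ''k''
         ELSE IF ''mark''\<langle>V ''v''\<rangle> \<doteq> N 0 THEN mark_component
         ELSE SKIP);;
        ''k'' ::= V ''k'' \<boxplus> N 1))"

definition algorithm1 :: com where
  "algorithm1 = (initialise;; construct_constraint_digraph;; tarjan;; process)"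

definition read_result :: "nat \<Rightarrow> mem \<Rightarrow> nat result" where
  "read_result n s =
    (if s ''fail'' 0 \<noteq> 0 then
       Self_Dual {(x,y). x < n \<and> y < n \<and> s ''comp'' (x * n + y) = s ''fail'' 0}
     else Colouring (\<lambda>(x,y).
       if x < n \<and> y < n \<and> s ''mark'' (x * n + y) \<noteq> 0
       then Some (s ''mark'' (x * n + y) = 1) else None))"

end

(* An orientation is F-free iff the set of its arcs is closed under the arcs of the constraint
   digraph, so finding one is an instance of 2-satisfiability in which reversal of pairs plays the role
   of negation. Reversal is an anti-automorphism of the constraint digraph. Hence a component equal to
   its dual contains an edge in both directions, which excludes an orientation; otherwise marking
   components in reverse topological order marks a vertex true only after everything reachable
   from it has been marked, and by duality it has been marked true.

   For the program, a component is popped from Tarjan's stack when the low-link of a vertex v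
   equals its visiting number: then no open vertex below v is reachable from v, since the path
   would have to leave the segment above v by an explored arc, which would have lowered the low-link.
   Running times are bounded by potentials; the cubic bound reflects that there are at most 4n^3
   arcs. In unit time t all numbers have at most t more bits than initially, which
   bounds the logarithmic cost by a polynomial in the unit cost. *)
theory Submission imports Defs
begin

section \<open>Reasoning about RAM programs\<close>

text \<open>The obstacle is the distance between a nondeterministic specification and one concrete
  program. Three interfaces bridge it. Correctness of an outcome is a statement about positions in
  an arbitrary reverse topological list, so the program only has to produce some such list. Tarjan's
  algorithm is a transition system on functions over an arbitrary vertex type; instead of a
  depth-first tree its invariants use the segments into which the call stack, sorted by visiting
  number, cuts the open vertices. The marking phase is compared with
  \<open>process_components\<close> through the result that the remaining abstract run would still
  produce. Time is an argument of every postcondition, so that one pass through the program yields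
  functional correctness, termination and the bound. Constants are rounded up generously; only the
  exponents matter. For membership in P the graph has to be recovered from a word of bits, although
  the machine can neither multiply nor take roots.\<close>

definition runs :: "com \<Rightarrow> mem \<Rightarrow> (nat \<Rightarrow> mem \<Rightarrow> bool) \<Rightarrow> bool" where
  "runs c s Q \<longleftrightarrow> (\<exists>t s'. exec unit_cost c s t s' \<and> Q t s')"

text \<open>The banks that a program may write, as a syntactic superset; frame conditions are stated
  with it.\<close>

primrec mods :: "com \<Rightarrow> vname set" where
  "mods SKIP = {}"
| "mods (Store x i e) = {x}"
| "mods (Seq c1 c2) = mods c1 \<union> mods c2"
| "mods (If b c1 c2) = mods c1 \<union> mods c2"
| "mods (While b c) = mods c"

lemma exec_mods: "exec w c s t s' \<Longrightarrow> x \<notin> mods c \<Longrightarrow> s' x = s x"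
  by (induction rule: exec.induct) auto

text \<open>Weakening also hands over the frame condition, so postconditions can be confined to the
  banks that change.\<close>

lemma runs_conseq:
  assumes "runs c s Q" "\<And>t s'. Q t s' \<Longrightarrow> (\<And>x. x \<notin> mods c \<Longrightarrow> s' x = s x) \<Longrightarrow> R t s'"
  shows "runs c s R"
  using assms exec_mods unfolding runs_def by metis

declare acost.simps [simp del]

lemma acost_unit [simp]:
  "acost unit_cost (N k) s = 1"
  "acost unit_cost (Cell x a) s = acost unit_cost a s + 1"
  "acost unit_cost (Plus a b) s = acost unit_cost a s + acost unit_cost b s + 1"
  "acost unit_cost (Minus a b) s = acost unit_cost a s + acost unit_cost b s + 1"
  by (simp_all add: acost.simps unit_cost_def)

text \<open>Keeps the simplifier from executing the rest of a program before its initial state is known.\<close>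

lemma runs_weak_cong [cong]: "c = c' \<Longrightarrow> s = s' \<Longrightarrow> runs c s Q \<longleftrightarrow> runs c' s' Q"
  by simp

lemma runsE:
  assumes "runs c s Q"
  obtains t s' where "exec unit_cost c s t s'" "Q t s'" "\<And>x. x \<notin> mods c \<Longrightarrow> s' x = s x"
  using assms exec_mods unfolding runs_def by metis

lemma runsI: "exec unit_cost c s t s' \<Longrightarrow> Q t s' \<Longrightarrow> runs c s Q"
  unfolding runs_def by blast

lemma runs_Skip [simp]: "runs SKIP s Q \<longleftrightarrow> Q 1 s"
  unfolding runs_def by (metis exec.Skip SkipE)

lemma runs_Store [simp]:
  "runs (Store x i e) s Q \<longleftrightarrow>
    Q (acost unit_cost i s + acost unit_cost e s + 1) (s(x := (s x)(aval i s := aval e s)))"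
  unfolding runs_def by (metis exec.Store StoreE)

lemma runs_Seq [simp]:
  "runs (c1;; c2) s Q \<longleftrightarrow> runs c1 s (\<lambda>t1 s1. runs c2 s1 (\<lambda>t2 s2. Q (t1 + t2) s2))"
  unfolding runs_def by (blast intro: exec.Seq elim: SeqE)

lemma runs_If [simp]:
  "runs (IF b THEN c1 ELSE c2) s Q \<longleftrightarrow>
    (if bval b s then runs c1 s (\<lambda>t. Q (bcost unit_cost b s + t))
     else runs c2 s (\<lambda>t. Q (bcost unit_cost b s + t)))"
  unfolding runs_def
  by (cases "bval b s") (auto intro: exec.IfTrue exec.IfFalse, (blast elim: IfE)+)

lemma bcost_unit_pos: "0 < bcost unit_cost b s"
  by (cases b) auto

text \<open>The potential \<open>\<Phi>\<close> both bounds the running time and ensures termination.\<close>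

lemma runs_While:
  assumes "I s"
    and step: "\<And>s'. I s' \<Longrightarrow> bval b s' \<Longrightarrow> (\<And>x. x \<notin> mods c \<Longrightarrow> s' x = s x) \<Longrightarrow>
      runs c s' (\<lambda>t s''. I s'' \<and> bcost unit_cost b s' + t + \<Phi> s'' \<le> \<Phi> s')"
  shows "runs (WHILE b DO c) s
    (\<lambda>t s'. I s' \<and> \<not> bval b s' \<and> t + \<Phi> s' \<le> \<Phi> s + bcost unit_cost b s')"
proof -
  have "\<exists>t s''. exec unit_cost (WHILE b DO c) s' t s'' \<and> I s'' \<and> \<not> bval b s'' \<and>
      t + \<Phi> s'' \<le> \<Phi> s' + bcost unit_cost b s''"
    if "I s'" "\<And>x. x \<notin> mods c \<Longrightarrow> s' x = s x" for s'
    using that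
  proof (induction "\<Phi> s'" arbitrary: s' rule: less_induct)
    case less
    show ?case
    proof (cases "bval b s'")
      case True
      from step[OF less.prems(1) True less.prems(2)]
      obtain t1 s1 where 1: "exec unit_cost c s' t1 s1" "I s1"
          "bcost unit_cost b s' + t1 + \<Phi> s1 \<le> \<Phi> s'"
        unfolding runs_def by blast
      have "\<And>x. x \<notin> mods c \<Longrightarrow> s1 x = s x"
        using exec_mods[OF 1(1)] less.prems(2) by simp
      \<comment> \<open>Evaluating the guard costs at least one unit, hence the drop is strict and
        the induction well-founded.\<close>
      moreover have "\<Phi> s1 < \<Phi> s'" using 1(3) bcost_unit_pos[of b s'] by simp
      ultimately obtain t2 s2 where 2: "exec unit_cost (WHILE b DO c) s1 t2 s2" "I s2"
          "\<not> bval b s2" "t2 + \<Phi> s2 \<le> \<Phi> s1 + bcost unit_cost b s2"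
        using less.hyps[of s1] 1(2) by blast
      with 1 True show ?thesis
        by (intro exI[of _ "bcost unit_cost b s' + t1 + t2"] exI[of _ s2])
          (auto intro: exec.WhileTrue)
    next
      case False
      then show ?thesis using less.prems exec.WhileFalse[OF False, of unit_cost c]
        by (metis add.commute order_refl)
    qed
  qed
  with assms(1) show ?thesis unfolding runs_def by blast
qed

text \<open>\<open>P k\<close> describes the memory just after the counter was set to
  \<open>k\<close>. An iteration may take \<open>T\<close> units more than the potential releases.
  Guard and increment cost 5 + 6 = 11, the first store and the last guard 3 + 5 = 8. The bound of
  the loop is a variable and is read again in each round, so the body must not write it.\<close>

lemma runs_FOR:
  assumes "x \<noteq> i" and x: "x \<notin> mods c" and m: "s x 0 = m"
    and init: "P 0 (s(i := (s i)(0 := 0)))"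
    and \<Phi>: "\<And>s k. \<Phi> (s(i := (s i)(0 := k))) = \<Phi> s"
    and step: "\<And>k s'. P k s' \<Longrightarrow> s' i 0 = k \<Longrightarrow> k < m \<Longrightarrow> s' x 0 = m \<Longrightarrow>
      (\<And>y. y \<notin> mods c \<union> {i} \<Longrightarrow> s' y = s y) \<Longrightarrow>
      runs c s' (\<lambda>t s''. s'' i 0 = k \<and> P (Suc k) (s''(i := (s'' i)(0 := Suc k))) \<and>
        t + \<Phi> s'' \<le> \<Phi> s' + T)"
  shows "runs (FOR i (V x) c) s
    (\<lambda>t s'. P m s' \<and> s' i 0 = m \<and> t + \<Phi> s' \<le> \<Phi> s + 8 + m * (T + 11))"
proof -
  let ?s = "s(i := (s i)(0 := 0))" and ?b = "V i \<prec> V x"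
  let ?I = "\<lambda>s'. P (s' i 0) s' \<and> s' i 0 \<le> m"
  let ?\<Phi> = "\<lambda>s'. \<Phi> s' + (m - s' i 0) * (T + 11)"
  have "runs (WHILE ?b DO (c;; i ::= V i \<boxplus> N 1)) ?s
    (\<lambda>t s'. ?I s' \<and> \<not> bval ?b s' \<and> t + ?\<Phi> s' \<le> ?\<Phi> ?s + bcost unit_cost ?b s')"
  proof (rule runs_While)
    show "?I ?s" using init by simp
  next
    fix s' assume I: "?I s'" and b: "bval ?b s'"
      and fr: "\<And>y. y \<notin> mods (c;; i ::= V i \<boxplus> N 1) \<Longrightarrow> s' y = ?s y"
    have sx: "s' x 0 = m" using fr[of x] x m \<open>x \<noteq> i\<close> by simp
    with b have lt: "s' i 0 < m" by simp
    have fr': "s' y = s y" if "y \<notin> mods c \<union> {i}" for y using fr[of y] that by simp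
    from step[OF conjunct1[OF I] refl lt sx fr'] lt
    show "runs (c;; i ::= V i \<boxplus> N 1) s'
        (\<lambda>t s''. ?I s'' \<and> bcost unit_cost ?b s' + t + ?\<Phi> s'' \<le> ?\<Phi> s')"
    proof (simp, elim runs_conseq, goal_cases)
      case (1 t s'')
      have "(m - s' i 0) * (T + 11) = (m - Suc (s' i 0)) * (T + 11) + (T + 11)"
        using lt by (metis Suc_diff_Suc add.commute mult_Suc)
      with 1 show ?case by (simp add: \<Phi>)
    qed
  qed
  then have "runs (WHILE ?b DO (c;; i ::= V i \<boxplus> N 1)) ?s
    (\<lambda>t s'. P m s' \<and> s' i 0 = m \<and> t + \<Phi> s' \<le> \<Phi> s + 5 + m * (T + 11))"
  proof (rule runs_conseq, goal_cases)
    case (1 t s')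
    have "s' x 0 = m" using 1(2)[of x] x m \<open>x \<noteq> i\<close> by simp
    with 1(1) show ?case by (auto simp: \<Phi>)
  qed
  then show ?thesis unfolding FOR_def by (auto elim!: runs_conseq)
qed

lemma mods_FOR [simp]: "mods (FOR i b c) = insert i (mods c)"
  by (auto simp: FOR_def)

section \<open>From unit cost to logarithmic cost\<close>

text \<open>Besides the memory, the constants of a program are the only source of large numbers, so
  they enter the bound on bit lengths.\<close>

primrec aconsts :: "aexp \<Rightarrow> nat set" where
  "aconsts (N k) = {k}"
| "aconsts (Cell x a) = aconsts a"
| "aconsts (Plus a b) = aconsts a \<union> aconsts b"
| "aconsts (Minus a b) = aconsts a \<union> aconsts b"

primrec bconsts :: "bexp \<Rightarrow> nat set" where
  "bconsts (Eq a b) = aconsts a \<union> aconsts b"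
| "bconsts (Less a b) = aconsts a \<union> aconsts b"
| "bconsts (Neg b) = bconsts b"
| "bconsts (Conj b c) = bconsts b \<union> bconsts c"

primrec cconsts :: "com \<Rightarrow> nat set" where
  "cconsts SKIP = {}"
| "cconsts (Store x i e) = aconsts i \<union> aconsts e"
| "cconsts (Seq c1 c2) = cconsts c1 \<union> cconsts c2"
| "cconsts (If b c1 c2) = bconsts b \<union> cconsts c1 \<union> cconsts c2"
| "cconsts (While b c) = bconsts b \<union> cconsts c"

lemma finite_aconsts: "finite (aconsts a)" by (induction a) auto
lemma finite_bconsts: "finite (bconsts b)" by (induction b) (auto simp: finite_aconsts)
lemma finite_cconsts: "finite (cconsts c)"
  by (induction c) (auto simp: finite_aconsts finite_bconsts)

lemma log_cost_le:
  assumes "v < 2 ^ K"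
  shows "log_cost v \<le> K + 1"
proof (cases "v = 0")
  case False
  then have "2 ^ floor_log v \<le> v" by (simp add: floor_log_exp2_le)
  from le_less_trans[OF this assms] have "(2::nat) ^ floor_log v < 2 ^ K" .
  then show ?thesis by (simp add: log_cost_def)
qed (simp add: log_cost_def floor_log.simps)

lemma less_power_mono: "v < 2 ^ K \<Longrightarrow> K \<le> M \<Longrightarrow> v < (2::nat) ^ M"
  by (erule less_le_trans) (simp add: power_increasing)

lemma mult_cost_mono: "c \<le> a * (K + a + 1) \<Longrightarrow> a \<le> (M::nat) \<Longrightarrow> c \<le> a * (K + M + 1)"
  by (meson add_le_mono1 add_mono_thms_linordered_semiring(2) le_trans mult_le_mono2)

text \<open>An addition yields at most one more bit than its larger operand and is charged one unit
  itself, so the exponent \<open>K\<close> plus unit cost absorbs it. The unit cost counts the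
  evaluations; multiplied by the largest possible bit length it bounds the logarithmic cost.\<close>

lemma aval_acost_log:
  assumes "\<forall>x i. s x i < 2 ^ K" "\<forall>k \<in> aconsts e. k < 2 ^ K"
  shows "aval e s < 2 ^ (K + acost unit_cost e s) \<and>
    acost log_cost e s \<le> acost unit_cost e s * (K + acost unit_cost e s + 1)"
  using assms(2)
proof (induction e)
  case (N k)
  then have "k < 2 ^ (K + 1)" by simp
  then show ?case using log_cost_le[of k "K + 1"] by (simp add: acost.simps(1)[of log_cost])
next
  case (Cell x a)
  let ?v = "s x (aval a s)"
  define u where "u = acost unit_cost a s"
  have v: "?v < 2 ^ K" using assms(1) by blast
  have "acost log_cost a s \<le> u * (K + u + 1)"
    using Cell by (simp add: u_def)
  then have "acost log_cost a s \<le> u * (K + (u + 1) + 1)" by (rule mult_cost_mono) simp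
  with log_cost_le[OF v]
  have "acost log_cost a s + log_cost ?v \<le> (u + 1) * (K + (u + 1) + 1)" by simp
  moreover have "?v < 2 ^ (K + (u + 1))" by (rule less_power_mono[OF v]) simp
  ultimately show ?case by (simp only: acost.simps(2)[of log_cost] acost_unit aval.simps u_def[symmetric])
next
  case (Plus a b)
  define u v where "u = acost unit_cost a s" "v = acost unit_cost b s"
  let ?M = "K + (u + v + 1)"
  have "aval a s < 2 ^ (K + u)" "acost log_cost a s \<le> u * (K + u + 1)"
    "aval b s < 2 ^ (K + v)" "acost log_cost b s \<le> v * (K + v + 1)"
    using Plus by (simp_all add: u_v_def)
  then have a: "aval a s < 2 ^ (K + u)" "acost log_cost a s \<le> u * (?M + 1)"
    and b: "aval b s < 2 ^ (K + v)" "acost log_cost b s \<le> v * (?M + 1)"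
    by (blast intro: mult_cost_mono le_add1 le_add2 order_trans)+
  have "aval a s < 2 ^ (K + u + v)" "aval b s < 2 ^ (K + u + v)"
    by (rule less_power_mono[OF a(1)], simp) (rule less_power_mono[OF b(1)], simp)
  \<comment> \<open>Twice a power of two; the extra exponent is the unit charged for the
    addition.\<close>
  then have lt: "aval a s + aval b s < 2 ^ ?M" by (simp add: add.assoc[symmetric])
  with log_cost_le[OF lt] a(2) b(2)
  have "acost log_cost a s + acost log_cost b s + log_cost (aval a s + aval b s)
      \<le> u * (?M + 1) + v * (?M + 1) + (?M + 1)" by linarith
  also have "\<dots> = (u + v + 1) * (?M + 1)" by (simp add: algebra_simps)
  finally show ?case using lt
    by (simp only: acost.simps(3)[of log_cost] acost_unit aval.simps u_v_def[symmetric])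
next
  case (Minus a b)
  define u v where "u = acost unit_cost a s" "v = acost unit_cost b s"
  let ?M = "K + (u + v + 1)"
  have "aval a s < 2 ^ (K + u)" "acost log_cost a s \<le> u * (K + u + 1)"
    "acost log_cost b s \<le> v * (K + v + 1)"
    using Minus by (simp_all add: u_v_def)
  then have a: "aval a s < 2 ^ (K + u)" "acost log_cost a s \<le> u * (?M + 1)"
    and b: "acost log_cost b s \<le> v * (?M + 1)"
    by (blast intro: mult_cost_mono le_add1 le_add2 order_trans)+
  have "aval a s < 2 ^ ?M" by (rule less_power_mono[OF a(1)]) simp
  then have lt: "aval a s - aval b s < 2 ^ ?M" by (metis diff_le_self le_less_trans)
  with log_cost_le[OF lt] a(2) b
  have "acost log_cost a s + acost log_cost b s + log_cost (aval a s - aval b s)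
      \<le> u * (?M + 1) + v * (?M + 1) + (?M + 1)" by linarith
  also have "\<dots> = (u + v + 1) * (?M + 1)" by (simp add: algebra_simps)
  finally show ?case using lt
    by (simp only: acost.simps(4)[of log_cost] acost_unit aval.simps u_v_def[symmetric])
qed

lemma acost_log:
  assumes "\<forall>x i. s x i < 2 ^ K" "\<forall>k \<in> aconsts e. k < 2 ^ K" "acost unit_cost e s \<le> M"
  shows "acost log_cost e s \<le> acost unit_cost e s * (K + M + 1)"
  using aval_acost_log[OF assms(1,2)] assms(3) by (blast intro: mult_cost_mono)

lemma bcost_log:
  assumes "\<forall>x i. s x i < 2 ^ K" "\<forall>k \<in> bconsts b. k < 2 ^ K" "bcost unit_cost b s \<le> M"
  shows "bcost log_cost b s \<le> bcost unit_cost b s * (K + M + 1)"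
  using assms(2,3)
proof (induction b)
  case (Eq a b)
  then show ?case
    using acost_log[OF assms(1), of a M] acost_log[OF assms(1), of b M] by (simp add: add_mult_distrib)
next
  case (Less a b)
  then show ?case
    using acost_log[OF assms(1), of a M] acost_log[OF assms(1), of b M] by (simp add: add_mult_distrib)
qed (simp_all add: add_mult_distrib)

text \<open>In one unit of time the bit length of the largest number grows by at most one.\<close>

lemma exec_log_cost:
  assumes "exec unit_cost c s t s'" "\<forall>x i. s x i < 2 ^ K" "\<forall>k \<in> cconsts c. k < 2 ^ K"
  shows "\<exists>t'. exec log_cost c s t' s' \<and> t' \<le> t * (K + t + 1) \<and> (\<forall>x i. s' x i < 2 ^ (K + t))"
  using assms
proof (induction arbitrary: K rule: exec.induct)
  case (Skip s)
  have "\<forall>x i. s x i < 2 ^ (K + 1)" using Skip by (blast intro: less_power_mono le_add1)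
  moreover have "(1::nat) \<le> 1 * (K + 1 + 1)" by simp
  ultimately show ?case using exec.Skip by blast
next
  case (Store x i e s)
  let ?u = "acost unit_cost i s" and ?v = "acost unit_cost e s"
  let ?t = "?u + ?v + 1"
  have "acost log_cost i s \<le> ?u * (K + ?t + 1)" "acost log_cost e s \<le> ?v * (K + ?t + 1)"
    using Store.prems(2) by (intro acost_log[OF Store.prems(1)]; simp)+
  then have "acost log_cost i s + acost log_cost e s + 1 \<le> ?t * (K + ?t + 1)"
    by (simp add: add_mult_distrib)
  moreover have "aval e s < 2 ^ (K + ?v)"
    using aval_acost_log[OF Store.prems(1), of e] Store.prems(2) by simp
  then have "aval e s < 2 ^ (K + ?t)" by (rule less_power_mono) simp
  moreover have "s y j < 2 ^ (K + ?t)" for y j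
    by (rule less_power_mono[OF Store.prems(1)[rule_format, of y j]]) simp
  ultimately have "\<forall>y j. (s(x := (s x)(aval i s := aval e s))) y j < 2 ^ (K + ?t)" by simp
  with \<open>_ \<le> ?t * (K + ?t + 1)\<close> exec.Store[of log_cost x i e s] show ?case by blast
next
  case (Seq c1 s1 t1 s2 c2 t2 s3)
  from Seq.IH(1)[of K] Seq.prems obtain u1 where u1: "exec log_cost c1 s1 u1 s2"
    "u1 \<le> t1 * (K + t1 + 1)" "\<forall>x i. s2 x i < 2 ^ (K + t1)" by auto
  \<comment> \<open>The second program starts with numbers of up to \<open>K + t1\<close> bits. The
    induction hypothesis is applied with this exponent, which is why \<open>K\<close> is
    arbitrary.\<close>
  have "\<forall>k \<in> cconsts c2. k < 2 ^ (K + t1)"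
    using Seq.prems(2) by (auto intro: less_power_mono)
  from Seq.IH(2)[OF u1(3) this] obtain u2 where u2: "exec log_cost c2 s2 u2 s3"
    "u2 \<le> t2 * (K + t1 + t2 + 1)" "\<forall>x i. s3 x i < 2 ^ (K + t1 + t2)" by auto
  have "u1 + u2 \<le> (t1 + t2) * (K + (t1 + t2) + 1)"
    using mult_cost_mono[OF u1(2), of "t1 + t2"] u2(2) by (simp add: algebra_simps)
  then show ?case using exec.Seq[OF u1(1) u2(1)] u2(3) by (auto simp: add.assoc)
next
  case (IfTrue b s c1 t s' c2)
  let ?b = "bcost unit_cost b s"
  from IfTrue.IH[of K] IfTrue.prems obtain u where u: "exec log_cost c1 s u s'"
    "u \<le> t * (K + t + 1)" "\<forall>x i. s' x i < 2 ^ (K + t)" by auto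
  have "bcost log_cost b s \<le> ?b * (K + (?b + t) + 1)"
    using IfTrue.prems(2) by (intro bcost_log[OF IfTrue.prems(1)]) simp_all
  then have "bcost log_cost b s + u \<le> (?b + t) * (K + (?b + t) + 1)"
    using mult_cost_mono[OF u(2), of "?b + t"] by (simp add: add_mult_distrib)
  moreover have "s' y j < 2 ^ (K + (?b + t))" for y j
    by (rule less_power_mono[OF u(3)[rule_format, of y j]]) simp
  ultimately show ?case using exec.IfTrue[OF IfTrue.hyps(1) u(1), of c2] by blast
next
  case (IfFalse b s c2 t s' c1)
  let ?b = "bcost unit_cost b s"
  from IfFalse.IH[of K] IfFalse.prems obtain u where u: "exec log_cost c2 s u s'"
    "u \<le> t * (K + t + 1)" "\<forall>x i. s' x i < 2 ^ (K + t)" by auto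
  have "bcost log_cost b s \<le> ?b * (K + (?b + t) + 1)"
    using IfFalse.prems(2) by (intro bcost_log[OF IfFalse.prems(1)]) simp_all
  then have "bcost log_cost b s + u \<le> (?b + t) * (K + (?b + t) + 1)"
    using mult_cost_mono[OF u(2), of "?b + t"] by (simp add: add_mult_distrib)
  moreover have "s' y j < 2 ^ (K + (?b + t))" for y j
    by (rule less_power_mono[OF u(3)[rule_format, of y j]]) simp
  ultimately show ?case using exec.IfFalse[OF IfFalse.hyps(1) u(1), of c1] by blast
next
  case (WhileFalse b s c)
  let ?b = "bcost unit_cost b s"
  have "s y j < 2 ^ (K + ?b)" for y j
    by (rule less_power_mono[OF WhileFalse.prems(1)[rule_format, of y j]]) simp
  then show ?case
    using exec.WhileFalse[OF WhileFalse.hyps, of log_cost c]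
      bcost_log[OF WhileFalse.prems(1), of b ?b] WhileFalse.prems(2) by auto
next
  case (WhileTrue b s1 c t1 s2 t2 s3)
  let ?b = "bcost unit_cost b s1"
  from WhileTrue.IH(1)[of K] WhileTrue.prems obtain u1 where u1: "exec log_cost c s1 u1 s2"
    "u1 \<le> t1 * (K + t1 + 1)" "\<forall>x i. s2 x i < 2 ^ (K + t1)" by auto
  have "\<forall>k \<in> cconsts (WHILE b DO c). k < 2 ^ (K + t1)"
    using WhileTrue.prems(2) by (auto intro: less_power_mono)
  from WhileTrue.IH(2)[OF u1(3) this] obtain u2 where u2: "exec log_cost (WHILE b DO c) s2 u2 s3"
    "u2 \<le> t2 * (K + t1 + t2 + 1)" "\<forall>x i. s3 x i < 2 ^ (K + t1 + t2)" by auto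
  let ?M = "K + (?b + t1 + t2)"
  have "bcost log_cost b s1 \<le> ?b * (?M + 1)"
    using WhileTrue.prems(2) by (intro bcost_log[OF WhileTrue.prems(1)]) auto
  moreover have "u1 \<le> t1 * (?M + 1)" using u1(2) by (rule mult_cost_mono) simp
  moreover have "u2 \<le> t2 * (?M + 1)" by (rule order_trans[OF u2(2)]) simp
  ultimately have "bcost log_cost b s1 + u1 + u2 \<le> (?b + t1 + t2) * (?M + 1)"
    by (simp add: add_mult_distrib)
  moreover have "s3 y j < 2 ^ ?M" for y j
    by (rule less_power_mono[OF u2(3)[rule_format, of y j]]) simp
  ultimately show ?case using exec.WhileTrue[OF WhileTrue.hyps(1) u1(1) u2(1)] by blast
qed

section \<open>Orientations and the constraint digraph\<close>

text \<open>Isomorphisms in general consist of separate maps for vertices and arcs together with new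
  tail and head functions. Between digraphs whose arcs are pairs the arc map is forced by the vertex
  map, and an injection of vertices is all that remains.\<close>

lemma digraph_iso_induced_iff:
  assumes "pair_wf_digraph H"
  shows "digraph_iso (with_proj H) (with_proj D \<restriction> W) \<longleftrightarrow>
    (\<exists>f. inj_on f (pverts H) \<and> f ` pverts H = W \<and>
       map_prod f f ` parcs H = {e \<in> parcs D. fst e \<in> W \<and> snd e \<in> W})" (is "?L \<longleftrightarrow> ?R")
proof
  assume ?L
  then obtain h where h: "pre_digraph.digraph_isomorphism (with_proj H) h"
      "with_proj D \<restriction> W = app_iso h (with_proj H)"
    unfolding digraph_iso_def by blast
  let ?f = "iso_verts h"
  from h(2) have eqs: "iso_tail h = fst" "iso_head h = snd" "?f ` pverts H = W"
      "iso_arcs h ` parcs H = {e \<in> parcs D. fst e \<in> W \<and> snd e \<in> W}"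
    by (auto simp: app_iso_def induce_subgraph_def)
  \<comment> \<open>In the target the tail and head of an arc are its two coordinates, so
    compatibility with tails and heads determines the image of \<open>e\<close>.\<close>
  have "iso_arcs h e = map_prod ?f ?f e" if "e \<in> parcs H" for e
    using h(1) that eqs unfolding pre_digraph.digraph_isomorphism_def
    by (cases e; cases "iso_arcs h e") auto
  then have "map_prod ?f ?f ` parcs H = iso_arcs h ` parcs H"
    by auto
  with eqs h(1) show ?R
    unfolding pre_digraph.digraph_isomorphism_def by auto
next
  assume ?R
  then obtain f where f: "inj_on f (pverts H)" "f ` pverts H = W"
      "map_prod f f ` parcs H = {e \<in> parcs D. fst e \<in> W \<and> snd e \<in> W}" by blast
  interpret pair_wf_digraph H by fact
  have wf: "parcs H \<subseteq> pverts H \<times> pverts H"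
    using in_arcsD1 in_arcsD2 by auto
  have "inj_on (map_prod f f) (parcs H)"
    by (rule inj_on_subset[OF map_prod_inj_on[OF f(1) f(1)] wf])
  then have "pre_digraph.digraph_isomorphism (with_proj H)
      \<lparr>iso_verts = f, iso_arcs = map_prod f f, iso_head = snd, iso_tail = fst\<rparr>"
    using f(1) wf_digraph by (auto simp: pre_digraph.digraph_isomorphism_def)
  moreover have "with_proj D \<restriction> W = app_iso
      \<lparr>iso_verts = f, iso_arcs = map_prod f f, iso_head = snd, iso_tail = fst\<rparr> (with_proj H)"
    using f by (simp add: app_iso_def induce_subgraph_def)
  ultimately show ?L unfolding digraph_iso_def by blast
qed

lemma nth_three: "i \<in> {0,1,2} \<Longrightarrow> f i = [f 0, f 1, f (2::nat)] ! i"
  by (elim insertE) simp_all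

text \<open>An injection of \<open>{0,1,2}\<close> is a list of three distinct vertices, applied by
  indexing. For a concrete \<open>H\<close> the image of its arcs then evaluates by
  simplification.\<close>

lemma digraph_iso_induced_three_iff:
  assumes "pverts H = {0,1,2::nat}" "parcs H \<subseteq> pverts H \<times> pverts H"
  shows "(\<exists>W \<subseteq> pverts D. digraph_iso (with_proj H) (with_proj D \<restriction> W)) \<longleftrightarrow>
    (\<exists>x y z. distinct [x,y,z] \<and> {x,y,z} \<subseteq> pverts D \<and>
       parcs D \<inter> {x,y,z} \<times> {x,y,z} =
         (\<lambda>(i,j). ([x,y,z] ! i, [x,y,z] ! j)) ` parcs H)" (is "?L \<longleftrightarrow> ?R")
proof -
  have wf: "pair_wf_digraph H" using assms(2) by unfold_locales auto
  have *: "parcs D \<inter> W \<times> W = {e \<in> parcs D. fst e \<in> W \<and> snd e \<in> W}" for W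
    by auto
  show ?thesis
  proof
    assume ?L
    then obtain W f where W: "W \<subseteq> pverts D" and f: "inj_on f (pverts H)" "f ` pverts H = W"
        "map_prod f f ` parcs H = {e \<in> parcs D. fst e \<in> W \<and> snd e \<in> W}"
      by (auto simp: digraph_iso_induced_iff[OF wf])
    have W': "W = {f 0, f 1, f 2}" using f(2) assms(1) by auto
    have "map_prod f f ` parcs H = (\<lambda>(i,j). ([f 0, f 1, f 2] ! i, [f 0, f 1, f 2] ! j)) ` parcs H"
    proof (rule image_cong[OF refl])
      fix e assume "e \<in> parcs H"
      then have "e \<in> {0,1,2} \<times> {0,1,2}" using assms by (metis subsetD)
      then have "fst e \<in> {0,1,2}" "snd e \<in> {0,1,2}" by (simp_all only: mem_Times_iff)
      then show "map_prod f f e = (case e of (i,j) \<Rightarrow> ([f 0, f 1, f 2] ! i, [f 0, f 1, f 2] ! j))"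
        using nth_three[of "fst e" f] nth_three[of "snd e" f] by (cases e) simp
    qed
    moreover have "distinct [f 0, f 1, f 2]" using f(1) assms(1) by (auto simp: inj_on_def)
    ultimately show ?R using W f(3) unfolding *[symmetric] W' by metis
  next
    assume ?R
    then obtain x y z where xyz: "distinct [x,y,z]" "{x,y,z} \<subseteq> pverts D"
      "parcs D \<inter> {x,y,z} \<times> {x,y,z} = (\<lambda>(i,j). ([x,y,z] ! i, [x,y,z] ! j)) ` parcs H"
      by (elim exE conjE) (rule that)
    define f where "f = (\<lambda>i. [x,y,z] ! i)"
    have "map_prod f f ` parcs H = parcs D \<inter> {x,y,z} \<times> {x,y,z}"
      unfolding xyz(3) f_def by (intro image_cong) auto
    moreover have "inj_on f (pverts H)" "f ` pverts H = {x,y,z}"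
      using xyz(1) assms(1) by (auto simp: f_def inj_on_def)
    ultimately show ?L using xyz(2) unfolding digraph_iso_induced_iff[OF wf] *[symmetric] by blast
  qed
qed

definition induces :: "'a pair_pre_digraph \<Rightarrow> 'a \<Rightarrow> 'a \<Rightarrow> 'a \<Rightarrow> ('a \<times> 'a) set \<Rightarrow> bool" where
  "induces D x y z A \<longleftrightarrow> distinct [x,y,z] \<and> {x,y,z} \<subseteq> pverts D \<and>
     parcs D \<inter> {x,y,z} \<times> {x,y,z} = A"

lemma F_free_iff:
  assumes "F \<subseteq> {B1, B2, B3, T3}"
  shows "F_free F D \<longleftrightarrow>
    (B1 \<in> F \<longrightarrow> (\<forall>x y z. \<not> induces D x y z {(x,y), (z,y)})) \<and>
    (B2 \<in> F \<longrightarrow> (\<forall>x y z. \<not> induces D x y z {(y,x), (y,z)})) \<and>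
    (B3 \<in> F \<longrightarrow> (\<forall>x y z. \<not> induces D x y z {(x,y), (y,z)})) \<and>
    (T3 \<in> F \<longrightarrow> (\<forall>x y z. \<not> induces D x y z {(x,y), (y,z), (x,z)}))"
proof -
  let ?P = "\<lambda>H. \<exists>W \<subseteq> pverts D. digraph_iso (with_proj H) (with_proj D \<restriction> W)"
  have b1: "?P B1 \<longleftrightarrow> (\<exists>x y z. induces D x y z {(x,y), (z,y)})"
    by (subst digraph_iso_induced_three_iff) (auto simp: B1_def induces_def)
  have b2: "?P B2 \<longleftrightarrow> (\<exists>x y z. induces D x y z {(y,x), (y,z)})"
    by (subst digraph_iso_induced_three_iff) (auto simp: B2_def induces_def)
  have b3: "?P B3 \<longleftrightarrow> (\<exists>x y z. induces D x y z {(x,y), (y,z)})"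
    by (subst digraph_iso_induced_three_iff) (auto simp: B3_def induces_def)
  have t3: "?P T3 \<longleftrightarrow> (\<exists>x y z. induces D x y z {(x,y), (y,z), (x,z)})"
    by (subst digraph_iso_induced_three_iff) (auto simp: T3_def induces_def)
  have free: "F_free F D \<longleftrightarrow> (\<forall>H \<in> F. \<not> ?P H)"
    by (auto simp: F_free_def)
  have all: "(\<forall>H \<in> F. \<not> P H) \<longleftrightarrow> (B1 \<in> F \<longrightarrow> \<not> P B1) \<and> (B2 \<in> F \<longrightarrow> \<not> P B2) \<and>
      (B3 \<in> F \<longrightarrow> \<not> P B3) \<and> (T3 \<in> F \<longrightarrow> \<not> P T3)" for P
    using assms by blast
  show ?thesis unfolding free all[of ?P] b1 b2 b3 t3 by simp
qed

lemma pair_graph_arcs: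
  assumes "pair_graph G"
  shows "parcs G \<subseteq> pverts G \<times> pverts G" "finite (pverts G)"
    "(x,y) \<in> parcs G \<longleftrightarrow> (y,x) \<in> parcs G" "(x,x) \<notin> parcs G"
proof -
  interpret pair_graph G by fact
  show "parcs G \<subseteq> pverts G \<times> pverts G" using in_arcsD1 in_arcsD2 by auto
  show "(x,y) \<in> parcs G \<longleftrightarrow> (y,x) \<in> parcs G" using arcs_symmetric by blast
  show "(x,x) \<notin> parcs G" using pair_no_loops[of "(x,x)"] by auto
  show "finite (pverts G)" by (rule pair_finite_verts)
qed

section \<open>Constraint arcs and F-free orientations\<close>

lemma constraint_arcE:
  assumes "((a,b),(c,d)) \<in> parcs (constraint_digraph G F)"
  obtains
    (1) x y z where "a = x" "b = y" "c = y" "d = z" "B1 \<in> F" "distinct [x,y,z]"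
      "(x,y) \<in> parcs G" "(y,z) \<in> parcs G" "(z,x) \<notin> parcs G"
  | (2) x y z where "a = y" "b = x" "c = z" "d = y" "B2 \<in> F" "distinct [x,y,z]"
      "(x,y) \<in> parcs G" "(y,z) \<in> parcs G" "(z,x) \<notin> parcs G"
  | (3) x y z where "a = x" "b = y" "c = z" "d = y" "B3 \<in> F" "distinct [x,y,z]"
      "(x,y) \<in> parcs G" "(y,z) \<in> parcs G" "(z,x) \<notin> parcs G"
  | (4) x y z where "a = y" "b = x" "c = y" "d = z" "B3 \<in> F" "distinct [x,y,z]"
      "(x,y) \<in> parcs G" "(y,z) \<in> parcs G" "(z,x) \<notin> parcs G"
  | (5) x y z where "a = x" "b = y" "c = y" "d = z" "T3 \<in> F" "distinct [x,y,z]"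
      "(x,y) \<in> parcs G" "(y,z) \<in> parcs G" "(z,x) \<in> parcs G"
  | (6) x y z where "a = y" "b = x" "c = x" "d = z" "T3 \<in> F" "distinct [x,y,z]"
      "(x,y) \<in> parcs G" "(y,z) \<in> parcs G" "(z,x) \<in> parcs G"
  using assms unfolding constraint_digraph_def by auto

lemma constraint_arcI:
  assumes "distinct [x,y,z]" "(x,y) \<in> parcs G" "(y,z) \<in> parcs G"
  shows
    "B1 \<in> F \<Longrightarrow> (z,x) \<notin> parcs G \<Longrightarrow> ((x,y),(y,z)) \<in> parcs (constraint_digraph G F)"
    "B2 \<in> F \<Longrightarrow> (z,x) \<notin> parcs G \<Longrightarrow> ((y,x),(z,y)) \<in> parcs (constraint_digraph G F)"
    "B3 \<in> F \<Longrightarrow> (z,x) \<notin> parcs G \<Longrightarrow> ((x,y),(z,y)) \<in> parcs (constraint_digraph G F)"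
    "B3 \<in> F \<Longrightarrow> (z,x) \<notin> parcs G \<Longrightarrow> ((y,x),(y,z)) \<in> parcs (constraint_digraph G F)"
    "T3 \<in> F \<Longrightarrow> (z,x) \<in> parcs G \<Longrightarrow> ((x,y),(y,z)) \<in> parcs (constraint_digraph G F)"
    "T3 \<in> F \<Longrightarrow> (z,x) \<in> parcs G \<Longrightarrow> ((y,x),(x,z)) \<in> parcs (constraint_digraph G F)"
  using assms by (auto simp: constraint_digraph_def)

text \<open>If \<open>x\<close> and \<open>z\<close> are not adjacent, a constraint arc says that
  one edge at \<open>y\<close>, oriented in a given way, forces the other edge so that the forbidden
  path does not arise. A triangle without a transitive tournament is a directed cycle, so each of
  its arcs forces the arc that leaves its head.\<close>

lemma F_free_orientation_iff_closed:
  assumes G: "pair_graph G" and F: "F \<subseteq> {B1, B2, B3, T3}" and D: "orientation_of G D"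
  shows "F_free F D \<longleftrightarrow>
    (\<forall>(u,v) \<in> parcs (constraint_digraph G F). u \<in> parcs D \<longrightarrow> v \<in> parcs D)" (is "_ \<longleftrightarrow> ?C")
proof -
  note PG = pair_graph_arcs[OF G]
  have edge: "(x,y) \<in> parcs G \<longleftrightarrow> (x,y) \<in> parcs D \<or> (y,x) \<in> parcs D"
    and anti: "(x,y) \<in> parcs D \<Longrightarrow> (y,x) \<notin> parcs D"
    and DG: "(x,y) \<in> parcs D \<Longrightarrow> x \<in> pverts D \<and> y \<in> pverts D" for x y
  proof -
    have eqs: "pverts D = pverts G" "parcs G = parcs D \<union> (parcs D)\<inverse>" "parcs D \<inter> (parcs D)\<inverse> = {}"
      using D unfolding orientation_of_def by simp_all
    show "(x,y) \<in> parcs G \<longleftrightarrow> (x,y) \<in> parcs D \<or> (y,x) \<in> parcs D" unfolding eqs(2) by blast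
    show "(x,y) \<in> parcs D \<Longrightarrow> (y,x) \<notin> parcs D" using eqs(3) by blast
    show "(x,y) \<in> parcs D \<Longrightarrow> x \<in> pverts D \<and> y \<in> pverts D"
      using eqs(2) PG(1) unfolding eqs(1) by blast
  qed
  have loop: "(x,x) \<notin> parcs D" for x using anti by blast
  have ind: "induces D x y z {(x,y), (z,y)} \<longleftrightarrow>
      distinct [x,y,z] \<and> (x,y) \<in> parcs D \<and> (z,y) \<in> parcs D \<and> (z,x) \<notin> parcs G"
    "induces D x y z {(y,x), (y,z)} \<longleftrightarrow>
      distinct [x,y,z] \<and> (y,x) \<in> parcs D \<and> (y,z) \<in> parcs D \<and> (z,x) \<notin> parcs G"
    "induces D x y z {(x,y), (y,z)} \<longleftrightarrow>
      distinct [x,y,z] \<and> (x,y) \<in> parcs D \<and> (y,z) \<in> parcs D \<and> (z,x) \<notin> parcs G"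
    "induces D x y z {(x,y), (y,z), (x,z)} \<longleftrightarrow>
      distinct [x,y,z] \<and> (x,y) \<in> parcs D \<and> (y,z) \<in> parcs D \<and> (x,z) \<in> parcs D" for x y z
  proof -
    \<comment> \<open>As there are no loops, equality with the induced arc set splits into six
      membership tests, which the classical reasoner can handle.\<close>
    have int: "parcs D \<inter> {x,y,z} \<times> {x,y,z} = A \<longleftrightarrow>
      A \<subseteq> {x,y,z} \<times> {x,y,z} \<and> (x,x) \<notin> A \<and> (y,y) \<notin> A \<and> (z,z) \<notin> A \<and>
      ((x,y) \<in> parcs D \<longleftrightarrow> (x,y) \<in> A) \<and> ((y,x) \<in> parcs D \<longleftrightarrow> (y,x) \<in> A) \<and>
      ((y,z) \<in> parcs D \<longleftrightarrow> (y,z) \<in> A) \<and> ((z,y) \<in> parcs D \<longleftrightarrow> (z,y) \<in> A) \<and>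
      ((x,z) \<in> parcs D \<longleftrightarrow> (x,z) \<in> A) \<and> ((z,x) \<in> parcs D \<longleftrightarrow> (z,x) \<in> A)" for A
      using loop by blast
    show "induces D x y z {(x,y), (z,y)} \<longleftrightarrow>
      distinct [x,y,z] \<and> (x,y) \<in> parcs D \<and> (z,y) \<in> parcs D \<and> (z,x) \<notin> parcs G"
      using DG[of x y] DG[of z y] anti[of x y] anti[of z y] edge[of z x]
      unfolding induces_def int by auto
    show "induces D x y z {(y,x), (y,z)} \<longleftrightarrow>
      distinct [x,y,z] \<and> (y,x) \<in> parcs D \<and> (y,z) \<in> parcs D \<and> (z,x) \<notin> parcs G"
      using DG[of y x] DG[of y z] anti[of y x] anti[of y z] edge[of z x]
      unfolding induces_def int by auto
    show "induces D x y z {(x,y), (y,z)} \<longleftrightarrow>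
      distinct [x,y,z] \<and> (x,y) \<in> parcs D \<and> (y,z) \<in> parcs D \<and> (z,x) \<notin> parcs G"
      using DG[of x y] DG[of y z] anti[of x y] anti[of y z] edge[of z x]
      unfolding induces_def int by auto
    show "induces D x y z {(x,y), (y,z), (x,z)} \<longleftrightarrow>
      distinct [x,y,z] \<and> (x,y) \<in> parcs D \<and> (y,z) \<in> parcs D \<and> (x,z) \<in> parcs D"
      using DG[of x y] DG[of y z] anti[of x y] anti[of y z] anti[of x z]
      unfolding induces_def int by auto
  qed
  have C: "?C \<longleftrightarrow>
     (B1 \<in> F \<longrightarrow> (\<forall>x y z. distinct [x,y,z] \<and> (x,y) \<in> parcs G \<and> (y,z) \<in> parcs G \<longrightarrow> (z,x) \<notin> parcs G \<longrightarrow>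
         (x,y) \<in> parcs D \<longrightarrow> (y,z) \<in> parcs D)) \<and>
     (B2 \<in> F \<longrightarrow> (\<forall>x y z. distinct [x,y,z] \<and> (x,y) \<in> parcs G \<and> (y,z) \<in> parcs G \<longrightarrow> (z,x) \<notin> parcs G \<longrightarrow>
         (y,x) \<in> parcs D \<longrightarrow> (z,y) \<in> parcs D)) \<and>
     (B3 \<in> F \<longrightarrow> (\<forall>x y z. distinct [x,y,z] \<and> (x,y) \<in> parcs G \<and> (y,z) \<in> parcs G \<longrightarrow> (z,x) \<notin> parcs G \<longrightarrow>
         ((x,y) \<in> parcs D \<longrightarrow> (z,y) \<in> parcs D) \<and> ((y,x) \<in> parcs D \<longrightarrow> (y,z) \<in> parcs D))) \<and>
     (T3 \<in> F \<longrightarrow> (\<forall>x y z. distinct [x,y,z] \<and> (x,y) \<in> parcs G \<and> (y,z) \<in> parcs G \<longrightarrow> (z,x) \<in> parcs G \<longrightarrow>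
         ((x,y) \<in> parcs D \<longrightarrow> (y,z) \<in> parcs D) \<and> ((y,x) \<in> parcs D \<longrightarrow> (x,z) \<in> parcs D)))"
    (is "_ \<longleftrightarrow> ?C'")
  proof
    assume ?C
    then have c: "u \<in> parcs D \<Longrightarrow> (u,v) \<in> parcs (constraint_digraph G F) \<Longrightarrow> v \<in> parcs D" for u v
      by blast
    show ?C'
      by (intro conjI allI impI; rule c, assumption) (auto simp: constraint_digraph_def)
  next
    assume C': ?C'
    show ?C
    proof clarify
      fix a b c d assume e: "((a,b),(c,d)) \<in> parcs (constraint_digraph G F)" and ab: "(a,b) \<in> parcs D"
      from e show "(c,d) \<in> parcs D"
        by (cases rule: constraint_arcE) (use ab C' in metis)+
    qed
  qed
  have B1: "(\<forall>x y z. \<not> induces D x y z {(x,y), (z,y)}) \<longleftrightarrow>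
      (\<forall>x y z. distinct [x,y,z] \<and> (x,y) \<in> parcs G \<and> (y,z) \<in> parcs G \<longrightarrow> (z,x) \<notin> parcs G \<longrightarrow>
         (x,y) \<in> parcs D \<longrightarrow> (y,z) \<in> parcs D)"
    unfolding ind using edge anti by blast
  have B2: "(\<forall>x y z. \<not> induces D x y z {(y,x), (y,z)}) \<longleftrightarrow>
      (\<forall>x y z. distinct [x,y,z] \<and> (x,y) \<in> parcs G \<and> (y,z) \<in> parcs G \<longrightarrow> (z,x) \<notin> parcs G \<longrightarrow>
         (y,x) \<in> parcs D \<longrightarrow> (z,y) \<in> parcs D)"
    unfolding ind using edge anti by blast
  have sym: "(z,x) \<in> parcs G \<longleftrightarrow> (x,z) \<in> parcs G" for x z using PG(3) .
  have B3: "(\<forall>x y z. \<not> induces D x y z {(x,y), (y,z)}) \<longleftrightarrow>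
      (\<forall>x y z. distinct [x,y,z] \<and> (x,y) \<in> parcs G \<and> (y,z) \<in> parcs G \<longrightarrow> (z,x) \<notin> parcs G \<longrightarrow>
         ((x,y) \<in> parcs D \<longrightarrow> (z,y) \<in> parcs D) \<and> ((y,x) \<in> parcs D \<longrightarrow> (y,z) \<in> parcs D))"
    (is "?l \<longleftrightarrow> ?r")
  proof
    assume ?l then show ?r unfolding ind by (metis distinct_length_2_or_more edge sym)
  next
    assume ?r then show ?l unfolding ind by (metis edge anti)
  qed
  have T3: "(\<forall>x y z. \<not> induces D x y z {(x,y), (y,z), (x,z)}) \<longleftrightarrow>
      (\<forall>x y z. distinct [x,y,z] \<and> (x,y) \<in> parcs G \<and> (y,z) \<in> parcs G \<longrightarrow> (z,x) \<in> parcs G \<longrightarrow>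
         ((x,y) \<in> parcs D \<longrightarrow> (y,z) \<in> parcs D) \<and> ((y,x) \<in> parcs D \<longrightarrow> (x,z) \<in> parcs D))"
    (is "?l \<longleftrightarrow> ?r")
  proof
    assume l: ?l
    \<comment> \<open>Otherwise \<open>c\<close> points to \<open>b\<close>, and either orientation
      of \<open>ac\<close> completes a transitive tournament, with vertex order \<open>a,c,b\<close>
      or \<open>c,a,b\<close>.\<close>
    have "(b,c) \<in> parcs D" if "distinct [a,b,c]" "(a,b) \<in> parcs D" "(b,c) \<in> parcs G" "(a,c) \<in> parcs G" for a b c
      using l[unfolded ind, rule_format, of a c b] l[unfolded ind, rule_format, of c a b]
        edge[of b c] edge[of a c] that by auto
    then show ?r by (metis distinct_length_2_or_more edge sym)
  next
    assume r: ?r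
    show ?l unfolding ind
    proof (intro allI notI, elim conjE)
      fix x y z assume *: "distinct [x,y,z]" "(x,y) \<in> parcs D" "(y,z) \<in> parcs D" "(x,z) \<in> parcs D"
      then have "(y,z) \<in> parcs G" "(z,x) \<in> parcs G" "(x,y) \<in> parcs G" using edge by auto
      with r * have "(z,x) \<in> parcs D" by (metis distinct_length_2_or_more distinct_singleton)
      with * anti show False by blast
    qed
  qed
  show ?thesis
    unfolding F_free_iff[OF F] C B1 B2 B3 T3 ..
qed

section \<open>Strong components and the marking\<close>

text \<open>For the reversed arcs the triple is read backwards, as \<open>z,y,x\<close>. This maps
  the families of \<open>B1\<close> and \<open>B2\<close> and the first one of \<open>T3\<close> to
  themselves and exchanges the two families of \<open>B3\<close>. An arc of the second
  \<open>T3\<close> family becomes one of the first with the triple \<open>z,x,y\<close>.\<close>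

lemma constraint_digraph_props:
  assumes G: "pair_graph G"
  shows "pair_wf_digraph (constraint_digraph G F)"
    "pverts (constraint_digraph G F) = parcs G"
    "(u,v) \<in> parcs (constraint_digraph G F) \<Longrightarrow>
      (prod.swap v, prod.swap u) \<in> parcs (constraint_digraph G F)"
proof -
  note PG = pair_graph_arcs[OF G]
  show "pair_wf_digraph (constraint_digraph G F)"
    by unfold_locales (auto simp: constraint_digraph_def PG(3))
  show "pverts (constraint_digraph G F) = parcs G" by (simp add: constraint_digraph_def)
  assume uv: "(u,v) \<in> parcs (constraint_digraph G F)"
  obtain a b c d where [simp]: "u = (a,b)" "v = (c,d)" by (cases u; cases v)
  have sym: "(y,x) \<in> parcs G" if "(x,y) \<in> parcs G" for x y using PG(3) that by blast
  from uv have "((a,b),(c,d)) \<in> parcs (constraint_digraph G F)" by simp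
  then have "((d,c),(b,a)) \<in> parcs (constraint_digraph G F)"
  proof (cases rule: constraint_arcE)
    case (1 x y z)
    then show ?thesis using constraint_arcI(1)[of z y x G F] by (auto dest: sym)
  next
    case (2 x y z)
    then show ?thesis using constraint_arcI(2)[of z y x G F] by (auto dest: sym)
  next
    case (3 x y z)
    then show ?thesis using constraint_arcI(4)[of z y x G F] by (auto dest: sym)
  next
    case (4 x y z)
    then show ?thesis using constraint_arcI(3)[of z y x G F] by (auto dest: sym)
  next
    case (5 x y z)
    then show ?thesis using constraint_arcI(5)[of z y x G F] by (auto dest: sym)
  next
    case (6 x y z)
    then show ?thesis using constraint_arcI(5)[of z x y G F] by (auto dest: sym)
  qed
  then show "(prod.swap v, prod.swap u) \<in> parcs (constraint_digraph G F)" by simp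
qed

text \<open>Reachability in a digraph is reflexive only on its vertices, reflexive transitive
  closure is so everywhere; membership of \<open>u\<close> makes up the difference.\<close>

lemma reachable_with_proj_iff:
  assumes "pair_wf_digraph D"
  shows "u \<rightarrow>\<^sup>*\<^bsub>with_proj D\<^esub> v \<longleftrightarrow> u \<in> pverts D \<and> (u,v) \<in> (parcs D)\<^sup>*"
proof -
  interpret pair_wf_digraph D by fact
  show ?thesis
  proof
    assume "u \<rightarrow>\<^sup>*\<^bsub>with_proj D\<^esub> v"
    then show "u \<in> pverts D \<and> (u,v) \<in> (parcs D)\<^sup>*"
    proof induction
      case (step x y)
      then have "(x,y) \<in> parcs D" by simp
      with step.IH step.hyps in_arcsD1 show ?case
        by (metis converse_rtrancl_into_rtrancl)
    qed simp
  next
    assume a: "u \<in> pverts D \<and> (u,v) \<in> (parcs D)\<^sup>*"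
    then have "(u,v) \<in> (parcs D)\<^sup>*" by simp
    then show "u \<rightarrow>\<^sup>*\<^bsub>with_proj D\<^esub> v"
    proof induction
      case base
      then show ?case using a by simp
    next
      case (step y z)
      then have "y \<rightarrow>\<^bsub>with_proj D\<^esub> z" by simp
      from step.IH this show ?case by (rule wf_digraph.reachable_adj_trans[OF wf_digraph])
    qed
  qed
qed

lemma mem_dual_iff: "v \<in> dual S \<longleftrightarrow> prod.swap v \<in> S"
  unfolding dual_def by (metis image_iff swap_swap)

context
  fixes G :: "'a pair_pre_digraph" and F :: "nat pair_pre_digraph set"
  assumes G: "pair_graph G"
begin

abbreviation (input) reach :: "'a \<times> 'a \<Rightarrow> 'a \<times> 'a \<Rightarrow> bool" where
  "reach u v \<equiv> (u,v) \<in> (parcs (constraint_digraph G F))\<^sup>*"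

lemma reach_skew: "reach u v \<Longrightarrow> reach (prod.swap v) (prod.swap u)"
proof (induction rule: rtrancl_induct)
  case (step y z)
  then show ?case
    using constraint_digraph_props(3)[OF G, of y z F] by (metis converse_rtrancl_into_rtrancl)
qed simp

lemma swap_in_arcs: "prod.swap u \<in> parcs G \<longleftrightarrow> u \<in> parcs G"
  using pair_graph_arcs(3)[OF G] by (cases u) auto

text \<open>Turns maximal nonempty sets of mutually reachable vertices into classes of single edges
  under mutual reachability, which is the form that component numbers deliver.\<close>

lemma in_constraint_sccs_iff:
  "S \<in> pre_digraph.sccs_verts (with_proj (constraint_digraph G F)) \<longleftrightarrow>
    (\<exists>u \<in> parcs G. S = {v. reach u v \<and> reach v u})" (is "?L \<longleftrightarrow> ?R")
proof -
  have arcs: "reach u v \<Longrightarrow> u \<in> parcs G \<longleftrightarrow> v \<in> parcs G" for u v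
    by (induction rule: rtrancl_induct) (auto simp: constraint_digraph_def pair_graph_arcs(3)[OF G])
  note re = reachable_with_proj_iff[OF constraint_digraph_props(1)[OF G, of F],
    unfolded constraint_digraph_props(2)[OF G]]
  show ?thesis
  proof
    assume L: ?L
    then obtain u where u: "u \<in> S" "\<forall>u \<in> S. \<forall>v \<in> S. u \<in> parcs G \<and> reach u v"
      "\<forall>u \<in> S. \<forall>v. v \<notin> S \<longrightarrow> \<not> (u \<in> parcs G \<and> reach u v) \<or> \<not> (v \<in> parcs G \<and> reach v u)"
      unfolding pre_digraph.sccs_verts_def re by blast
    then have "S = {v. reach u v \<and> reach v u}" using arcs by blast
    with u show ?R by blast
  next
    assume ?R
    then obtain u where u: "u \<in> parcs G" and S: "S = {v. reach u v \<and> reach v u}" by blast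
    show ?L unfolding pre_digraph.sccs_verts_def re S
      using u arcs by (blast intro: rtrancl_trans)
  qed
qed

lemma self_dual_no_orientation:
  assumes F: "F \<subseteq> {B1, B2, B3, T3}"
    and S: "S \<in> pre_digraph.sccs_verts (with_proj (constraint_digraph G F))" "S = dual S"
  shows "\<not> (\<exists>D. F_free_orientation G F D)"
proof
  assume "\<exists>D. F_free_orientation G F D"
  then obtain D where D: "orientation_of G D" "F_free F D" unfolding F_free_orientation_def by blast
  have closed: "reach u v \<Longrightarrow> u \<in> parcs D \<Longrightarrow> v \<in> parcs D" for u v
  proof (induction rule: rtrancl_induct)
    case (step y z)
    then show ?case using F_free_orientation_iff_closed[OF G F D(1)] D(2) by blast
  qed
  from S(1) obtain u where u: "u \<in> parcs G" and Su: "S = {v. reach u v \<and> reach v u}"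
    unfolding in_constraint_sccs_iff by blast
  have "u \<in> S" by (simp add: Su)
  with S(2) have "prod.swap u \<in> S" using mem_dual_iff by blast
  then have "u \<in> parcs D \<longleftrightarrow> prod.swap u \<in> parcs D" using closed Su by blast
  moreover from u D(1) have "u \<in> parcs D \<longleftrightarrow> prod.swap u \<notin> parcs D"
    unfolding orientation_of_def by (cases u) auto
  ultimately show False by blast
qed

end

section \<open>The colouring produced by processing the components\<close>

lemma process_components_Self_Dual:
  "process_components Ss m = Self_Dual S \<Longrightarrow> S \<in> set Ss \<and> S = dual S"
  by (induction Ss m rule: process_components.induct) (auto split: if_splits)

text \<open>Of two dual components the one that comes first in the list is marked true. Hence the
  final colouring has a closed form in terms of positions, and it remains to compare positions.
  Abstracting components to an index function avoids reasoning about sets of sets.\<close>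

lemma process_components_Colouring:
  fixes idx :: "'a \<times> 'a \<Rightarrow> nat"
  assumes mem: "\<And>v i. i < length Ss \<Longrightarrow> v \<in> Ss ! i \<longleftrightarrow> v \<in> A \<and> idx v = i"
    and idx: "\<And>v. v \<in> A \<Longrightarrow> idx v < length Ss"
    and A: "\<And>v. v \<in> A \<Longrightarrow> prod.swap v \<in> A"
    and ne: "{} \<notin> set Ss"
    and dual: "\<And>u v. u \<in> A \<Longrightarrow> v \<in> A \<Longrightarrow> idx u = idx v \<Longrightarrow> idx (prod.swap u) = idx (prod.swap v)"
    and res: "process_components Ss Map.empty = Colouring m"
  shows "m = (\<lambda>v. if v \<in> A then Some (idx v < idx (prod.swap v)) else None) \<and>
    (\<forall>v \<in> A. idx v \<noteq> idx (prod.swap v))"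
proof -
  \<comment> \<open>The colouring after the first \<open>i\<close> components: a vertex is marked as
    soon as its own component or the dual one has been reached, and its final colour is known at
    once.\<close>
  define marks where "marks i = (\<lambda>v. if v \<in> A \<and> (idx v < i \<or> idx (prod.swap v) < i)
    then Some (idx v < idx (prod.swap v)) else None)" for i
  have "m = marks (length Ss) \<and> (\<forall>v \<in> A. i \<le> idx v \<longrightarrow> idx v \<noteq> idx (prod.swap v))"
    if "i \<le> length Ss" "process_components (drop i Ss) (marks i) = Colouring m" for i
    using that
  proof (induction "length Ss - i" arbitrary: i)
    case 0
    then show ?case using idx by force
  next
    case (Suc k)
    then have i: "i < length Ss" by simp
    let ?S = "Ss ! i"
    have drop: "drop i Ss = ?S # drop (Suc i) Ss" using i by (simp add: Cons_nth_drop_Suc)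
    from i ne obtain w where w: "w \<in> ?S" by (metis ex_in_conv nth_mem)
    then have wA: "w \<in> A" "idx w = i" using mem[OF i] by auto
    have sw: "idx (prod.swap v) = idx (prod.swap w)" if "v \<in> ?S" for v
      using that dual[of v w] wA mem[OF i, of v] by simp
    have nd: "?S \<noteq> dual ?S" using Suc.prems(2) unfolding drop by (auto split: if_splits)
    \<comment> \<open>One reversed member inside the component would bring all of them there, by the
      assumption \<open>dual\<close>; the component would be its own dual and the result not a
      colouring.\<close>
    have ne_i: "idx (prod.swap v) \<noteq> i" if "v \<in> ?S" for v
    proof
      assume "idx (prod.swap v) = i"
      then have *: "idx (prod.swap x) = i" if "x \<in> ?S" for x using sw that \<open>v \<in> ?S\<close> by metis
      then have "x \<in> ?S \<longleftrightarrow> prod.swap x \<in> ?S" for x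
        using mem[OF i] A by (metis swap_swap)
      then have "?S = dual ?S" unfolding set_eq_iff mem_dual_iff by blast
      with nd show False by blast
    qed
    have "process_components (drop (Suc i) Ss) (marks (Suc i)) = Colouring m"
    proof (cases "idx (prod.swap w) < i")
      \<comment> \<open>The dual component came earlier and has marked this one false, so nothing
        changes.\<close>
      case True
      then have "marks i w \<noteq> None" using wA by (simp add: marks_def)
      moreover have "marks (Suc i) = marks i"
      proof
        fix v
        have "idx v < i \<or> idx (prod.swap v) < i" if "v \<in> A" "idx v = i \<or> idx (prod.swap v) = i"
          using that sw[of v] sw[of "prod.swap v"] True mem[OF i] A[of v] by auto
        then show "marks (Suc i) v = marks i v" by (auto simp: marks_def less_Suc_eq)
      qed
      ultimately show ?thesis using Suc.prems(2) nd w unfolding drop by (auto split: if_splits)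
    next
      case False
      then have gt: "i < idx (prod.swap v)" if "v \<in> ?S" for v
        using sw[OF that] ne_i[OF that] by simp
      then have "\<forall>v \<in> ?S. marks i v = None" using mem[OF i] by (fastforce simp: marks_def)
      moreover have "marks (Suc i) =
          (\<lambda>v. if v \<in> ?S then Some True else if v \<in> dual ?S then Some False else marks i v)"
      proof
        fix v
        show "marks (Suc i) v =
          (if v \<in> ?S then Some True else if v \<in> dual ?S then Some False else marks i v)"
          using gt[of v] gt[of "prod.swap v"] mem[OF i, of v] mem[OF i, of "prod.swap v"]
            A[of v] A[of "prod.swap v"]
          by (auto simp: marks_def mem_dual_iff less_Suc_eq)
      qed
      ultimately show ?thesis using Suc.prems(2) nd unfolding drop by simp
    qed
    with Suc.hyps(1)[of "Suc i"] Suc.hyps(2) i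
    have "m = marks (length Ss)" "\<forall>v \<in> A. Suc i \<le> idx v \<longrightarrow> idx v \<noteq> idx (prod.swap v)" by auto
    moreover have "idx v \<noteq> idx (prod.swap v)" if "v \<in> A" "idx v = i" for v
      using ne_i[of v] mem[OF i] that by auto
    ultimately show ?case by (metis Suc_leI le_neq_implies_less)
  qed
  from this[of 0] res idx show ?thesis by (auto simp: marks_def)
qed

text \<open>Reachability makes positions decrease weakly, and by skew symmetry it makes the
  positions of the reversed pairs increase weakly. These two facts hold for every reverse
  topological order, so ties may be broken in any way.\<close>

theorem algorithm1_outcome_correct:
  assumes G: "pair_graph G" and F: "F \<subseteq> {B1, B2, B3, T3}" and r: "algorithm1_outcome G F r"
  shows "case r of
      Self_Dual S \<Rightarrow> \<not> (\<exists>D. F_free_orientation G F D)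
    | Colouring m \<Rightarrow> F_free_orientation G F (orient G m)"
proof -
  let ?reach = "\<lambda>u v. (u,v) \<in> (parcs (constraint_digraph G F))\<^sup>*"
  from r obtain Ss where Ss: "reverse_topological (constraint_digraph G F) Ss"
      "r = process_components Ss Map.empty"
    unfolding algorithm1_outcome_def by blast
  note scc = in_constraint_sccs_iff[OF G, of _ F]
  from Ss(1) have dist: "distinct Ss"
    and set: "set Ss = pre_digraph.sccs_verts (with_proj (constraint_digraph G F))"
    and topo: "\<And>i j u v. i < length Ss \<Longrightarrow> j < length Ss \<Longrightarrow> u \<in> Ss ! i \<Longrightarrow> v \<in> Ss ! j \<Longrightarrow>
        u \<in> parcs G \<Longrightarrow> ?reach u v \<Longrightarrow> j \<le> i"
    unfolding reverse_topological_def
      reachable_with_proj_iff[OF constraint_digraph_props(1)[OF G, of F]]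
      constraint_digraph_props(2)[OF G] by blast+
  define comp where "comp u = {v. ?reach u v \<and> ?reach v u}" for u
  have arcs: "?reach u v \<Longrightarrow> u \<in> parcs G \<longleftrightarrow> v \<in> parcs G" for u v
    by (induction rule: rtrancl_induct) (auto simp: constraint_digraph_def pair_graph_arcs(3)[OF G])
  have comp_eq: "v \<in> S \<longleftrightarrow> v \<in> parcs G \<and> S = comp v" if "S \<in> set Ss" for S v
  proof -
    from that obtain u where "u \<in> parcs G" "S = comp u" unfolding set scc comp_def by blast
    then show ?thesis using arcs[of u v] unfolding comp_def by (auto intro: rtrancl_trans)
  qed
  have "\<exists>i < length Ss. Ss ! i = comp v" if "v \<in> parcs G" for v
    using that set scc unfolding comp_def by (metis (mono_tags, lifting) in_set_conv_nth)
  then obtain idx where idx: "\<And>v. v \<in> parcs G \<Longrightarrow> idx v < length Ss \<and> Ss ! idx v = comp v"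
    by metis
  have mem: "v \<in> Ss ! i \<longleftrightarrow> v \<in> parcs G \<and> idx v = i" if "i < length Ss" for v i
    using comp_eq[of "Ss ! i" v] that idx[of v] dist by (metis nth_eq_iff_index_eq nth_mem)
  have le: "idx v \<le> idx u" if "?reach u v" "u \<in> parcs G" for u v
    using topo[of "idx u" "idx v" u v] that arcs[OF that(1)] idx[of u] idx[of v]
      mem[of "idx u" u] mem[of "idx v" v] by simp
  have eq_reach: "?reach u v" if "u \<in> parcs G" "v \<in> parcs G" "idx u = idx v" for u v
    using idx[of u] idx[of v] that unfolding comp_def by auto
  have swap_le: "idx (prod.swap u) \<le> idx (prod.swap v)" if "?reach u v" "u \<in> parcs G" for u v
    using le[OF reach_skew[OF G that(1)]] that arcs[OF that(1)] swap_in_arcs[OF G] by blast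
  show ?thesis
  proof (cases r)
    case (Self_Dual S)
    with Ss(2) process_components_Self_Dual[of Ss Map.empty S] set
    have "S = dual S \<and> S \<in> pre_digraph.sccs_verts (with_proj (constraint_digraph G F))" by auto
    then have "\<not> (\<exists>D. F_free_orientation G F D)"
      using self_dual_no_orientation[OF G F, of S] by blast
    then show ?thesis unfolding Self_Dual by simp
  next
    case (Colouring m)
    have m: "m = (\<lambda>v. if v \<in> parcs G then Some (idx v < idx (prod.swap v)) else None) \<and>
      (\<forall>v \<in> parcs G. idx v \<noteq> idx (prod.swap v))"
    proof (rule process_components_Colouring[of Ss])
      show "{} \<notin> set Ss" unfolding set pre_digraph.sccs_verts_def by blast
      show "process_components Ss Map.empty = Colouring m" using Ss(2) Colouring by simp
      fix u v assume "u \<in> parcs G" "v \<in> parcs G" "idx u = idx v"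
      then show "idx (prod.swap u) = idx (prod.swap v)"
        using eq_reach[of u v] eq_reach[of v u] swap_le[of u v] swap_le[of v u] by simp
    qed (use mem idx swap_in_arcs[OF G] in auto)
    let ?D = "orient G m"
    have D: "v \<in> parcs ?D \<longleftrightarrow> v \<in> parcs G \<and> idx v < idx (prod.swap v)" for v
      using m by (auto simp: orient_def)
    have or: "orientation_of G ?D"
      unfolding orientation_of_def
    proof (intro conjI)
      show "parcs ?D \<union> (parcs ?D)\<inverse> = parcs G"
      proof (intro set_eqI)
        fix v
        have "v \<in> parcs ?D \<union> (parcs ?D)\<inverse> \<longleftrightarrow> v \<in> parcs ?D \<or> prod.swap v \<in> parcs ?D"
          by (cases v) auto
        then show "v \<in> parcs ?D \<union> (parcs ?D)\<inverse> \<longleftrightarrow> v \<in> parcs G"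
          using m swap_in_arcs[OF G, of v] unfolding D by (auto simp: nat_neq_iff)
      qed
      show "parcs ?D \<inter> (parcs ?D)\<inverse> = {}" using D by fastforce
    qed (simp add: orient_def)
    have "F_free F ?D"
      unfolding F_free_orientation_iff_closed[OF G F or]
    proof clarify
      fix a b c d
      assume e: "((a,b),(c,d)) \<in> parcs (constraint_digraph G F)" and ab: "(a,b) \<in> parcs ?D"
      \<comment> \<open>With \<open>u\<close> and \<open>v\<close> for the two pairs:
        \<open>idx v\<close> \<le> \<open>idx u\<close> < \<open>idx (prod.swap u)\<close> \<le>
        \<open>idx (prod.swap v)\<close>. The strict inequality says that \<open>u\<close> is marked
        true; the outer ones are monotonicity and its dual.\<close>
      from e have r: "?reach (a,b) (c,d)" by blast
      from ab have "(a,b) \<in> parcs G" using D by blast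
      with le[OF r] swap_le[OF r] arcs[OF r] ab show "(c,d) \<in> parcs ?D" unfolding D by auto
    qed
    with or Colouring show ?thesis by (simp add: F_free_orientation_def)
  qed
qed

section \<open>Initialisation\<close>

text \<open>The case of a zero potential: no amortisation, one bound for all iterations.\<close>

lemma runs_FOR':
  assumes "x \<noteq> i" "x \<notin> mods c" "s x 0 = m"
    and "P 0 (s(i := (s i)(0 := 0)))"
    and "\<And>k s'. P k s' \<Longrightarrow> s' i 0 = k \<Longrightarrow> k < m \<Longrightarrow> s' x 0 = m \<Longrightarrow>
      (\<And>y. y \<notin> mods c \<union> {i} \<Longrightarrow> s' y = s y) \<Longrightarrow>
      runs c s' (\<lambda>t s''. s'' i 0 = k \<and> P (Suc k) (s''(i := (s'' i)(0 := Suc k))) \<and> t \<le> T)"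
  shows "runs (FOR i (V x) c) s (\<lambda>t s'. P m s' \<and> t \<le> 8 + m * (T + 11))"
  by (rule runs_conseq[OF runs_FOR[where P = P and \<Phi> = "\<lambda>_. 0" and T = T, OF assms(1-4)]])
    (auto intro!: runs_conseq[OF assms(5)])

text \<open>Without multiplication the multiples of \<open>n\<close> have to be accumulated; the
  last one is the number of pairs.\<close>

lemma runs_row:
  assumes "s ''n'' 0 = n" "s ''size'' 0 = 0"
  shows "runs (FOR ''x'' (V ''n'')
       (''row''\<langle>V ''x''\<rangle> ::= V ''size'';; ''size'' ::= V ''size'' \<boxplus> V ''n'')) s
     (\<lambda>t s'. ((\<forall>x<n. s' ''row'' x = x * n) \<and> s' ''size'' 0 = n * n) \<and> t \<le> 8 + n * 40)"
  by (rule runs_conseq[OF runs_FOR'[where T = 29 and m = n and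
        P = "\<lambda>k s'. (\<forall>x<k. s' ''row'' x = x * n) \<and> s' ''size'' 0 = k * n"]])
    (use assms in \<open>auto simp: less_Suc_eq\<close>)

lemma rev_decode:
  assumes "x * n + y = x' * n + y'" "y < n" "y' < (n::nat)"
  shows "x = x' \<and> y = y'"
proof -
  have "(x * n + y) div n = x" "(x' * n + y') div n = x'" "(x * n + y) mod n = y" "(x' * n + y') mod n = y'"
    using assms(2,3) by simp_all
  with assms(1) show ?thesis by simp
qed

lemma encode_eq_iff:
  "y < n \<Longrightarrow> y' < (n::nat) \<Longrightarrow> x * n + y = x' * n + y' \<longleftrightarrow> x = x' \<and> y = y'"
  using rev_decode by blast

lemma encode_less: "x < n \<Longrightarrow> y < n \<Longrightarrow> x * n + y < n * (n::nat)"
  by (metis add_less_cancel_left less_le_trans mult.commute mult_Suc mult_le_mono1 Suc_leI add.commute)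

lemma runs_rev:
  assumes n: "s ''n'' 0 = n" and row: "\<forall>x<n. s ''row'' x = x * n"
  shows "runs (FOR ''x'' (V ''n'') (FOR ''y'' (V ''n'')
       (''rev''\<langle>pair ''x'' ''y''\<rangle> ::= pair ''y'' ''x''))) s
     (\<lambda>t s'. (\<forall>x<n. \<forall>y<n. s' ''rev'' (x * n + y) = y * n + x) \<and> t \<le> 8 + n * (8 + n * 40 + 11))"
proof (rule runs_conseq[OF runs_FOR'[where T = "8 + n * 40" and m = n and
        P = "\<lambda>k s'. \<forall>x<k. \<forall>y<n. s' ''rev'' (x * n + y) = y * n + x"]], goal_cases)
  case (5 k s')
  have row': "s' ''row'' x = x * n" if "x < n" for x using 5(5)[of "''row''"] row that by simp
  \<comment> \<open>The numbering of pairs is injective, so a store to \<open>rev\<close> leaves all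
    entries written before intact.\<close>
  show ?case
    by (rule runs_conseq[OF runs_FOR'[where T = 29 and m = n and
        P = "\<lambda>l s''. s'' ''x'' 0 = k \<and> (\<forall>x<k. \<forall>y<n. s'' ''rev'' (x * n + y) = y * n + x) \<and>
          (\<forall>y<l. s'' ''rev'' (k * n + y) = y * n + k)"]])
      (use 5 row' in \<open>auto simp: pair_def less_Suc_eq encode_eq_iff\<close>)
qed (use assms in auto)

text \<open>The invariants of the search speak about all natural numbers, so \<open>num\<close> and
  \<open>comp\<close> must vanish beyond \<open>m\<close> as well. Clearing the cells below
  \<open>m\<close> cannot establish that; it is inherited from the initial memory.\<close>

lemma runs_clear:
  assumes "s ''size'' 0 = m" "s ''num'' = (\<lambda>_. 0)" "s ''comp'' = (\<lambda>_. 0)"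
  shows "runs (FOR ''v'' (V ''size'')
       (''first''\<langle>V ''v''\<rangle> ::= N 0;; ''num''\<langle>V ''v''\<rangle> ::= N 0;;
        ''comp''\<langle>V ''v''\<rangle> ::= N 0;; ''mark''\<langle>V ''v''\<rangle> ::= N 0)) s
    (\<lambda>t s'. ((\<forall>v<m. s' ''first'' v = 0 \<and> s' ''mark'' v = 0) \<and> s' ''num'' = (\<lambda>_. 0) \<and> s' ''comp'' = (\<lambda>_. 0)) \<and>
      t \<le> 8 + m * 50)"
  by (rule runs_conseq[OF runs_FOR'[where T = 39 and m = m and
        P = "\<lambda>k s'. (\<forall>v<k. s' ''first'' v = 0 \<and> s' ''mark'' v = 0) \<and>
          s' ''num'' = (\<lambda>_. 0) \<and> s' ''comp'' = (\<lambda>_. 0)"]])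
    (use assms in \<open>auto simp: less_Suc_eq\<close>)

lemma runs_initialise:
  assumes n: "s ''n'' 0 = n" and zero: "s ''num'' = (\<lambda>_. 0)" "s ''comp'' = (\<lambda>_. 0)"
  shows "runs initialise s (\<lambda>t s'. (\<forall>x<n. s' ''row'' x = x * n) \<and> s' ''size'' 0 = n * n \<and>
    (\<forall>x<n. \<forall>y<n. s' ''rev'' (x * n + y) = y * n + x) \<and>
    (\<forall>v < n * n. s' ''first'' v = 0 \<and> s' ''mark'' v = 0) \<and>
    s' ''num'' = (\<lambda>_. 0) \<and> s' ''comp'' = (\<lambda>_. 0) \<and> t \<le> 200 * n^2 + 100)"
proof -
  let ?s = "s(''size'' := (s ''size'')(0 := 0))"
  have e0: "exec unit_cost (''size'' ::= N 0) s 3 ?s"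
    using exec.Store[of unit_cost "''size''" "N 0" "N 0" s] by (simp add: numeral_3_eq_3)
  have p0: "?s ''n'' 0 = n" "?s ''size'' 0 = 0" using n by simp_all
  from runs_row[of ?s n, OF p0] obtain t1 s1 where
    e1: "exec unit_cost (FOR ''x'' (V ''n'')
       (''row''\<langle>V ''x''\<rangle> ::= V ''size'';; ''size'' ::= V ''size'' \<boxplus> V ''n'')) ?s t1 s1"
    and q1: "\<forall>x<n. s1 ''row'' x = x * n" "s1 ''size'' 0 = n * n" "t1 \<le> 8 + n * 40"
    and f1: "\<And>x. x \<notin> {''x'', ''row'', ''size''} \<Longrightarrow> s1 x = ?s x"
    by (elim runsE) auto
  from f1[of "''n''"] n have n1: "s1 ''n'' 0 = n" by simp
  from runs_rev[of s1 n, OF n1 q1(1)] obtain t2 s2 where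
    e2: "exec unit_cost (FOR ''x'' (V ''n'') (FOR ''y'' (V ''n'')
       (''rev''\<langle>pair ''x'' ''y''\<rangle> ::= pair ''y'' ''x''))) s1 t2 s2"
    and q2: "\<forall>x<n. \<forall>y<n. s2 ''rev'' (x * n + y) = y * n + x" "t2 \<le> 8 + n * (8 + n * 40 + 11)"
    and f2: "\<And>x. x \<notin> {''x'', ''y'', ''rev''} \<Longrightarrow> s2 x = s1 x"
    by (elim runsE) auto
  from f2[of "''size''"] q1(2) have size2: "s2 ''size'' 0 = n * n" by simp
  have zero2: "s2 ''num'' = (\<lambda>_. 0)" "s2 ''comp'' = (\<lambda>_. 0)"
    using f2[of "''num''"] f2[of "''comp''"] f1[of "''num''"] f1[of "''comp''"] zero by simp_all
  from runs_clear[of s2 "n * n", OF size2 zero2] obtain t3 s3 where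
    e3: "exec unit_cost (FOR ''v'' (V ''size'')
       (''first''\<langle>V ''v''\<rangle> ::= N 0;; ''num''\<langle>V ''v''\<rangle> ::= N 0;;
        ''comp''\<langle>V ''v''\<rangle> ::= N 0;; ''mark''\<langle>V ''v''\<rangle> ::= N 0)) s2 t3 s3"
    and q3: "(\<forall>v < n * n. s3 ''first'' v = 0 \<and> s3 ''mark'' v = 0) \<and>
        s3 ''num'' = (\<lambda>_. 0) \<and> s3 ''comp'' = (\<lambda>_. 0)"
      "t3 \<le> 8 + n * n * 50"
    and f3: "\<And>x. x \<notin> {''v'', ''first'', ''num'', ''comp'', ''mark''} \<Longrightarrow> s3 x = s2 x"
    by (elim runsE) auto
  have "n \<le> n * n" by simp
  then have time: "3 + (t1 + (t2 + t3)) \<le> 200 * n^2 + 100"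
    using q1(3) q2(2) q3(2) unfolding power2_eq_square add_mult_distrib2 by linarith
  show ?thesis
    unfolding initialise_def
    by (rule runsI[OF exec.Seq[OF e0 exec.Seq[OF e1 exec.Seq[OF e2 e3]]]])
      (use time q1 q2 q3(1) size2 f3[of "''size''"] f3[of "''row''"] f2[of "''row''"] f3[of "''rev''"] in simp)
qed

section \<open>Construction of the constraint digraph\<close>

text \<open>The test \<open>nxt e < e\<close> makes the traversal terminate for any contents of
  memory. It holds for all arcs that were entered, since the successor in a list is an older arc,
  and it fails at 0, the end marker.\<close>

function list_targets :: "(nat \<Rightarrow> nat) \<Rightarrow> (nat \<Rightarrow> nat) \<Rightarrow> nat \<Rightarrow> nat list" where
  "list_targets nxt tgt e = (if nxt e < e then tgt e # list_targets nxt tgt (nxt e) else [])"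
  by pat_completeness auto
termination by (relation "measure (\<lambda>(nxt, tgt, e). e)") auto

declare list_targets.simps [simp del]

lemma list_targets_0 [simp]: "list_targets nxt tgt 0 = []"
  by (simp add: list_targets.simps)

text \<open>The traversal only descends. An arc entered later has a larger number and therefore
  leaves existing lists alone.\<close>

lemma list_targets_cong:
  "(\<And>d. d \<le> e \<Longrightarrow> nxt d = nxt' d \<and> tgt d = tgt' d) \<Longrightarrow>
    list_targets nxt tgt e = list_targets nxt' tgt' e"
proof (induction e rule: less_induct)
  case (less e)
  have "list_targets nxt tgt (nxt e) = list_targets nxt' tgt' (nxt e)" if "nxt e < e"
    by (rule less.IH[OF that]) (use less.prems that in simp)
  then show ?case
    using less.prems[of e] by (subst (1 2) list_targets.simps) simp
qed

abbreviation out_arcs :: "mem \<Rightarrow> nat \<Rightarrow> nat list" where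
  "out_arcs s v \<equiv> list_targets (s ''next'') (s ''target'') (s ''first'' v)"

text \<open>\<open>S\<close> is the set of arcs entered so far and \<open>k\<close> a bound on the
  number of entries. Because of repetitions the lists represent \<open>S\<close> only as sets,
  whereas the running time of the search depends on the total number of entries.\<close>

definition arc_lists :: "nat \<Rightarrow> (nat \<times> nat) set \<Rightarrow> nat \<Rightarrow> mem \<Rightarrow> bool" where
  "arc_lists m S k s \<longleftrightarrow>
    (\<forall>e. 0 < e \<and> e \<le> s ''arcs'' 0 \<longrightarrow> s ''next'' e < e) \<and>
    (\<forall>v<m. s ''first'' v \<le> s ''arcs'' 0 \<and> set (out_arcs s v) = {w. (v,w) \<in> S}) \<and>
    (\<Sum>v<m. length (out_arcs s v)) = s ''arcs'' 0 \<and> s ''arcs'' 0 \<le> k"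

lemma arc_lists_mono: "arc_lists m S k s \<Longrightarrow> k \<le> k' \<Longrightarrow> arc_lists m S k' s"
  unfolding arc_lists_def by auto

lemma arc_lists_cong:
  assumes "s' ''arcs'' = s ''arcs''" "s' ''next'' = s ''next''" "s' ''first'' = s ''first''"
    "s' ''target'' = s ''target''"
  shows "arc_lists m S k s' = arc_lists m S k s"
  unfolding arc_lists_def by (simp only: assms)

lemma arc_lists_upd [simp]:
  "x \<notin> {''arcs'', ''next'', ''first'', ''target''} \<Longrightarrow> arc_lists m S k (s(x := f)) = arc_lists m S k s"
  by (rule arc_lists_cong) auto

lemma arc_lists_insert:
  assumes s: "arc_lists m S k s" and u: "u < m"
    and s': "s' ''arcs'' 0 = Suc (s ''arcs'' 0)"
      "s' ''target'' = (s ''target'')(Suc (s ''arcs'' 0) := v)"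
      "s' ''next'' = (s ''next'')(Suc (s ''arcs'' 0) := s ''first'' u)"
      "s' ''first'' = (s ''first'')(u := Suc (s ''arcs'' 0))"
  shows "arc_lists m (insert (u,v) S) (Suc k) s'"
proof -
  let ?a = "s ''arcs'' 0"
  have first: "s ''first'' w \<le> ?a" if "w < m" for w using s that by (simp add: arc_lists_def)
  have old: "list_targets (s' ''next'') (s' ''target'') e =
      list_targets (s ''next'') (s ''target'') e" if "e \<le> ?a" for e
    by (rule list_targets_cong) (use that s' in auto)
  \<comment> \<open>The old head of the list is at most the old arc count, hence below the new arc,
    and the traversal continues into the old list.\<close>
  have new: "out_arcs s' u = v # out_arcs s u"
    using first[OF u] old[OF first[OF u]] by (subst list_targets.simps) (simp add: s')
  have other: "out_arcs s' w = out_arcs s w" if "w < m" "w \<noteq> u" for w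
    using old[OF first[OF that(1)]] that(2) by (simp add: s'(4))
  have "(\<Sum>w<m. length (out_arcs s' w)) = length (out_arcs s' u) + (\<Sum>w\<in>{..<m}-{u}. length (out_arcs s' w))"
    using u by (simp add: sum.remove)
  also have "(\<Sum>w\<in>{..<m}-{u}. length (out_arcs s' w)) = (\<Sum>w\<in>{..<m}-{u}. length (out_arcs s w))"
    using other by (intro sum.cong) auto
  also have "length (out_arcs s' u) + \<dots> = Suc (\<Sum>w<m. length (out_arcs s w))"
    using u new by (simp add: sum.remove[of "{..<m}" u])
  finally have sum: "(\<Sum>w<m. length (out_arcs s' w)) = Suc (\<Sum>w<m. length (out_arcs s w))" .
  show ?thesis
    unfolding arc_lists_def
  proof (intro conjI allI impI)
    fix e assume "0 < e \<and> e \<le> s' ''arcs'' 0"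
    then show "s' ''next'' e < e" using s u by (cases "e = Suc ?a") (auto simp: arc_lists_def s' less_Suc_eq_le)
  next
    fix w assume "w < m"
    then show "s' ''first'' w \<le> s' ''arcs'' 0" using first[of w] by (simp add: s')
    show "set (out_arcs s' w) = {x. (w,x) \<in> insert (u,v) S}"
      using s new other[of w] \<open>w < m\<close> by (cases "w = u") (auto simp: arc_lists_def)
  qed (use s sum in \<open>auto simp: arc_lists_def s'\<close>)
qed

text \<open>The operands are evaluated again between the stores. Restricting them to the loop
  variables keeps them away from the banks that are being written.\<close>

lemma runs_add_arc:
  assumes "arc_lists m S k s" "{p, q, r, t} \<subseteq> {''x'', ''y'', ''z''}"
    and "s ''row'' (s p 0) + s q 0 = u" "u < m" "s ''row'' (s r 0) + s t 0 = v"
  shows "runs (add_arc (pair p q) (pair r t)) s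
    (\<lambda>t s'. arc_lists m (insert (u,v) S) (Suc k) s' \<and> t \<le> 50)"
proof -
  have "p \<notin> {''arcs'', ''target'', ''next'', ''first'', ''row''}" "q \<notin> {''arcs'', ''target'', ''next'', ''first''}"
    "r \<notin> {''arcs'', ''target'', ''next'', ''first'', ''row''}" "t \<notin> {''arcs'', ''target'', ''next'', ''first''}"
    using assms(2) by auto
  then show ?thesis
    unfolding add_arc_def pair_def runs_Seq runs_Store
    using assms(3,5) by (intro conjI arc_lists_insert[OF assms(1,4)]) auto
qed

text \<open>Adjacency and flags are predicates here, so that the same set can be compared with the
  branches of the program and with the constraint digraph.\<close>

definition triple_arcs ::
    "nat \<Rightarrow> (nat \<Rightarrow> nat \<Rightarrow> bool) \<Rightarrow> (nat \<Rightarrow> bool) \<Rightarrow> nat \<Rightarrow> nat \<Rightarrow> nat \<Rightarrow> (nat \<times> nat) set" where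
  "triple_arcs n A f x y z =
    (if A x y \<and> A y z \<and> x \<noteq> z then
       if A z x then
         if f 3 then {(x * n + y, y * n + z), (y * n + x, x * n + z)} else {}
       else (if f 0 then {(x * n + y, y * n + z)} else {}) \<union>
         (if f 1 then {(y * n + x, z * n + y)} else {}) \<union>
         (if f 2 then {(x * n + y, z * n + y), (y * n + x, y * n + z)} else {})
     else {})"

definition add_triple :: com where
  "add_triple = (IF edge ''x'' ''y'' AND edge ''y'' ''z'' AND Neg (V ''x'' \<doteq> V ''z'') THEN
         (IF edge ''z'' ''x'' THEN
           (IF ''F''\<langle>N 3\<rangle> \<doteq> N 1 THEN
              (add_arc (pair ''x'' ''y'') (pair ''y'' ''z'');;
               add_arc (pair ''y'' ''x'') (pair ''x'' ''z''))
            ELSE SKIP)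
          ELSE
           ((IF ''F''\<langle>N 0\<rangle> \<doteq> N 1 THEN
              add_arc (pair ''x'' ''y'') (pair ''y'' ''z'')
            ELSE SKIP);;
           (IF ''F''\<langle>N 1\<rangle> \<doteq> N 1 THEN
              add_arc (pair ''y'' ''x'') (pair ''z'' ''y'')
            ELSE SKIP);;
           (IF ''F''\<langle>N 2\<rangle> \<doteq> N 1 THEN
              (add_arc (pair ''x'' ''y'') (pair ''z'' ''y'');;
               add_arc (pair ''y'' ''x'') (pair ''y'' ''z''))
            ELSE SKIP)))
        ELSE SKIP)"

lemma mods_add_arc [simp]: "mods (add_arc u v) = {''arcs'', ''target'', ''next'', ''first''}"
  by (auto simp: add_arc_def)

section \<open>The contribution of a single triple\<close>

definition arc_vars :: "vname set" where
  "arc_vars = {''arcs'', ''target'', ''next'', ''first''}"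

text \<open>All tests in the loop body read banks outside \<open>arc_vars\<close> and can be
  evaluated in the memory \<open>s0\<close>. Relative to it each command simply contributes a set
  \<open>X\<close> of arcs, at most \<open>k\<close> entries and time \<open>T\<close>, and these
  add up along sequences.\<close>

definition arc_step :: "nat \<Rightarrow> mem \<Rightarrow> com \<Rightarrow> (nat \<times> nat) set \<Rightarrow> nat \<Rightarrow> nat \<Rightarrow> bool" where
  "arc_step m s0 c X k T \<longleftrightarrow> mods c \<subseteq> arc_vars \<and>
    (\<forall>s S j. (\<forall>x. x \<notin> arc_vars \<longrightarrow> s x = s0 x) \<longrightarrow> arc_lists m S j s \<longrightarrow>
      runs c s (\<lambda>t s'. arc_lists m (S \<union> X) (j + k) s' \<and> t \<le> T))"

lemma arc_stepI:
  assumes "mods c \<subseteq> arc_vars"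
    and "\<And>s S j. (\<And>x. x \<notin> arc_vars \<Longrightarrow> s x = s0 x) \<Longrightarrow> arc_lists m S j s \<Longrightarrow>
      runs c s (\<lambda>t s'. arc_lists m (S \<union> X) (j + k) s' \<and> t \<le> T)"
  shows "arc_step m s0 c X k T"
  using assms unfolding arc_step_def by simp

lemma arc_stepD:
  assumes "arc_step m s0 c X k T"
  shows "mods c \<subseteq> arc_vars"
    "(\<And>x. x \<notin> arc_vars \<Longrightarrow> s x = s0 x) \<Longrightarrow> arc_lists m S j s \<Longrightarrow>
      runs c s (\<lambda>t s'. arc_lists m (S \<union> X) (j + k) s' \<and> t \<le> T)"
  using assms unfolding arc_step_def by simp_all

lemma arc_step_Seq:
  assumes "arc_step m s0 c1 X k1 T1" "arc_step m s0 c2 Y k2 T2"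
  shows "arc_step m s0 (c1;; c2) (X \<union> Y) (k1 + k2) (T1 + T2)"
proof (rule arc_stepI)
  show "mods (c1;; c2) \<subseteq> arc_vars" using assms arc_stepD(1) by simp
next
  fix s S j assume s: "\<And>x. x \<notin> arc_vars \<Longrightarrow> s x = s0 x" and S: "arc_lists m S j s"
  show "runs (c1;; c2) s (\<lambda>t s'. arc_lists m (S \<union> (X \<union> Y)) (j + (k1 + k2)) s' \<and> t \<le> T1 + T2)"
    unfolding runs_Seq
  proof (rule runs_conseq[OF arc_stepD(2)[OF assms(1) s S]])
    fix t1 s1 assume 1: "arc_lists m (S \<union> X) (j + k1) s1 \<and> t1 \<le> T1"
      and fr: "\<And>x. x \<notin> mods c1 \<Longrightarrow> s1 x = s x"
    have "s1 x = s0 x" if "x \<notin> arc_vars" for x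
      using fr[of x] s[OF that] that arc_stepD(1)[OF assms(1)] by auto
    from arc_stepD(2)[OF assms(2) this conjunct1[OF 1]]
    show "runs c2 s1 (\<lambda>t2 s2. arc_lists m (S \<union> (X \<union> Y)) (j + (k1 + k2)) s2 \<and> t1 + t2 \<le> T1 + T2)"
      by (rule runs_conseq) (use 1 in \<open>auto simp: Un_assoc add.assoc\<close>)
  qed
qed

lemma arc_step_If:
  assumes "arc_step m s0 c1 X k T" "arc_step m s0 c2 Y k T"
    and "\<And>s. (\<And>x. x \<notin> arc_vars \<Longrightarrow> s x = s0 x) \<Longrightarrow> bval b s = B \<and> bcost unit_cost b s \<le> Tb"
  shows "arc_step m s0 (IF b THEN c1 ELSE c2) (if B then X else Y) k (Tb + T)"
proof (rule arc_stepI)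
  show "mods (IF b THEN c1 ELSE c2) \<subseteq> arc_vars" using assms(1,2) arc_stepD(1) by simp
next
  fix s S j assume s: "\<And>x. x \<notin> arc_vars \<Longrightarrow> s x = s0 x" and S: "arc_lists m S j s"
  note b = assms(3)[OF s]
  show "runs (IF b THEN c1 ELSE c2) s
      (\<lambda>t s'. arc_lists m (S \<union> (if B then X else Y)) (j + k) s' \<and> t \<le> Tb + T)"
    using arc_stepD(2)[OF assms(1) s S] arc_stepD(2)[OF assms(2) s S] b
    by (cases B) (auto elim!: runs_conseq)
qed

lemma arc_step_SKIP: "0 < T \<Longrightarrow> arc_step m s0 SKIP {} k T"
  by (rule arc_stepI) (auto intro: arc_lists_mono)

lemma arc_step_mono:
  assumes "arc_step m s0 c X k T" "k \<le> k'" "T \<le> T'"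
  shows "arc_step m s0 c X k' T'"
proof (rule arc_stepI)
  fix s S j assume s: "\<And>x. x \<notin> arc_vars \<Longrightarrow> s x = s0 x" and S: "arc_lists m S j s"
  show "runs c s (\<lambda>t s'. arc_lists m (S \<union> X) (j + k') s' \<and> t \<le> T')"
    by (rule runs_conseq[OF arc_stepD(2)[OF assms(1) s S]])
      (use assms(2,3) in \<open>auto elim!: arc_lists_mono\<close>)
qed (rule arc_stepD(1)[OF assms(1)])

lemma arc_step_add_arc:
  assumes "{p, q, r, t} \<subseteq> {''x'', ''y'', ''z''}"
    and "s0 ''row'' (s0 p 0) + s0 q 0 = u" "u < m" "s0 ''row'' (s0 r 0) + s0 t 0 = v"
  shows "arc_step m s0 (add_arc (pair p q) (pair r t)) {(u,v)} 1 50"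
proof (rule arc_stepI)
  fix s S j assume s: "\<And>x. x \<notin> arc_vars \<Longrightarrow> s x = s0 x" and S: "arc_lists m S j s"
  have keep: "s x = s0 x" if "x \<in> {''x'', ''y'', ''z'', ''row''}" for x
    by (rule s) (use that in \<open>auto simp: arc_vars_def\<close>)
  have "s p = s0 p" "s q = s0 q" "s r = s0 r" "s t = s0 t" "s ''row'' = s0 ''row''"
  proof -
    have sub: "{''x'', ''y'', ''z''} \<subseteq> {''x'', ''y'', ''z'', ''row''}" by blast
    show "s p = s0 p" "s q = s0 q" "s r = s0 r" "s t = s0 t"
      by (rule keep, rule subsetD[OF sub], use assms(1) in \<open>simp only: insert_subset\<close>)+
    show "s ''row'' = s0 ''row''" by (rule keep) simp
  qed
  then have uv: "s ''row'' (s p 0) + s q 0 = u" "s ''row'' (s r 0) + s t 0 = v"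
    using assms(2,4) by simp_all
  show "runs (add_arc (pair p q) (pair r t)) s
      (\<lambda>t s'. arc_lists m (S \<union> {(u,v)}) (j + 1) s' \<and> t \<le> 50)"
    by (rule runs_conseq[OF runs_add_arc[OF S assms(1) uv(1) assms(3) uv(2)]]) simp
qed (simp add: arc_vars_def)

text \<open>If \<open>x\<close> and \<open>z\<close> are not adjacent, \<open>B1\<close> and
  \<open>B2\<close> contribute one arc each and \<open>B3\<close> two; if they are,
  \<open>T3\<close> contributes two. Hence the number 4.\<close>

lemma add_triple_step:
  assumes row: "\<And>x. x < n \<Longrightarrow> s ''row'' x = x * n"
    and x: "s ''x'' 0 = x" "x < n" and y: "s ''y'' 0 = y" "y < n" and z: "s ''z'' 0 = z" "z < n"
  shows "arc_step (n * n) s add_triple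
    (triple_arcs n (\<lambda>x y. s ''adj'' (x * n + y) = 1) (\<lambda>i. s ''F'' i = 1) x y z) 4 400"
proof -
  let ?E = "\<lambda>x y. s ''adj'' (x * n + y) = 1" and ?f = "\<lambda>i. s ''F'' i = 1"
  note less = encode_less[OF x(2) y(2)] encode_less[OF y(2) x(2)]
  have arc: "arc_step (n * n) s (add_arc (pair ''x'' ''y'') (pair ''y'' ''z'')) {(x * n + y, y * n + z)} 1 50"
    "arc_step (n * n) s (add_arc (pair ''y'' ''x'') (pair ''x'' ''z'')) {(y * n + x, x * n + z)} 1 50"
    "arc_step (n * n) s (add_arc (pair ''y'' ''x'') (pair ''z'' ''y'')) {(y * n + x, z * n + y)} 1 50"
    "arc_step (n * n) s (add_arc (pair ''x'' ''y'') (pair ''z'' ''y'')) {(x * n + y, z * n + y)} 1 50"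
    "arc_step (n * n) s (add_arc (pair ''y'' ''x'') (pair ''y'' ''z'')) {(y * n + x, y * n + z)} 1 50"
    by (rule arc_step_add_arc; use x y z row less in simp)+
  have keep: "s' ''x'' = s ''x''" "s' ''y'' = s ''y''" "s' ''z'' = s ''z''" "s' ''row'' = s ''row''"
    "s' ''adj'' = s ''adj''" "s' ''F'' = s ''F''" if "\<And>x. x \<notin> arc_vars \<Longrightarrow> s' x = s x" for s'
    using that by (simp_all add: arc_vars_def)
  have F: "bval (''F''\<langle>N i\<rangle> \<doteq> N 1) s' = ?f i \<and> bcost unit_cost (''F''\<langle>N i\<rangle> \<doteq> N 1) s' \<le> 10"
    if "\<And>x. x \<notin> arc_vars \<Longrightarrow> s' x = s x" for s' i
    using keep[OF that] by simp
  have if3: "arc_step (n * n) s (IF ''F''\<langle>N 3\<rangle> \<doteq> N 1 THEN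
        (add_arc (pair ''x'' ''y'') (pair ''y'' ''z'');; add_arc (pair ''y'' ''x'') (pair ''x'' ''z''))
      ELSE SKIP) (if ?f 3 then {(x * n + y, y * n + z)} \<union> {(y * n + x, x * n + z)} else {})
      (1 + 1) (10 + (50 + 50))"
    by (rule arc_step_If[OF arc_step_Seq[OF arc(1,2)] arc_step_SKIP F]) simp
  have if0: "arc_step (n * n) s (IF ''F''\<langle>N 0\<rangle> \<doteq> N 1 THEN
        add_arc (pair ''x'' ''y'') (pair ''y'' ''z'') ELSE SKIP)
      (if ?f 0 then {(x * n + y, y * n + z)} else {}) 1 (10 + 50)"
    by (rule arc_step_If[OF arc(1) arc_step_SKIP F]) simp
  have if1: "arc_step (n * n) s (IF ''F''\<langle>N 1\<rangle> \<doteq> N 1 THEN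
        add_arc (pair ''y'' ''x'') (pair ''z'' ''y'') ELSE SKIP)
      (if ?f 1 then {(y * n + x, z * n + y)} else {}) 1 (10 + 50)"
    by (rule arc_step_If[OF arc(3) arc_step_SKIP F]) simp
  have if2: "arc_step (n * n) s (IF ''F''\<langle>N 2\<rangle> \<doteq> N 1 THEN
        (add_arc (pair ''x'' ''y'') (pair ''z'' ''y'');; add_arc (pair ''y'' ''x'') (pair ''y'' ''z''))
      ELSE SKIP) (if ?f 2 then {(x * n + y, z * n + y)} \<union> {(y * n + x, y * n + z)} else {})
      (1 + 1) (10 + (50 + 50))"
    by (rule arc_step_If[OF arc_step_Seq[OF arc(4,5)] arc_step_SKIP F]) simp
  have "arc_step (n * n) s add_triple
    (if ?E x y \<and> ?E y z \<and> x \<noteq> z then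
       if ?E z x then
         if ?f 3 then {(x * n + y, y * n + z)} \<union> {(y * n + x, x * n + z)} else {}
       else (if ?f 0 then {(x * n + y, y * n + z)} else {}) \<union>
         ((if ?f 1 then {(y * n + x, z * n + y)} else {}) \<union>
         (if ?f 2 then {(x * n + y, z * n + y)} \<union> {(y * n + x, y * n + z)} else {}))
     else {}) 4 (50 + (50 + 300))"
    unfolding add_triple_def
  proof (rule arc_step_If[OF arc_step_If arc_step_SKIP], goal_cases)
    case 1 show ?case by (rule arc_step_mono[OF if3]) simp_all
  next
    case 2 show ?case by (rule arc_step_mono[OF arc_step_Seq[OF if0 arc_step_Seq[OF if1 if2]]]) simp_all
  next
    case (3 s')
    note k = keep[of s', OF 3]
    show ?case using x y z row by (simp add: edge_def pair_def k)
  next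
    case (5 s')
    note k = keep[of s', OF 5]
    show ?case using x y z row by (simp add: edge_def pair_def k)
  qed simp
  also have "(if ?E x y \<and> ?E y z \<and> x \<noteq> z then
       if ?E z x then
         if ?f 3 then {(x * n + y, y * n + z)} \<union> {(y * n + x, x * n + z)} else {}
       else (if ?f 0 then {(x * n + y, y * n + z)} else {}) \<union>
         ((if ?f 1 then {(y * n + x, z * n + y)} else {}) \<union>
         (if ?f 2 then {(x * n + y, z * n + y)} \<union> {(y * n + x, y * n + z)} else {}))
     else {}) = triple_arcs n ?E ?f x y z"
    unfolding triple_arcs_def by (simp only: Un_assoc insert_is_Un[symmetric])
  finally show ?thesis by simp
qed

lemma mods_add_triple [simp]: "mods add_triple = {''arcs'', ''target'', ''next'', ''first''}"
  by (auto simp: add_triple_def)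

section \<open>The loops over all triples\<close>

context
  fixes n :: nat and adj flags :: "nat \<Rightarrow> nat" and arcs_of :: "nat \<Rightarrow> nat \<Rightarrow> nat \<Rightarrow> (nat \<times> nat) set"
  defines arcs_of_def: "arcs_of \<equiv> triple_arcs n (\<lambda>x y. adj (x * n + y) = 1) (\<lambda>i. flags i = 1)"
begin

abbreviation (input) input_ok :: "mem \<Rightarrow> bool" where
  "input_ok s \<equiv> s ''n'' 0 = n \<and> (\<forall>x<n. s ''row'' x = x * n) \<and> s ''adj'' = adj \<and> s ''F'' = flags"

lemma runs_triples_z:
  assumes s: "input_ok s" "s ''x'' 0 = x" "x < n" "s ''y'' 0 = y" "y < n" and S: "arc_lists (n * n) S j s"
  shows "runs (FOR ''z'' (V ''n'') add_triple) s
    (\<lambda>t s'. arc_lists (n * n) (S \<union> (\<Union>z<n. arcs_of x y z)) (j + n * 4) s' \<and> t \<le> 8 + n * (400 + 11))"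
proof (rule runs_FOR'[where P = "\<lambda>k. arc_lists (n * n) (S \<union> (\<Union>z<k. arcs_of x y z)) (j + k * 4)"], goal_cases)
  case (4)
  show ?case using S by (subst arc_lists_cong[of _ s]) simp_all
next
  case (5 k s')
  note keep = 5(5)[of "''n''"] 5(5)[of "''row''"] 5(5)[of "''adj''"] 5(5)[of "''F''"] 5(5)[of "''x''"] 5(5)[of "''y''"]
  have step: "arc_step (n * n) s' add_triple (arcs_of x y k) 4 400"
    using add_triple_step[of n s' x y k] 5(2,3) keep s unfolding arcs_of_def by simp
  show ?case
    by (rule runs_conseq[OF arc_stepD(2)[OF step refl 5(1)]])
      (use 5(2,5) in \<open>simp add: lessThan_Suc Un_ac add.commute add.left_commute\<close>)
qed (use s in auto)

lemma runs_triples_y: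
  assumes s: "input_ok s" "s ''x'' 0 = x" "x < n" and S: "arc_lists (n * n) S j s"
  shows "runs (FOR ''y'' (V ''n'') (FOR ''z'' (V ''n'') add_triple)) s
    (\<lambda>t s'. arc_lists (n * n) (S \<union> (\<Union>y<n. \<Union>z<n. arcs_of x y z)) (j + n * (n * 4)) s' \<and>
      t \<le> 8 + n * (8 + n * (400 + 11) + 11))"
proof (rule runs_FOR'[where P = "\<lambda>k. arc_lists (n * n) (S \<union> (\<Union>y<k. \<Union>z<n. arcs_of x y z)) (j + k * (n * 4))"], goal_cases)
  case (4)
  show ?case using S by (subst arc_lists_cong[of _ s]) simp_all
next
  case (5 k s')
  note keep = 5(5)[of "''n''"] 5(5)[of "''row''"] 5(5)[of "''adj''"] 5(5)[of "''F''"] 5(5)[of "''x''"]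
  have ok: "input_ok s'" "s' ''x'' 0 = x" using keep s by simp_all
  show ?case
    by (rule runs_conseq[OF runs_triples_z[OF ok s(3) 5(2,3,1)]])
      (use 5(2,5) in \<open>simp add: lessThan_Suc Un_ac add.commute add.left_commute\<close>)
qed (use s in auto)

lemma runs_construct:
  assumes s: "input_ok s" and first: "\<forall>v < n * n. s ''first'' v = 0"
  shows "runs construct_constraint_digraph s
    (\<lambda>t s'. arc_lists (n * n) (\<Union>x<n. \<Union>y<n. \<Union>z<n. arcs_of x y z) (n * (n * (n * 4))) s' \<and>
      t \<le> 450 * n ^ 3 + 20)"
proof -
  have "runs (FOR ''x'' (V ''n'') (FOR ''y'' (V ''n'') (FOR ''z'' (V ''n'') add_triple)))
      (s(''arcs'' := (s ''arcs'')(0 := 0)))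
      (\<lambda>t s'. arc_lists (n * n) (\<Union>x<n. \<Union>y<n. \<Union>z<n. arcs_of x y z) (n * (n * (n * 4))) s' \<and>
        t \<le> 8 + n * (8 + n * (8 + n * (400 + 11) + 11) + 11))"
  proof (rule runs_FOR'[where P = "\<lambda>k. arc_lists (n * n) (\<Union>x<k. \<Union>y<n. \<Union>z<n. arcs_of x y z) (k * (n * (n * 4)))"],
      goal_cases)
    case 4
    show ?case using first by (auto simp: arc_lists_def)
  next
    case (5 k s')
    note keep = 5(5)[of "''n''"] 5(5)[of "''row''"] 5(5)[of "''adj''"] 5(5)[of "''F''"]
    have ok: "input_ok s'" using keep s by simp
    show ?case
      by (rule runs_conseq[OF runs_triples_y[OF ok 5(2,3,1)]])
        (use 5(2,5) in \<open>simp add: lessThan_Suc Un_ac add.commute add.left_commute\<close>)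
  qed (use s in auto)
  moreover have "8 + n * (8 + n * (8 + n * (400 + 11) + 11) + 11) \<le> 450 * n ^ 3 + 17"
  proof -
    have le: "n \<le> n ^ 3" "n ^ 2 \<le> n ^ 3" by (cases n; simp add: power_increasing self_le_power)+
    have "8 + n * (8 + n * (8 + n * (400 + 11) + 11) + 11) = 8 + 19 * n + 19 * n ^ 2 + 411 * n ^ 3"
      by (simp add: algebra_simps power2_eq_square power3_eq_cube)
    with le show ?thesis by linarith
  qed
  ultimately show ?thesis
    unfolding construct_constraint_digraph_def add_triple_def[symmetric]
    by (auto elim!: runs_conseq)
qed

end

section \<open>Invariants of Tarjan's algorithm\<close>

text \<open>The vertices on Tarjan's stack are those with \<open>num v \<noteq> 0\<close> and \<open>comp v = 0\<close>, here called open.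
  The assumption \<open>low_bound\<close> concerns an open vertex \<open>u\<close> in the segment of the stack between a
  vertex \<open>c\<close> of the call stack and the next one.\<close>

definition edges :: "('v \<Rightarrow> 'v set) \<Rightarrow> ('v \<times> 'v) set" where
  "edges E = {(u,v). v \<in> E u}"

text \<open>\<open>call_reach\<close> and \<open>open_reach\<close> complement each other: a call
  vertex reaches every later open vertex, and every open vertex reaches a call vertex that is not
  later. Together they make a popped segment strongly connected, while \<open>low_bound\<close>
  makes it closed. \<open>low_reach\<close> ensures that a low-link below the visiting number is no
  false alarm: it is the number of an open vertex that can be reached.\<close>

locale tarjan_state =
  fixes V :: "'v set" and E :: "'v \<Rightarrow> 'v set"
    and num low comp :: "'v \<Rightarrow> nat" and todo :: "'v \<Rightarrow> 'v set" and call :: "'v list"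
  assumes visited_V: "num v \<noteq> 0 \<Longrightarrow> v \<in> V"
    and comp_visited: "comp v \<noteq> 0 \<Longrightarrow> num v \<noteq> 0"
    and num_inj: "num u \<noteq> 0 \<Longrightarrow> num u = num v \<Longrightarrow> u = v"
    and call_open: "c \<in> set call \<Longrightarrow> num c \<noteq> 0 \<and> comp c = 0"
    and call_sorted: "sorted_wrt (\<lambda>a b. num a < num b) call"
    and todo_sub: "num v \<noteq> 0 \<Longrightarrow> todo v \<subseteq> E v"
    and explored_visited: "num v \<noteq> 0 \<Longrightarrow> u \<in> E v \<Longrightarrow> u \<notin> todo v \<Longrightarrow> num u \<noteq> 0"
    and finished: "num v \<noteq> 0 \<Longrightarrow> v \<notin> set call \<Longrightarrow> todo v = {}"
    and comp_closed: "comp v \<noteq> 0 \<Longrightarrow> u \<in> E v \<Longrightarrow> comp u \<noteq> 0 \<and> comp u \<le> comp v"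
    and comp_reach: "comp v \<noteq> 0 \<Longrightarrow> comp u = comp v \<Longrightarrow> (v,u) \<in> (edges E)\<^sup>*"
    and call_reach: "c \<in> set call \<Longrightarrow> num u \<noteq> 0 \<Longrightarrow> comp u = 0 \<Longrightarrow> num c \<le> num u \<Longrightarrow>
      (c,u) \<in> (edges E)\<^sup>*"
    and open_reach: "num u \<noteq> 0 \<Longrightarrow> comp u = 0 \<Longrightarrow>
      \<exists>c \<in> set call. num c \<le> num u \<and> (u,c) \<in> (edges E)\<^sup>*"
    and low_reach: "c \<in> set call \<Longrightarrow> low c \<le> num c \<and>
      (\<exists>w. num w \<noteq> 0 \<and> comp w = 0 \<and> num w = low c \<and> (c,w) \<in> (edges E)\<^sup>*)"
    and low_bound: "c \<in> set call \<Longrightarrow> num u \<noteq> 0 \<Longrightarrow> comp u = 0 \<Longrightarrow> num c \<le> num u \<Longrightarrow>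
      \<forall>d \<in> set call. num c < num d \<longrightarrow> num u < num d \<Longrightarrow>
      x \<in> E u \<Longrightarrow> x \<notin> todo u \<Longrightarrow> comp x = 0 \<Longrightarrow> low c \<le> num x"
begin

lemma visit:
  assumes u: "u \<in> V" "num u = 0" and k: "\<And>v. num v < k"
    and todo': "\<And>v. todo' v \<subseteq> todo v" "\<And>v. todo v \<subseteq> insert u (todo' v)"
    and reach: "\<And>c. c \<in> set call \<Longrightarrow> (c,u) \<in> (edges E)\<^sup>*"
  shows "tarjan_state V E (num(u := k)) (low(u := k)) comp (todo'(u := E u)) (call @ [u])"
proof -
  have cu: "comp u = 0" using comp_visited u by blast
  have k0: "k \<noteq> 0" using k[of u] by simp
  have uc: "u \<notin> set call" using call_open u by blast
  have kn: "num v \<noteq> k" "\<not> k \<le> num v" "\<not> k < num v" "num v \<le> k" for v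
    using k[of v] by simp_all
  have call: "c \<noteq> u" if "c \<in> set call" for c using that uc by blast
  show ?thesis
  proof
    fix v assume "(num(u := k)) v \<noteq> 0" then show "v \<in> V" using visited_V u by (auto split: if_splits)
  next
    fix v assume "comp v \<noteq> 0" then show "(num(u := k)) v \<noteq> 0" using comp_visited k0 by auto
  next
    fix v w assume "(num(u := k)) v \<noteq> 0" "(num(u := k)) v = (num(u := k)) w"
    then show "v = w" using num_inj kn by (metis fun_upd_apply)
  next
    fix c assume "c \<in> set (call @ [u])"
    then show "(num(u := k)) c \<noteq> 0 \<and> comp c = 0" using call_open k0 cu by auto
  next
    have "sorted_wrt (\<lambda>a b. (num(u := k)) a < (num(u := k)) b) call"
      by (rule sorted_wrt_mono_rel[OF _ call_sorted]) (use call in auto)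
    then show "sorted_wrt (\<lambda>a b. (num(u := k)) a < (num(u := k)) b) (call @ [u])"
      using k call by (auto simp: sorted_wrt_append)
  next
    fix v assume "(num(u := k)) v \<noteq> 0"
    then show "(todo'(u := E u)) v \<subseteq> E v" using todo_sub todo'(1) by (auto split: if_splits)
  next
    fix v w assume "(num(u := k)) v \<noteq> 0" "w \<in> E v" "w \<notin> (todo'(u := E u)) v"
    then show "(num(u := k)) w \<noteq> 0" using explored_visited[of v w] todo'(2)[of v] k0
      by (auto split: if_splits)
  next
    fix v assume "(num(u := k)) v \<noteq> 0" "v \<notin> set (call @ [u])"
    then show "(todo'(u := E u)) v = {}" using finished[of v] todo'(1)[of v] by auto
  next
    fix v w assume "comp v \<noteq> 0" "w \<in> E v" then show "comp w \<noteq> 0 \<and> comp w \<le> comp v"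
      by (rule comp_closed)
  next
    fix v w assume "comp v \<noteq> 0" "comp w = comp v" then show "(v,w) \<in> (edges E)\<^sup>*"
      by (rule comp_reach)
  next
    fix c w assume "c \<in> set (call @ [u])" "(num(u := k)) w \<noteq> 0" "comp w = 0"
      "(num(u := k)) c \<le> (num(u := k)) w"
    then show "(c,w) \<in> (edges E)\<^sup>*"
      using call_reach[of c w] reach[of c] kn call[of c] by (auto split: if_splits)
  next
    fix w assume "(num(u := k)) w \<noteq> 0" "comp w = 0"
    then show "\<exists>c \<in> set (call @ [u]). (num(u := k)) c \<le> (num(u := k)) w \<and> (w,c) \<in> (edges E)\<^sup>*"
      using open_reach[of w] call by (cases "w = u") fastforce+
  next
    fix c assume c: "c \<in> set (call @ [u])"
    show "(low(u := k)) c \<le> (num(u := k)) c \<and>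
      (\<exists>w. (num(u := k)) w \<noteq> 0 \<and> comp w = 0 \<and> (num(u := k)) w = (low(u := k)) c \<and>
        (c,w) \<in> (edges E)\<^sup>*)"
    proof (cases "c = u")
      case True
      then show ?thesis using k0 cu by (auto intro: exI[of _ u])
    next
      case False
      with c have "c \<in> set call" by simp
      from low_reach[OF this] obtain w where "low c \<le> num c" "num w \<noteq> 0" "comp w = 0"
        "num w = low c" "(c,w) \<in> (edges E)\<^sup>*" by blast
      with False u show ?thesis by (auto intro!: exI[of _ w])
    qed
  next
    fix c w x assume A: "c \<in> set (call @ [u])" "(num(u := k)) w \<noteq> 0" "comp w = 0"
      "(num(u := k)) c \<le> (num(u := k)) w"
      "\<forall>d \<in> set (call @ [u]). (num(u := k)) c < (num(u := k)) d \<longrightarrow> (num(u := k)) w < (num(u := k)) d"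
      "x \<in> E w" "x \<notin> (todo'(u := E u)) w" "comp x = 0"
    have wu: "w \<noteq> u" using A by auto
    with A have w: "num w \<noteq> 0" "x \<notin> todo' w" by auto
    \<comment> \<open>Nothing is numbered after \<open>u\<close>, so an older vertex cannot lie in
      its segment.\<close>
    have cu': "c \<noteq> u" using A(4) wu kn by auto
    with A have c: "c \<in> set call" "num c \<le> num w" using wu by auto
    show "(low(u := k)) c \<le> (num(u := k)) x"
    proof (cases "x = u")
      \<comment> \<open>An explored arc into the new vertex is harmless: low-links do not exceed
        visiting numbers, and these are below \<open>k\<close>.\<close>
      case True
      then show ?thesis using low_reach[OF c(1)] k[of c] cu' by auto
    next
      case False
      then have "x \<notin> todo w" using todo'(2)[of w] w(2) by blast
      moreover have "\<forall>d \<in> set call. num c < num d \<longrightarrow> num w < num d"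
        using A(5) wu cu' call by auto
      ultimately show ?thesis using low_bound[of c w x] c w(1) A(3,6,8) False cu' by simp
    qed
  qed
qed

text \<open>The explored arc leaves the top of the call stack, so it affects
  \<open>low_bound\<close> only for the topmost segment. If its target is open, the low-link of
  \<open>v\<close> is lowered to the number of the target, which also witnesses
  \<open>low_reach\<close>.\<close>

lemma explore_visited:
  assumes v: "call = cs @ [v]" and u: "num u \<noteq> 0" "u \<in> E v"
    and todo': "todo' v \<subseteq> todo v" "todo v \<subseteq> insert u (todo' v)" "\<And>w. w \<noteq> v \<Longrightarrow> todo' w = todo w"
    and low': "low' v = (if comp u = 0 \<and> num u < low v then num u else low v)"
      "\<And>w. w \<noteq> v \<Longrightarrow> low' w = low w"
  shows "tarjan_state V E num low' comp todo' call"
proof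
  have vc: "v \<in> set call" using v by simp
  have vu: "(v,u) \<in> (edges E)\<^sup>*" using u(2) by (auto simp: edges_def)
  have todo_le: "todo' w \<subseteq> todo w" for w using todo' by (cases "w = v") auto
  have low_le: "low' w \<le> low w" for w using low' by (cases "w = v") auto
  have le_v: "num c \<le> num v" if "c \<in> set call" for c
    using call_sorted that v by (auto simp: sorted_wrt_append)
  {
    fix v assume "num v \<noteq> 0" then show "todo' v \<subseteq> E v" using todo_sub todo_le by blast
  next
    fix x w assume A: "num w \<noteq> 0" "x \<in> E w" "x \<notin> todo' w"
    show "num x \<noteq> 0"
      using explored_visited[OF A(1,2)] todo'(2,3) A(3) u by (metis insertE subsetD)
  next
    fix v assume "num v \<noteq> 0" "v \<notin> set call" then show "todo' v = {}" using finished todo_le by blast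
  next
    fix c assume c: "c \<in> set call"
    show "low' c \<le> num c \<and>
      (\<exists>w. num w \<noteq> 0 \<and> comp w = 0 \<and> num w = low' c \<and> (c,w) \<in> (edges E)\<^sup>*)"
    proof (cases "c = v \<and> comp u = 0 \<and> num u < low v")
      case True
      then show ?thesis using low_reach[OF c] low'(1) vu u by (auto intro!: exI[of _ u])
    next
      case False
      then have "low' c = low c" using low' by metis
      then show ?thesis using low_reach[OF c] by simp
    qed
  next
    fix c w x assume A: "c \<in> set call" "num w \<noteq> 0" "comp w = 0" "num c \<le> num w"
      "\<forall>d \<in> set call. num c < num d \<longrightarrow> num w < num d" "x \<in> E w" "x \<notin> todo' w" "comp x = 0"
    show "low' c \<le> num x"
    proof (cases "x \<in> todo w")
      case False
      from low_bound[OF A(1-6) False A(8)] low_le[of c] show ?thesis by simp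
    next
      case True
      with A(7) todo'(3) have "w = v" by metis
      with A(7) True todo'(2) have "x = u" by blast
      \<comment> \<open>The top \<open>v\<close> lies in the segment of \<open>c\<close>, and no
        call vertex separates a vertex from itself.\<close>
      have "c = v"
        using A(5) vc \<open>w = v\<close> le_v[OF A(1)] num_inj call_open A(1)
        by (metis le_neq_implies_less less_irrefl)
      with \<open>x = u\<close> show ?thesis using low'(1) A(8) by auto
    qed
  }
qed (fact visited_V comp_visited num_inj call_open call_sorted comp_closed comp_reach call_reach open_reach)+

section \<open>Leaving the vertex on top of the call stack\<close>

context
  fixes v :: 'v and cs :: "'v list"
  assumes call: "call = cs @ [v]" and nothing_todo: "todo v = {}"
begin

lemma cs_less: "c \<in> set cs \<Longrightarrow> num c < num v"
  using call_sorted call by (auto simp: sorted_wrt_append)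

lemma call_le: "c \<in> set call \<Longrightarrow> num c \<le> num v"
  using cs_less call by fastforce

lemma call_none_above: "d \<in> set call \<Longrightarrow> \<not> num v < num d"
  using call_le by (simp add: not_less)

lemma v_open: "num v \<noteq> 0" "comp v = 0"
  using call_open[of v] call by auto

text \<open>The low-link witnesses an open vertex \<open>w\<close> before \<open>v\<close>, and
  \<open>w\<close> reaches a call vertex \<open>c\<close> before \<open>v\<close>. So
  \<open>v\<close> is not at the bottom of the call stack, and vertices that met
  \<open>open_reach\<close> by means of \<open>v\<close> can continue to \<open>c\<close>. The
  segment of \<open>v\<close> is merged into that of \<open>p\<close>, whose low-link therefore
  takes the minimum.\<close>

lemma finish_low:
  assumes "low v \<noteq> num v"
  shows "cs \<noteq> []" "p = last cs \<Longrightarrow> low' = low(p := min (low p) (low v)) \<Longrightarrow>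
    tarjan_state V E num low' comp todo cs"
proof -
  obtain w where w: "num w \<noteq> 0" "comp w = 0" "num w = low v" "(v,w) \<in> (edges E)\<^sup>*"
    and lv: "low v < num v"
    using low_reach[of v] call assms by auto
  obtain c where c: "c \<in> set call" "num c \<le> num w" "(w,c) \<in> (edges E)\<^sup>*"
    using open_reach[OF w(1,2)] by blast
  then have "c \<noteq> v" using w lv by auto
  with c have c_cs: "c \<in> set cs" using call by simp
  then show "cs \<noteq> []" by auto
  assume p: "p = last cs" and low': "low' = low(p := min (low p) (low v))"
  have pcs: "p \<in> set cs" using p \<open>cs \<noteq> []\<close> by simp
  obtain ds where ds: "cs = ds @ [p]" using p \<open>cs \<noteq> []\<close> by (metis append_butlast_last_id)
  have le_p: "num d \<le> num p" if "d \<in> set cs" for d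
  proof -
    have "sorted_wrt (\<lambda>a b. num a < num b) (ds @ [p])"
      using call_sorted unfolding call ds sorted_wrt_append by blast
    then show ?thesis using that ds by (auto simp: sorted_wrt_append)
  qed
  have pv: "(p,v) \<in> (edges E)\<^sup>*"
    using call_reach[of p v] call pcs v_open cs_less[OF pcs] by simp
  show "tarjan_state V E num low' comp todo cs"
  proof
    fix c assume "c \<in> set cs" then show "num c \<noteq> 0 \<and> comp c = 0" using call_open call by simp
  next
    show "sorted_wrt (\<lambda>a b. num a < num b) cs" using call_sorted call by (simp add: sorted_wrt_append)
  next
    fix u assume "num u \<noteq> 0" "u \<notin> set cs"
    then show "todo u = {}" using finished[of u] nothing_todo call by (cases "u = v") auto
  next
    fix c u assume "c \<in> set cs" "num u \<noteq> 0" "comp u = 0" "num c \<le> num u"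
    then show "(c,u) \<in> (edges E)\<^sup>*" using call_reach call by simp
  next
    fix u assume u: "num u \<noteq> 0" "comp u = 0"
    from open_reach[OF u] obtain d where d: "d \<in> set call" "num d \<le> num u" "(u,d) \<in> (edges E)\<^sup>*"
      by blast
    show "\<exists>c \<in> set cs. num c \<le> num u \<and> (u,c) \<in> (edges E)\<^sup>*"
    proof (cases "d = v")
      case True
      then have "(u,c) \<in> (edges E)\<^sup>*" using d(3) w(4) c(3) by (meson rtrancl_trans)
      moreover have "num c \<le> num u" using c(2) w(3) lv d(2) True by simp
      ultimately show ?thesis using c_cs by blast
    qed (use d call in auto)
  next
    fix d assume d: "d \<in> set cs"
    show "low' d \<le> num d \<and> (\<exists>w. num w \<noteq> 0 \<and> comp w = 0 \<and> num w = low' d \<and> (d,w) \<in> (edges E)\<^sup>*)"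
    proof (cases "d = p \<and> low v < low p")
      case True
      then have "low' d = low v" by (simp add: low')
      moreover have "low p \<le> num p" using low_reach[of p] call pcs by simp
      moreover have "(p,w) \<in> (edges E)\<^sup>*" using pv w(4) by (rule rtrancl_trans)
      ultimately show ?thesis using True w by (metis less_imp_le order_trans)
    next
      case False
      then have "low' d = low d" by (auto simp: low')
      then show ?thesis using low_reach[of d] d call by simp
    qed
  next
    fix c u x assume A: "c \<in> set cs" "num u \<noteq> 0" "comp u = 0" "num c \<le> num u"
      "\<forall>d \<in> set cs. num c < num d \<longrightarrow> num u < num d" "x \<in> E u" "x \<notin> todo u" "comp x = 0"
    have low_le: "low' c \<le> low c" by (simp add: low')
    show "low' c \<le> num x"
    proof (cases "num v \<le> num u")
      case True
      \<comment> \<open>Here \<open>u\<close> comes from the segment of \<open>v\<close>; on the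
        shortened call stack it belongs to the last segment, that of \<open>p\<close>.\<close>
      have "c = p"
        using A(5) pcs le_p[OF A(1)] cs_less[OF pcs] True num_inj call_open[of c] call A(1)
        by (metis Un_iff le_neq_implies_less less_trans not_le set_append)
      moreover have "low v \<le> num x"
        using low_bound[of v u x] True call_none_above call A by simp
      ultimately show ?thesis by (simp add: low')
    next
      case False
      have "\<forall>d \<in> set call. num c < num d \<longrightarrow> num u < num d" using A(5) False call by auto
      with low_bound[of c u x] A call low_le show ?thesis by simp
    qed
  qed (fact visited_V comp_visited num_inj todo_sub explored_visited comp_closed comp_reach)+
qed

text \<open>The popped vertices are connected through \<open>v\<close>: \<open>call_reach\<close>
  leads from \<open>v\<close> to each of them, \<open>open_reach\<close> followed by
  \<open>call_reach\<close> leads back. As \<open>k\<close> exceeds all earlier component numbers,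
  arcs into older components respect \<open>comp_closed\<close>.\<close>

lemma finish_root:
  assumes low: "low v = num v" and k: "\<And>u. comp u < k"
    and comp': "\<And>u. comp' u = (if num u \<noteq> 0 \<and> comp u = 0 \<and> num v \<le> num u then k else comp u)"
  shows "tarjan_state V E num low comp' todo cs"
proof -
  have k0: "k \<noteq> 0" using k[of v] by simp
  have kc: "comp u \<noteq> k" "comp u \<le> k" for u using k[of u] by simp_all
  \<comment> \<open>No other call vertex is numbered from \<open>v\<close> onwards, so all these
    vertices have been finished.\<close>
  have todo0: "todo u = {}" if "num u \<noteq> 0" "num v \<le> num u" for u
    using finished[of u] that call_le[of u] num_inj[of v u] nothing_todo v_open by fastforce
  have closed: "comp' x \<noteq> 0 \<and> comp' x \<le> k" if "comp' u = k" "x \<in> E u" for u x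
  proof -
    have u: "num u \<noteq> 0" "comp u = 0" "num v \<le> num u"
      using that(1) kc by (auto simp: comp' split: if_splits)
    have "num x \<noteq> 0" using explored_visited[OF u(1) that(2)] todo0[OF u(1,3)] by simp
    moreover have "num v \<le> num x" if "comp x = 0"
      using low_bound[of v u x] u todo0[OF u(1,3)] call call_none_above \<open>x \<in> E u\<close> that low
      by simp
    ultimately show ?thesis using kc k0 by (auto simp: comp')
  qed
  have to_v: "(u,v) \<in> (edges E)\<^sup>*" and from_v: "(v,u) \<in> (edges E)\<^sup>*"
    if "num u \<noteq> 0" "comp u = 0" "num v \<le> num u" for u
  proof -
    from open_reach[OF that(1,2)] obtain c where c: "c \<in> set call" "(u,c) \<in> (edges E)\<^sup>*" by blast
    have "(c,v) \<in> (edges E)\<^sup>*" using call_reach[OF c(1) v_open call_le[OF c(1)]] .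
    with c(2) show "(u,v) \<in> (edges E)\<^sup>*" by (rule rtrancl_trans)
    show "(v,u) \<in> (edges E)\<^sup>*" using call_reach[of v u] call that by simp
  qed
  show ?thesis
  proof
    fix u assume "comp' u \<noteq> 0" then show "num u \<noteq> 0" using comp_visited by (auto simp: comp' split: if_splits)
  next
    fix c assume "c \<in> set cs"
    then show "num c \<noteq> 0 \<and> comp' c = 0" using call_open[of c] call cs_less[of c] by (auto simp: comp')
  next
    show "sorted_wrt (\<lambda>a b. num a < num b) cs" using call_sorted call by (simp add: sorted_wrt_append)
  next
    fix u assume "num u \<noteq> 0" "u \<notin> set cs"
    then show "todo u = {}" using finished[of u] nothing_todo call by (cases "u = v") auto
  next
    fix u x assume "comp' u \<noteq> 0" "x \<in> E u"
    then show "comp' x \<noteq> 0 \<and> comp' x \<le> comp' u"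
      using closed[of u x] comp_closed[of u x] comp'[of u] comp'[of x] by (auto split: if_splits)
  next
    fix u w assume A: "comp' u \<noteq> 0" "comp' w = comp' u"
    show "(u,w) \<in> (edges E)\<^sup>*"
    proof (cases "comp' u = k")
      case True
      have new: "num y \<noteq> 0" "comp y = 0" "num v \<le> num y" if "comp' y = k" for y
        using that kc[of y] comp'[of y] by (auto split: if_splits)
      from A(2) True have "comp' w = k" by simp
      with new[OF True] new[of w] show ?thesis using to_v from_v by (meson rtrancl_trans)
    next
      case False
      have old: "comp' y = comp y" if "comp' y \<noteq> k" for y
        using that unfolding comp' by (simp split: if_splits)
      have w: "comp' w \<noteq> k" using False A(2) by metis
      show ?thesis
        by (rule comp_reach) (use A old[OF False] old[OF w] in metis)+
    qed
  next
    fix c u assume "c \<in> set cs" "num u \<noteq> 0" "comp' u = 0" "num c \<le> num u"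
    then show "(c,u) \<in> (edges E)\<^sup>*" using call_reach[of c u] call k0 by (auto simp: comp' split: if_splits)
  next
    fix u assume "num u \<noteq> 0" "comp' u = 0"
    then have u: "num u \<noteq> 0" "comp u = 0" "num u < num v"
      using k0 by (auto simp: comp' split: if_splits)
    from open_reach[OF u(1,2)] obtain d where "d \<in> set call" "num d \<le> num u" "(u,d) \<in> (edges E)\<^sup>*"
      by blast
    then show "\<exists>c \<in> set cs. num c \<le> num u \<and> (u,c) \<in> (edges E)\<^sup>*" using call u(3) by auto
  next
    fix d assume d: "d \<in> set cs"
    from low_reach[of d] d call obtain w where w: "low d \<le> num d" "num w \<noteq> 0" "comp w = 0"
      "num w = low d" "(d,w) \<in> (edges E)\<^sup>*" by auto
    then have "comp' w = 0" using cs_less[OF d] by (auto simp: comp')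
    with w show "low d \<le> num d \<and> (\<exists>w. num w \<noteq> 0 \<and> comp' w = 0 \<and> num w = low d \<and> (d,w) \<in> (edges E)\<^sup>*)"
      by blast
  next
    fix c u x assume A: "c \<in> set cs" "num u \<noteq> 0" "comp' u = 0" "num c \<le> num u"
      "\<forall>d \<in> set cs. num c < num d \<longrightarrow> num u < num d" "x \<in> E u" "x \<notin> todo u" "comp' x = 0"
    then have u: "comp u = 0" "num u < num v" "comp x = 0"
      using k0 by (auto simp: comp' split: if_splits)
    have "\<forall>d \<in> set call. num c < num d \<longrightarrow> num u < num d" using A(5) u(2) call by auto
    then show "low c \<le> num x" using low_bound[of c u x] A u call by simp
  qed (fact visited_V num_inj todo_sub explored_visited)+
qed

text \<open>After a component has been popped, the program still passes the low-link of
  \<open>v\<close> on to its caller. This inequality shows that doing so has no effect.\<close>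

lemma finish_root_low: "low v = num v \<Longrightarrow> p \<in> set cs \<Longrightarrow> low p < low v"
  using low_reach[of p] cs_less[of p] call by auto

end

section \<open>Components and reachability after the search\<close>

lemma all_done:
  assumes "call = []"
  shows "comp v \<noteq> 0 \<longleftrightarrow> num v \<noteq> 0"
  using open_reach[of v] comp_visited[of v] assms by auto

text \<open>Component numbers never increase along arcs; this is the source of the reverse
  topological order.\<close>

lemma comp_mono: "(u,v) \<in> (edges E)\<^sup>* \<Longrightarrow> comp u \<noteq> 0 \<Longrightarrow> comp v \<noteq> 0 \<and> comp v \<le> comp u"
proof (induction rule: rtrancl_induct)
  case (step y z)
  then show ?case using comp_closed[of y z] by (auto simp: edges_def)
qed simp

lemma comp_eq_iff:
  assumes "comp u \<noteq> 0"
  shows "comp v = comp u \<longleftrightarrow> (u,v) \<in> (edges E)\<^sup>* \<and> (v,u) \<in> (edges E)\<^sup>*"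
  using comp_mono[of u v] comp_mono[of v u] comp_reach[of u v] comp_reach[of v u] assms by auto

end

lemma tarjan_state_init:
  "tarjan_state U E (\<lambda>_. 0) low (\<lambda>_. 0) todo []"
  by unfold_locales auto

section \<open>Tarjan's algorithm as a RAM program\<close>

lemma map_upd_upt [simp]: "map (f(h := u)) [0..<h] = map f [0..<h]"
  by (intro map_cong) auto

lemma sorted_wrt_less_distinct:
  fixes f :: "'b \<Rightarrow> nat"
  shows "sorted_wrt (\<lambda>u v. f u < f v) xs \<Longrightarrow> distinct xs"
  by (induction xs) auto

lemma sum_fun_upd:
  fixes f g :: "nat \<Rightarrow> nat"
  assumes "v < m" "\<And>w. w \<noteq> v \<Longrightarrow> g w = f w"
  shows "(\<Sum>w<m. g w) + f v = (\<Sum>w<m. f w) + g v"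
proof -
  have "(\<Sum>w\<in>{..<m}-{v}. g w) = (\<Sum>w\<in>{..<m}-{v}. f w)" using assms(2) by (intro sum.cong) auto
  then show ?thesis using assms(1) by (simp add: sum.remove[of "{..<m}" v])
qed

text \<open>Slices are compared with components as sets only. They are nonempty, whence
  \<open>comps\<close> \<le> \<open>members\<close>, which bounds the number of rounds of
  \<open>process\<close>. Before the first component is generated \<open>start\<close> is
  uninitialised, hence the case distinction.\<close>

definition comps_ok :: "(nat \<Rightarrow> nat) \<Rightarrow> nat \<Rightarrow> nat \<Rightarrow> (nat \<Rightarrow> nat) \<Rightarrow> (nat \<Rightarrow> nat) \<Rightarrow> bool" where
  "comps_ok cmp comps members start member \<longleftrightarrow>
    (\<forall>v. cmp v \<le> comps) \<and> comps \<le> members \<and>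
    (if comps = 0 then members = 0 else start 1 = 0 \<and> start (Suc comps) = members) \<and>
    (\<forall>k. 1 \<le> k \<and> k \<le> comps \<longrightarrow> start k < start (Suc k) \<and> start (Suc k) \<le> members \<and>
      member ` {start k..<start (Suc k)} = {v. cmp v = k})"

lemma comps_ok_init: "comps_ok (\<lambda>_. 0) 0 0 start member"
  by (simp add: comps_ok_def)

lemma comps_ok_Suc:
  assumes ok: "comps_ok cmp c d start member"
    and A: "A \<noteq> {}" "\<And>v. v \<in> A \<Longrightarrow> cmp v = 0"
    and cmp': "\<And>v. cmp' v = (if v \<in> A then Suc c else cmp v)"
    and d': "d < d'" and member': "member' ` {d..<d'} = A" "\<And>i. i < d \<Longrightarrow> member' i = member i"
  shows "comps_ok cmp' (Suc c) d' (start(Suc c := d, Suc (Suc c) := d')) member'"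
proof -
  let ?start = "start(Suc c := d, Suc (Suc c) := d')"
  have le: "cmp v \<le> c" for v using ok by (simp add: comps_ok_def)
  \<comment> \<open>For \<open>k = c\<close> the cell \<open>start (Suc c)\<close> is overwritten,
    but it held \<open>d\<close> already.\<close>
  have old: "?start k = start k" "?start (Suc k) = start (Suc k)" if "1 \<le> k" "k \<le> c" for k
    using ok that by (auto simp: comps_ok_def split: if_splits)
  have new: "?start (Suc c) = d" "?start (Suc (Suc c)) = d'" by simp_all
  have "?start k < ?start (Suc k) \<and> ?start (Suc k) \<le> d' \<and>
      member' ` {?start k..<?start (Suc k)} = {v. cmp' v = k}" if k: "1 \<le> k" "k \<le> Suc c" for k
  proof (cases "k = Suc c")
    case True
    have "{v. cmp' v = Suc c} = A" using cmp' le by (auto simp: Suc_n_not_le_n) (metis Suc_n_not_le_n)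
    then show ?thesis using d' member'(1) unfolding True new by simp
  next
    case False
    with k have k': "1 \<le> k" "k \<le> c" by auto
    have *: "start k < start (Suc k)" "start (Suc k) \<le> d" "member ` {start k..<start (Suc k)} = {v. cmp v = k}"
      using ok k' by (simp_all add: comps_ok_def)
    have "member' ` {start k..<start (Suc k)} = member ` {start k..<start (Suc k)}"
      using *(2) member'(2) by (intro image_cong) auto
    moreover have "{v. cmp' v = k} = {v. cmp v = k}"
      using cmp' A(2) k' False by auto
    ultimately show ?thesis using * d' unfolding old[OF k'] by simp
  qed
  moreover have "?start 1 = 0"
    using ok by (auto simp: comps_ok_def split: if_splits)
  moreover have "cmp' v \<le> Suc c" for v using cmp' le[of v] by simp
  moreover have "c \<le> d" using ok by (simp add: comps_ok_def)
  ultimately show ?thesis using d' new unfolding comps_ok_def by auto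
qed

text \<open>Ordered pairs that are not edges also occupy numbers below \<open>m\<close>;
  \<open>adj v = 1\<close> singles out the vertices of the constraint digraph.\<close>

locale tarjan_input =
  fixes m a :: nat and nxt tgt first adj :: "nat \<Rightarrow> nat"
  assumes nxt_less: "0 < e \<Longrightarrow> e \<le> a \<Longrightarrow> nxt e < e"
    and first_le: "v < m \<Longrightarrow> first v \<le> a"
    and targets: "v < m \<Longrightarrow> adj v = 1 \<Longrightarrow> u \<in> set (list_targets nxt tgt (first v)) \<Longrightarrow> u < m \<and> adj u = 1"
begin

definition verts :: "nat set" where "verts = {v. v < m \<and> adj v = 1}"

abbreviation targets_from :: "nat \<Rightarrow> nat list" where
  "targets_from e \<equiv> list_targets nxt tgt e"

definition succs :: "nat \<Rightarrow> nat set" where "succs v = set (targets_from (first v))"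

definition rest :: "mem \<Rightarrow> nat \<Rightarrow> nat set" where "rest s v = set (targets_from (s ''todo'' v))"

definition calls :: "mem \<Rightarrow> nat list" where "calls s = map (s ''call'') [0..<s ''depth'' 0]"

definition stck :: "mem \<Rightarrow> nat list" where "stck s = map (s ''stack'') [0..<s ''height'' 0]"

lemma succs_verts: "v \<in> verts \<Longrightarrow> u \<in> succs v \<Longrightarrow> u \<in> verts"
  using targets unfolding verts_def succs_def by blast

lemma targets_from_Cons:
  "0 < e \<Longrightarrow> e \<le> a \<Longrightarrow> targets_from e = tgt e # targets_from (nxt e) \<and> nxt e \<le> a"
  using nxt_less[of e] by (subst list_targets.simps) auto

text \<open>The stack is sorted by visiting number and holds exactly the open vertices. The clock
  counts the visited vertices, and each of them is either on the stack or listed in a component;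
  this yields the equation for \<open>members\<close> and later its bound by
  \<open>m\<close>.\<close>

definition tinv :: "mem \<Rightarrow> bool" where
  "tinv s \<longleftrightarrow> s ''first'' = first \<and> s ''next'' = nxt \<and> s ''target'' = tgt \<and>
    tarjan_state verts succs (s ''num'') (s ''low'') (s ''comp'') (rest s) (calls s) \<and>
    sorted_wrt (\<lambda>u v. s ''num'' u < s ''num'' v) (stck s) \<and>
    set (stck s) = {v. s ''num'' v \<noteq> 0 \<and> s ''comp'' v = 0} \<and>
    (\<forall>v. s ''num'' v \<le> s ''clock'' 0) \<and> card {v. s ''num'' v \<noteq> 0} = s ''clock'' 0 \<and>
    s ''members'' 0 + s ''height'' 0 = s ''clock'' 0 \<and>
    (\<forall>v. s ''num'' v \<noteq> 0 \<longrightarrow> s ''todo'' v \<le> a) \<and>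
    comps_ok (s ''comp'') (s ''comps'' 0) (s ''members'' 0) (s ''start'') (s ''member'')"

section \<open>Transitions of the search on the memory\<close>

lemma tinv_cong:
  assumes "\<And>x. x \<notin> {''r'', ''v'', ''e'', ''u'', ''p''} \<Longrightarrow> s' x = s x"
  shows "tinv s' = tinv s"
  unfolding tinv_def rest_def calls_def stck_def by (simp add: assms)

lemma tinv_visit:
  assumes t: "tinv s" and u: "u \<in> verts" "s ''num'' u = 0"
    and todo1: "\<And>w. set (targets_from (todo1 w)) \<subseteq> rest s w"
      "\<And>w. rest s w \<subseteq> insert u (set (targets_from (todo1 w)))"
      "\<And>w. s ''num'' w \<noteq> 0 \<Longrightarrow> todo1 w \<le> a"
    and reach: "\<And>c. c \<in> set (calls s) \<Longrightarrow> (c,u) \<in> (edges succs)\<^sup>*"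
    and s': "s' ''clock'' 0 = Suc (s ''clock'' 0)" "s' ''num'' = (s ''num'')(u := Suc (s ''clock'' 0))"
      "s' ''low'' = (s ''low'')(u := Suc (s ''clock'' 0))" "s' ''todo'' = todo1(u := first u)"
      "s' ''stack'' = (s ''stack'')(s ''height'' 0 := u)" "s' ''height'' 0 = Suc (s ''height'' 0)"
      "s' ''call'' = (s ''call'')(s ''depth'' 0 := u)" "s' ''depth'' 0 = Suc (s ''depth'' 0)"
    and fr: "\<And>x. x \<in> {''first'', ''next'', ''target'', ''comp'', ''comps'', ''members'', ''start'', ''member''} \<Longrightarrow>
      s' x = s x"
  shows "tinv s'"
proof -
  interpret T: tarjan_state verts succs "s ''num''" "s ''low''" "s ''comp''" "rest s" "calls s"
    using t by (simp add: tinv_def)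
  have clock: "s ''num'' v < Suc (s ''clock'' 0)" for v using t by (simp add: tinv_def less_Suc_eq_le)
  have cu: "s ''comp'' u = 0" using T.comp_visited u by blast
  have calls': "calls s' = calls s @ [u]" by (simp add: calls_def s')
  have stck': "stck s' = stck s @ [u]" by (simp add: stck_def s')
  have rest': "rest s' = (\<lambda>w. set (targets_from (todo1 w)))(u := succs u)"
    by (auto simp: rest_def s' succs_def fun_eq_iff)
  have u_stck: "u \<notin> set (stck s)" using t u by (simp add: tinv_def)
  have fin: "finite {v. s ''num'' v \<noteq> 0}"
    by (rule finite_subset[of _ "{..<m}"]) (use T.visited_V in \<open>auto simp: verts_def\<close>)
  have card: "card {v. s' ''num'' v \<noteq> 0} = Suc (card {v. s ''num'' v \<noteq> 0})"
  proof -
    have "{v. s' ''num'' v \<noteq> 0} = insert u {v. s ''num'' v \<noteq> 0}" by (auto simp: s')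
    then show ?thesis using fin u by simp
  qed
  have "tarjan_state verts succs (s' ''num'') (s' ''low'') (s' ''comp'') (rest s') (calls s')"
    using T.visit[OF u clock todo1(1,2) reach] by (simp add: fr s' calls' rest')
  moreover have "sorted_wrt (\<lambda>u v. s' ''num'' u < s' ''num'' v) (stck s')"
  proof -
    have "sorted_wrt (\<lambda>u v. s' ''num'' u < s' ''num'' v) (stck s)"
      by (rule sorted_wrt_mono_rel[of _ "\<lambda>u v. s ''num'' u < s ''num'' v"])
        (use t u_stck in \<open>auto simp: tinv_def s'\<close>)
    then show ?thesis unfolding stck' using u_stck clock by (auto simp: sorted_wrt_append s')
  qed
  moreover have "set (stck s') = {v. s' ''num'' v \<noteq> 0 \<and> s' ''comp'' v = 0}"
    using t cu by (auto simp: stck' tinv_def s' fr)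
  moreover have "s' ''num'' v \<le> s' ''clock'' 0" for v using clock[of v] by (simp add: s')
  moreover have "s' ''todo'' v \<le> a" if "s' ''num'' v \<noteq> 0" for v
    using that todo1(3)[of v] first_le[of u] u(1) by (auto simp: s' verts_def)
  ultimately show ?thesis using t card unfolding tinv_def by (simp add: fr s')
qed

lemma tinv_explore_visited:
  assumes t: "tinv s" and v: "calls s = cs @ [v]" and e: "s ''todo'' v = e" "0 < e"
    and u: "u = tgt e" "s ''num'' u \<noteq> 0"
    and s': "s' ''todo'' = (s ''todo'')(v := nxt e)"
      "s' ''low'' = (if s ''comp'' u = 0 \<and> s ''num'' u < s ''low'' v then (s ''low'')(v := s ''num'' u) else s ''low'')"
    and fr: "\<And>x. x \<notin> {''todo'', ''low'', ''e'', ''u'', ''v''} \<Longrightarrow> s' x = s x"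
  shows "tinv s'"
proof -
  interpret T: tarjan_state verts succs "s ''num''" "s ''low''" "s ''comp''" "rest s" "calls s"
    using t by (simp add: tinv_def)
  have nv: "s ''num'' v \<noteq> 0" using T.call_open[of v] v by simp
  then have "e \<le> a" using t e by (auto simp: tinv_def)
  note cons = targets_from_Cons[OF e(2) this]
  have rest_v: "rest s v = insert u (set (targets_from (nxt e)))"
    using cons by (simp add: rest_def e u)
  have eqs: "calls s' = calls s" "stck s' = stck s" by (simp_all add: calls_def stck_def fr)
  have rest': "rest s' v = set (targets_from (nxt e))" "w \<noteq> v \<Longrightarrow> rest s' w = rest s w" for w
    by (simp_all add: rest_def s')
  have "u \<in> succs v" using T.todo_sub[OF nv] rest_v by blast
  have "tarjan_state verts succs (s ''num'') (s' ''low'') (s ''comp'') (rest s') (calls s)"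
    by (rule T.explore_visited[OF v u(2) \<open>u \<in> succs v\<close>]) (auto simp: rest_v rest' s')
  moreover have "s' ''todo'' w \<le> a" if "s ''num'' w \<noteq> 0" for w
    using t that cons by (auto simp: tinv_def s')
  ultimately show ?thesis using t unfolding tinv_def by (simp add: fr eqs)
qed

lemma tinv_finish_low_not_root:
  assumes t: "tinv s" and v: "calls s = cs @ [v]" and todo: "s ''todo'' v = 0"
    and low: "s ''low'' v \<noteq> s ''num'' v"
  shows "cs \<noteq> []"
proof -
  interpret T: tarjan_state verts succs "s ''num''" "s ''low''" "s ''comp''" "rest s" "calls s"
    using t by (simp add: tinv_def)
  show ?thesis using T.finish_low(1)[OF v _ low] todo by (simp add: rest_def)
qed

lemma tinv_finish_low:
  assumes t: "tinv s" and v: "calls s = cs @ [v]" and todo: "s ''todo'' v = 0"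
    and low: "s ''low'' v \<noteq> s ''num'' v"
    and s': "p = last cs" "s' ''low'' = (s ''low'')(p := min (s ''low'' p) (s ''low'' v))"
      "Suc (s' ''depth'' 0) = s ''depth'' 0"
    and fr: "\<And>x. x \<notin> {''low'', ''depth'', ''e'', ''u'', ''v'', ''p''} \<Longrightarrow> s' x = s x"
  shows "tinv s'"
proof -
  interpret T: tarjan_state verts succs "s ''num''" "s ''low''" "s ''comp''" "rest s" "calls s"
    using t by (simp add: tinv_def)
  have rest_v: "rest s v = {}" by (simp add: rest_def todo)
  have "calls s = calls s' @ [s' ''call'' (s' ''depth'' 0)]"
    using s'(3)[symmetric] by (simp add: calls_def fr)
  then have "calls s' = cs" using v by simp
  moreover have "stck s' = stck s" "rest s' = rest s" by (simp_all add: stck_def rest_def fr fun_eq_iff)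
  ultimately show "tinv s'"
    using t T.finish_low(2)[OF v rest_v low s'(1,2)] unfolding tinv_def by (simp add: fr)
qed

lemma tinv_finish_root_low:
  assumes t: "tinv s" and v: "calls s = cs @ [v]" and todo: "s ''todo'' v = 0"
    and low: "s ''low'' v = s ''num'' v" and c: "c \<in> set cs"
  shows "s ''low'' c < s ''low'' v"
proof -
  interpret T: tarjan_state verts succs "s ''num''" "s ''low''" "s ''comp''" "rest s" "calls s"
    using t by (simp add: tinv_def)
  show ?thesis using T.finish_root_low[OF v _ low c] todo by (simp add: rest_def)
qed

text \<open>Since the stack is sorted by visiting number, the entries from the position of
  \<open>v\<close> upwards are exactly the open vertices numbered from \<open>v\<close> onwards,
  which is the set that the abstract transition closes.\<close>

lemma tinv_finish_root:
  assumes t: "tinv s" and v: "calls s = cs @ [v]" and todo: "s ''todo'' v = 0"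
    and low: "s ''low'' v = s ''num'' v"
    and p: "p < length (stck s)" "stck s ! p = v"
    and s': "s' ''comp'' = (\<lambda>u. if u \<in> set (drop p (stck s)) then Suc (s ''comps'' 0) else s ''comp'' u)"
      "s' ''height'' 0 = p" "Suc (s' ''depth'' 0) = s ''depth'' 0"
      "s' ''comps'' 0 = Suc (s ''comps'' 0)" "s' ''members'' 0 = s ''members'' 0 + (length (stck s) - p)"
      "s' ''start'' = (s ''start'')(Suc (s ''comps'' 0) := s ''members'' 0, Suc (Suc (s ''comps'' 0)) := s' ''members'' 0)"
      "s' ''member'' ` {s ''members'' 0..<s' ''members'' 0} = set (drop p (stck s))"
      "\<And>i. i < s ''members'' 0 \<Longrightarrow> s' ''member'' i = s ''member'' i"
    and fr: "\<And>x. x \<notin> {''comp'', ''height'', ''depth'', ''comps'', ''members'', ''start'', ''member'', ''e'', ''u'', ''v'', ''p''} \<Longrightarrow> s' x = s x"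
  shows "tinv s'"
proof -
  interpret T: tarjan_state verts succs "s ''num''" "s ''low''" "s ''comp''" "rest s" "calls s"
    using t by (simp add: tinv_def)
  have rv: "rest s v = {}" by (simp add: rest_def todo)
  have sorted: "sorted_wrt (\<lambda>u v. s ''num'' u < s ''num'' v) (stck s)"
    and stck_set: "set (stck s) = {v. s ''num'' v \<noteq> 0 \<and> s ''comp'' v = 0}"
    and comps: "comps_ok (s ''comp'') (s ''comps'' 0) (s ''members'' 0) (s ''start'') (s ''member'')"
    using t by (simp_all add: tinv_def)
  have num_nth: "s ''num'' (stck s ! i) < s ''num'' (stck s ! j)" if "i < j" "j < length (stck s)" for i j
    using sorted that by (simp add: sorted_wrt_iff_nth_less)
  have pop_set: "set (drop p (stck s)) = {u. s ''num'' u \<noteq> 0 \<and> s ''comp'' u = 0 \<and> s ''num'' v \<le> s ''num'' u}"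
  proof (intro set_eqI iffI)
    fix u assume "u \<in> set (drop p (stck s))"
    then obtain j where j: "p + j < length (stck s)" "u = stck s ! (p + j)"
      unfolding in_set_conv_nth by (metis add.commute length_drop less_diff_conv nth_drop p(1) less_imp_le)
    then have "u \<in> set (stck s)" by simp
    moreover have "s ''num'' v \<le> s ''num'' u"
      using num_nth[of p "p + j"] j p(2) by (cases "j = 0") auto
    ultimately show "u \<in> {u. s ''num'' u \<noteq> 0 \<and> s ''comp'' u = 0 \<and> s ''num'' v \<le> s ''num'' u}"
      using stck_set by simp
  next
    fix u assume u: "u \<in> {u. s ''num'' u \<noteq> 0 \<and> s ''comp'' u = 0 \<and> s ''num'' v \<le> s ''num'' u}"
    then have "u \<in> set (stck s)" using stck_set by simp
    then obtain i where i: "i < length (stck s)" "u = stck s ! i" by (auto simp: in_set_conv_nth)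
    have "p \<le> i" using num_nth[of i p] u i p by (cases "i < p") auto
    then show "u \<in> set (drop p (stck s))" using i
      by (auto simp: in_set_conv_nth intro!: exI[of _ "i - p"])
  qed
  have "calls s = calls s' @ [s' ''call'' (s' ''depth'' 0)]"
    using s'(3)[symmetric] by (simp add: calls_def fr)
  then have calls': "calls s' = cs" using v by simp
  have height: "s ''height'' 0 = length (stck s)" by (simp add: stck_def)
  have stck': "stck s' = take p (stck s)"
    using p(1) by (simp add: stck_def fr s' take_map)
  have rest': "rest s' = rest s" by (simp add: rest_def fr fun_eq_iff)
  have comp_lt: "s ''comp'' u < Suc (s ''comps'' 0)" for u
    using comps by (simp add: comps_ok_def less_Suc_eq_le)
  have "tarjan_state verts succs (s ''num'') (s ''low'') (s' ''comp'') (rest s) cs"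
    by (rule T.finish_root[OF v rv low comp_lt]) (simp add: s'(1) pop_set)
  moreover have "comps_ok (s' ''comp'') (Suc (s ''comps'' 0)) (s' ''members'' 0) (s' ''start'') (s' ''member'')"
    unfolding s'(6)
  proof (rule comps_ok_Suc[OF comps, of "set (drop p (stck s))"])
    show "set (drop p (stck s)) \<noteq> {}" using p(1) by simp
  qed (use p(1) s'(1,5,7,8) pop_set in auto)
  moreover have "sorted_wrt (\<lambda>u v. s ''num'' u < s ''num'' v) (stck s')"
    unfolding stck' using sorted by (rule sorted_wrt_take)
  moreover have "set (stck s') = {v. s ''num'' v \<noteq> 0 \<and> s' ''comp'' v = 0}"
  proof -
    have "distinct (stck s)"
      using sorted by (rule sorted_wrt_less_distinct)
    then have "set (take p (stck s)) \<inter> set (drop p (stck s)) = {}"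
      by (simp add: set_take_disj_set_drop_if_distinct)
    moreover have "set (stck s) = set (take p (stck s)) \<union> set (drop p (stck s))"
      by (metis append_take_drop_id set_append)
    ultimately show ?thesis using stck_set unfolding stck' s'(1) by auto
  qed
  ultimately show "tinv s'"
    using t p(1) height unfolding tinv_def by (simp add: fr calls' rest' s'(2,4,5))
qed

text \<open>An unvisited vertex holds 200 units: 100 and 40 of them pass to its entries on the call
  stack and on Tarjan's stack, 60 are available for visiting it. Each unexplored entry of an arc
  list holds 60 for its exploration.\<close>

definition pot :: "(nat \<Rightarrow> nat) \<Rightarrow> (nat \<Rightarrow> nat) \<Rightarrow> nat" where
  "pot num todo = (\<Sum>v<m. if num v = 0 then 200 + 60 * length (targets_from (first v))
     else 60 * length (targets_from (todo v)))"

lemma pot_visit: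
  assumes "u < m" "num u = 0" "k \<noteq> 0"
  shows "pot (num(u := k)) (todo(u := first u)) + 200 = pot num todo"
  unfolding pot_def using assms
    sum_fun_upd[of u m "\<lambda>v. if (num(u := k)) v = 0 then 200 + 60 * length (targets_from (first v))
      else 60 * length (targets_from ((todo(u := first u)) v))"
      "\<lambda>v. if num v = 0 then 200 + 60 * length (targets_from (first v))
      else 60 * length (targets_from (todo v))"]
  by (simp add: fun_upd_def)

lemma pot_next:
  assumes "v < m" "num v \<noteq> 0" "0 < todo v" "todo v \<le> a"
  shows "pot num (todo(v := nxt (todo v))) + 60 = pot num todo"
  unfolding pot_def using assms targets_from_Cons[of "todo v"]
    sum_fun_upd[of v m "\<lambda>w. if num w = 0 then 200 + 60 * length (targets_from (first w))
      else 60 * length (targets_from ((todo(v := nxt (todo v))) w))"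
      "\<lambda>w. if num w = 0 then 200 + 60 * length (targets_from (first w))
      else 60 * length (targets_from (todo w))"]
  by (simp add: fun_upd_def)

text \<open>The 100 units on the call stack pay for finishing a vertex, the 40 on Tarjan's stack for
  popping it.\<close>

definition potential :: "mem \<Rightarrow> nat" where
  "potential s = pot (s ''num'') (s ''todo'') + 100 * s ''depth'' 0 + 40 * s ''height'' 0"

end

section \<open>Popping a component\<close>

definition pop_loop :: com where
  "pop_loop = (WHILE ''comp''\<langle>V ''v''\<rangle> \<doteq> N 0 DO
       (''height'' ::= V ''height'' \<boxminus> N 1;;
        ''u'' ::= ''stack''\<langle>V ''height''\<rangle>;;
        ''comp''\<langle>V ''u''\<rangle> ::= V ''comps'';;
        ''member''\<langle>V ''members''\<rangle> ::= V ''u'';;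
        ''members'' ::= V ''members'' \<boxplus> N 1))"

text \<open>The guard inspects \<open>v\<close> itself and fails once \<open>v\<close> has been
  popped; as the stack has no repetitions, this happens exactly at height \<open>p\<close>. The
  component number must be nonzero, for 0 would keep the guard true.\<close>

lemma runs_pop_loop:
  assumes stk: "stk = map (s ''stack'') [0..<s ''height'' 0]" "distinct stk"
    and p: "p < length stk" "stk ! p = v" and v: "s ''v'' 0 = v"
    and c0: "\<And>u. u \<in> set stk \<Longrightarrow> s ''comp'' u = 0" and k: "s ''comps'' 0 \<noteq> 0"
  shows "runs pop_loop s (\<lambda>t s'. s' ''height'' 0 = p \<and>
    s' ''comp'' = (\<lambda>u. if u \<in> set (drop p stk) then s ''comps'' 0 else s ''comp'' u) \<and>
    s' ''members'' 0 = s ''members'' 0 + (length stk - p) \<and>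
    s' ''member'' ` {s ''members'' 0..<s' ''members'' 0} = set (drop p stk) \<and>
    (\<forall>i < s ''members'' 0. s' ''member'' i = s ''member'' i) \<and>
    t + 40 * p \<le> 40 * length stk + 5)"
proof -
  let ?h = "length stk" and ?d = "s ''members'' 0"
  have h: "?h = s ''height'' 0" using stk by simp
  let ?I = "\<lambda>s'. p \<le> s' ''height'' 0 \<and> s' ''height'' 0 \<le> ?h \<and>
    s' ''comp'' = (\<lambda>u. if u \<in> set (drop (s' ''height'' 0) stk) then s ''comps'' 0 else s ''comp'' u) \<and>
    s' ''members'' 0 = ?d + (?h - s' ''height'' 0) \<and>
    s' ''member'' ` {?d..<s' ''members'' 0} = set (drop (s' ''height'' 0) stk) \<and>
    (\<forall>i < ?d. s' ''member'' i = s ''member'' i)"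
  have "runs pop_loop s (\<lambda>t s'. ?I s' \<and> \<not> bval (''comp''\<langle>V ''v''\<rangle> \<doteq> N 0) s' \<and>
      t + 40 * s' ''height'' 0 \<le> 40 * s ''height'' 0 + bcost unit_cost (''comp''\<langle>V ''v''\<rangle> \<doteq> N 0) s')"
    unfolding pop_loop_def
  proof (rule runs_While, goal_cases)
    case 1
    then show ?case using p(1) h by simp
  next
    case (2 s')
    note I = 2(1)
    from 2(3) have fr: "s' ''v'' = s ''v''" "s' ''stack'' = s ''stack''" "s' ''comps'' = s ''comps''" by simp_all
    have "v \<notin> set (drop (s' ''height'' 0) stk)" using 2(2) I k fr v by auto
    have "s' ''height'' 0 \<noteq> p"
    proof
      assume "s' ''height'' 0 = p"
      then have "v \<in> set (drop (s' ''height'' 0) stk)" using p by (metis Cons_nth_drop_Suc list.set_intros(1))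
      with \<open>v \<notin> _\<close> show False by blast
    qed
    then obtain g where g: "s' ''height'' 0 = Suc g" "p \<le> g" "g < ?h"
      using I by (cases "s' ''height'' 0") auto
    have st: "s ''stack'' g = stk ! g" using g(3) h unfolding stk(1) by simp
    have drop: "drop g stk = stk ! g # drop (Suc g) stk" using g(3) by (rule Cons_nth_drop_Suc[symmetric])
    obtain l where l: "?h = Suc g + l" using g(3) by (metis add_Suc less_iff_Suc_add)
    have I': "s' ''members'' 0 = ?d + l" "s' ''member'' ` {?d..<?d + l} = set (drop (Suc g) stk)"
      "s' ''comp'' = (\<lambda>u. if u \<in> set (drop (Suc g) stk) then s ''comps'' 0 else s ''comp'' u)"
      "\<forall>i < ?d. s' ''member'' i = s ''member'' i"
      using I g(1) l by auto
    have int: "{?d..<Suc (?d + l)} \<inter> {x. x \<noteq> ?d + l} = {?d..<?d + l}" by auto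
    have cmp: "(\<lambda>u. if u \<in> set (drop (Suc g) stk) then s ''comps'' 0 else s ''comp'' u)(stk ! g := s ''comps'' 0) =
        (\<lambda>u. if u \<in> set (drop g stk) then s ''comps'' 0 else s ''comp'' u)"
      unfolding drop by auto
    show ?case using g(2) st l I'(2,4) cmp drop by (simp add: fr I'(1,3) g(1) int)
  qed
  then show ?thesis
  proof (rule runs_conseq, goal_cases)
    case (1 t s')
    from 1(2)[of "''v''"] v have v': "s' ''v'' 0 = v" by (simp add: pop_loop_def)
    let ?g = "s' ''height'' 0"
    have "v \<in> set (drop ?g stk)" using 1(1) v' c0[of v] p nth_mem[OF p(1)] by (auto split: if_splits)
    then obtain i where i: "i < length (drop ?g stk)" "drop ?g stk ! i = v" unfolding in_set_conv_nth by blast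
    then have "stk ! (?g + i) = stk ! p" "?g + i < ?h" using p 1(1) by auto
    then have "?g + i = p" using stk(2) p(1) by (simp add: nth_eq_iff_index_eq)
    with 1(1) have "?g = p" by simp
    with 1(1) h show ?case by (auto simp del: diff_add_assoc2)
  qed
qed

lemma runs_pop_component:
  assumes stk: "stk = map (s ''stack'') [0..<s ''height'' 0]" "distinct stk"
    and p: "p < length stk" "stk ! p = v" and v: "s ''v'' 0 = v"
    and c0: "\<And>u. u \<in> set stk \<Longrightarrow> s ''comp'' u = 0"
  shows "runs pop_component s (\<lambda>t s'. s' ''height'' 0 = p \<and>
    s' ''comp'' = (\<lambda>u. if u \<in> set (drop p stk) then Suc (s ''comps'' 0) else s ''comp'' u) \<and>
    s' ''comps'' 0 = Suc (s ''comps'' 0) \<and>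
    s' ''members'' 0 = s ''members'' 0 + (length stk - p) \<and>
    s' ''start'' = (s ''start'')(Suc (s ''comps'' 0) := s ''members'' 0, Suc (Suc (s ''comps'' 0)) := s' ''members'' 0) \<and>
    s' ''member'' ` {s ''members'' 0..<s' ''members'' 0} = set (drop p stk) \<and>
    (\<forall>i < s ''members'' 0. s' ''member'' i = s ''member'' i) \<and>
    t + 40 * p \<le> 40 * length stk + 30)"
  unfolding pop_component_def pop_loop_def[symmetric] runs_Seq runs_Store
proof (rule runs_conseq[OF runs_pop_loop[of stk _ p v]], goal_cases)
  case (8 t s')
  from 8(2)[of "''start''"] 8(2)[of "''comps''"] 8(1) show ?case
    by (auto simp: pop_loop_def)
qed (use assms in simp_all)

section \<open>Effect and time of the single steps of the search\<close>

lemma mods_visit [simp]: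
  "mods (visit u) = {''clock'', ''num'', ''low'', ''todo'', ''stack'', ''height'', ''call'', ''depth''}"
  by (auto simp: visit_def)

lemma mods_finish:
  "mods finish_vertex = {''depth'', ''comps'', ''start'', ''height'', ''u'', ''comp'', ''member'',
    ''members'', ''p'', ''low''}"
  by (auto simp: finish_vertex_def pop_component_def lower_def)

lemma runs_visit_equations:
  assumes "x = ''u'' \<or> x = ''r''" "s x 0 = u"
  shows "runs (visit x) s (\<lambda>t s'. t \<le> 56 \<and>
    s' ''clock'' 0 = Suc (s ''clock'' 0) \<and> s' ''num'' = (s ''num'')(u := Suc (s ''clock'' 0)) \<and>
    s' ''low'' = (s ''low'')(u := Suc (s ''clock'' 0)) \<and>
    s' ''todo'' = (s ''todo'')(u := s ''first'' u) \<and>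
    s' ''stack'' = (s ''stack'')(s ''height'' 0 := u) \<and> s' ''height'' 0 = Suc (s ''height'' 0) \<and>
    s' ''call'' = (s ''call'')(s ''depth'' 0 := u) \<and> s' ''depth'' 0 = Suc (s ''depth'' 0))"
  using assms by (elim disjE) (simp_all add: visit_def)

lemma runs_finish_low_equations:
  assumes "s ''depth'' 0 = Suc (Suc d)" "s ''v'' 0 = v" "s ''low'' v \<noteq> s ''num'' v" "s ''call'' d = p"
  shows "runs finish_vertex s (\<lambda>t s'. t \<le> 60 \<and>
      s' ''low'' = (s ''low'')(p := min (s ''low'' p) (s ''low'' v)) \<and> s' ''depth'' 0 = Suc d \<and>
      s' ''comps'' = s ''comps'' \<and> s' ''start'' = s ''start'' \<and> s' ''height'' = s ''height'' \<and>
      s' ''comp'' = s ''comp'' \<and> s' ''member'' = s ''member'' \<and> s' ''members'' = s ''members'')"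
proof (cases "s ''low'' v < s ''low'' p")
  case True
  then show ?thesis unfolding finish_vertex_def lower_def using assms by (simp add: min_def)
next
  case False
  then have "(s ''low'')(p := min (s ''low'' p) (s ''low'' v)) = s ''low''" by (simp add: min_def)
  with False show ?thesis unfolding finish_vertex_def lower_def using assms by simp
qed

context tarjan_input
begin

text \<open>Of the 60 units that a new vertex does not pass on to the stacks, the visit takes at
  most 56; the remaining 4 pay for the last guard of the search loop.\<close>

lemma runs_visit_root:
  assumes t: "tinv s" and d: "s ''depth'' 0 = 0" and u: "s ''r'' 0 = u" "u \<in> verts" "s ''num'' u = 0"
  shows "runs (visit ''r'') s (\<lambda>t s'. tinv s' \<and> s' ''num'' u \<noteq> 0 \<and>
    (\<forall>v. s ''num'' v \<noteq> 0 \<longrightarrow> s' ''num'' v \<noteq> 0) \<and> t + 4 + potential s' \<le> potential s)"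
proof (rule runs_conseq[OF runs_visit_equations[of "''r''" s u]], goal_cases)
  case (3 t s')
  have first: "s ''first'' = first" using t by (simp add: tinv_def)
  have calls: "calls s = []" using d by (simp add: calls_def)
  have todo: "s ''num'' w \<noteq> 0 \<Longrightarrow> s ''todo'' w \<le> a" for w using t by (simp add: tinv_def)
  have "tinv s'"
  proof (rule tinv_visit[OF t u(2,3), where s' = s' and ?todo1.0 = "s ''todo''"])
    fix x assume "x \<in> {''first'', ''next'', ''target'', ''comp'', ''comps'', ''members'', ''start'', ''member''}"
    then show "s' x = s x" by (intro 3(2)) auto
  qed (use 3(1) calls todo first in \<open>auto simp: rest_def\<close>)
  moreover have "pot (s' ''num'') (s' ''todo'') + 200 = pot (s ''num'') (s ''todo'')"
    using 3(1) first pot_visit[of u "s ''num''"] u by (simp add: verts_def)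
  ultimately show ?case using 3(1) u by (auto simp: potential_def)
qed (use u in auto)

lemma runs_finish_low:
  assumes t: "tinv s" and d: "s ''depth'' 0 = Suc d" "s ''call'' d = v" "s ''v'' 0 = v" "s ''todo'' v = 0"
    and low: "s ''low'' v \<noteq> s ''num'' v"
  shows "runs finish_vertex s (\<lambda>t s'. tinv s' \<and> s' ''num'' = s ''num'' \<and> t + 24 + potential s' \<le> potential s)"
proof -
  let ?cs = "map (s ''call'') [0..<d]"
  have v: "calls s = ?cs @ [v]" using d by (simp add: calls_def)
  have "?cs \<noteq> []" by (rule tinv_finish_low_not_root[OF t v d(4) low])
  then obtain d' where d': "d = Suc d'" by (cases d) auto
  let ?p = "s ''call'' d'"
  have last: "?p = last ?cs" using d' by simp
  have depth: "s ''depth'' 0 = Suc (Suc d')" using d(1) d' by simp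
  have "runs finish_vertex s (\<lambda>t s'. t \<le> 60 \<and>
      s' ''low'' = (s ''low'')(?p := min (s ''low'' ?p) (s ''low'' v)) \<and> s' ''depth'' 0 = Suc d' \<and>
      s' ''comps'' = s ''comps'' \<and> s' ''start'' = s ''start'' \<and> s' ''height'' = s ''height'' \<and>
      s' ''comp'' = s ''comp'' \<and> s' ''member'' = s ''member'' \<and> s' ''members'' = s ''members'')"
    by (rule runs_finish_low_equations[OF depth d(3) low refl])
  then show ?thesis
  proof (rule runs_conseq, goal_cases)
    case (1 t' s')
    have "tinv s'"
    proof (rule tinv_finish_low[OF t v d(4) low last, where s' = s'])
      fix x assume "x \<notin> {''low'', ''depth'', ''e'', ''u'', ''v'', ''p''}"
      then show "s' x = s x"
        using 1(1) 1(2)[of x] mods_finish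
        by (cases "x \<in> {''comps'', ''start'', ''height'', ''comp'', ''member'', ''members''}") auto
    qed (use 1(1) d d' in auto)
    moreover have "s' ''num'' = s ''num''" "s' ''todo'' = s ''todo''" "s' ''height'' = s ''height''"
      using 1(1) 1(2)[of "''num''"] 1(2)[of "''todo''"] by (simp_all add: mods_finish)
    ultimately show ?case using 1(1) d d' by (simp add: potential_def)
  qed
qed

lemma runs_finish_root:
  assumes t: "tinv s" and d: "s ''depth'' 0 = Suc d" "s ''call'' d = v" "s ''v'' 0 = v" "s ''todo'' v = 0"
    and low: "s ''low'' v = s ''num'' v"
  shows "runs finish_vertex s (\<lambda>t s'. tinv s' \<and> s' ''num'' = s ''num'' \<and> t + 24 + potential s' \<le> potential s)"
proof -
  let ?cs = "map (s ''call'') [0..<d]" and ?s = "s(''depth'' := (s ''depth'')(0 := d))"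
  interpret T: tarjan_state verts succs "s ''num''" "s ''low''" "s ''comp''" "rest s" "calls s"
    using t by (simp add: tinv_def)
  have v: "calls s = ?cs @ [v]" using d by (simp add: calls_def)
  have v_open: "s ''num'' v \<noteq> 0" "s ''comp'' v = 0" using T.call_open[of v] v by auto
  have stck: "set (stck s) = {v. s ''num'' v \<noteq> 0 \<and> s ''comp'' v = 0}"
    and "sorted_wrt (\<lambda>u v. s ''num'' u < s ''num'' v) (stck s)"
    using t by (simp_all add: tinv_def)
  then have dist: "distinct (stck s)"
    by (intro sorted_wrt_less_distinct[where f = "s ''num''"])
  have "v \<in> set (stck s)" using v_open stck by simp
  then obtain p where p: "p < length (stck s)" "stck s ! p = v" unfolding in_set_conv_nth by blast
  have height: "length (stck s) = s ''height'' 0" by (simp add: stck_def)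
  define s0 where "s0 = ?s"
  then have s0: "s0 ''comp'' = s ''comp''" "s0 ''comps'' = s ''comps''" "s0 ''members'' = s ''members''"
    "s0 ''start'' = s ''start''" "s0 ''member'' = s ''member''" "s0 ''stack'' = s ''stack''"
    "s0 ''height'' = s ''height''" "s0 ''v'' = s ''v''"
    by simp_all
  have keep0: "s0 x = s x" if "x \<noteq> ''depth''" for x using that by (simp add: s0_def)
  have depth0: "s0 ''depth'' 0 = d" by (simp add: s0_def)
  have pop: "runs pop_component s0 (\<lambda>t1 s1. runs (IF N 0 \<prec> V ''depth'' THEN
       (''p'' ::= ''call''\<langle>V ''depth'' \<boxminus> N 1\<rangle>;; lower ''p'' (''low''\<langle>V ''v''\<rangle>)) ELSE SKIP) s1
     (\<lambda>t2 s'. tinv s' \<and> s' ''num'' = s ''num'' \<and> 13 + t1 + t2 + 24 + potential s' \<le> potential s))"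
  proof (rule runs_conseq[OF runs_pop_component[of "stck s" s0 p v]], goal_cases)
    case (7 t1 s1)
    have s1: "s1 ''height'' 0 = p"
      "s1 ''comp'' = (\<lambda>u. if u \<in> set (drop p (stck s)) then Suc (s ''comps'' 0) else s ''comp'' u)"
      "s1 ''comps'' 0 = Suc (s ''comps'' 0)"
      "s1 ''members'' 0 = s ''members'' 0 + (length (stck s) - p)"
      "s1 ''start'' = (s ''start'')(Suc (s ''comps'' 0) := s ''members'' 0, Suc (Suc (s ''comps'' 0)) := s1 ''members'' 0)"
      "s1 ''member'' ` {s ''members'' 0..<s1 ''members'' 0} = set (drop p (stck s))"
      "\<And>i. i < s ''members'' 0 \<Longrightarrow> s1 ''member'' i = s ''member'' i"
      "t1 + 40 * p \<le> 40 * length (stck s) + 30"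
      using 7(1)[unfolded s0] by blast+
    note s1 = s1 s1(6)[unfolded s1(4)]
    have keep: "s1 x = s x" if "x \<notin> {''comp'', ''height'', ''depth'', ''comps'', ''members'', ''start'', ''member'', ''u''}" for x
      using 7(2)[of x] keep0[of x] that by (simp add: pop_component_def)
    have depth: "s1 ''depth'' 0 = d" using 7(2)[of "''depth''"] depth0 by (simp add: pop_component_def)
    \<comment> \<open>Proved for all memories that differ from \<open>s1\<close> at most in
      \<open>p\<close>: with an empty call stack \<open>p\<close> is not assigned, otherwise it
      is.\<close>
    have inv: "tinv s'" if "\<And>x. x \<noteq> ''p'' \<Longrightarrow> s' x = s1 x" for s'
    proof (rule tinv_finish_root[OF t v d(4) low p, where s' = s'])
      fix x assume "x \<notin> {''comp'', ''height'', ''depth'', ''comps'', ''members'', ''start'', ''member'', ''e'', ''u'', ''v'', ''p''}"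
      then show "s' x = s x" using that[of x] keep[of x] by simp
    qed (use that depth d(1) in \<open>simp_all add: s1\<close>)
    have inv1: "tinv s1" by (rule inv) simp
    \<comment> \<open>Hence the branch of \<open>lower\<close> that writes is not taken for the
      caller.\<close>
    have low_lt: "s ''low'' c < s ''low'' v" if "c \<in> set ?cs" for c
      using that v by (intro tinv_finish_root_low[OF t v d(4) low]) simp
    have pot: "potential s' + 100 + 40 * (length (stck s) - p) = potential s"
      if "\<And>x. x \<noteq> ''p'' \<Longrightarrow> s' x = s1 x" for s'
      using s1(1) that keep[of "''num''"] keep[of "''todo''"] depth d(1) p(1) height
      by (simp add: potential_def)
    have t1: "t1 \<le> 40 * (length (stck s) - p) + 30" using s1(8) p(1) by linarith
    show ?case
    proof (cases d)
      case 0
      then show ?thesis using depth inv1 pot[of s1] t1 keep[of "''num''"] by simp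
    next
      case (Suc d')
      then have "s ''low'' (s ''call'' d') < s ''low'' v" by (intro low_lt) (use Suc in auto)
      then show ?thesis
        using depth Suc keep[of "''call''"] keep[of "''low''"] keep[of "''v''"] keep[of "''num''"] d(3) t1
          inv[of "s1(''p'' := (s1 ''p'')(0 := s ''call'' d'))"] pot[of "s1(''p'' := (s1 ''p'')(0 := s ''call'' d'))"]
        by (simp add: lower_def)
    qed
  qed (use p dist d stck in \<open>simp_all add: s0 stck_def\<close>)
  show ?thesis
    unfolding finish_vertex_def runs_Seq runs_Store runs_If[of "_ \<doteq> _"]
    using pop[unfolded s0_def] d low by (auto elim!: runs_conseq)
qed

end

lemma runs_explore_visit_equations:
  assumes "s ''e'' 0 = e" "s ''v'' 0 = v" "s ''target'' e = u" "s ''num'' u = 0" "s ''comp'' u = 0"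
  shows "runs explore_arc s (\<lambda>t s'. t \<le> 80 \<and>
    s' ''clock'' 0 = Suc (s ''clock'' 0) \<and> s' ''num'' = (s ''num'')(u := Suc (s ''clock'' 0)) \<and>
    s' ''low'' = (s ''low'')(u := Suc (s ''clock'' 0)) \<and>
    s' ''todo'' = (s ''todo'')(v := s ''next'' e, u := s ''first'' u) \<and>
    s' ''stack'' = (s ''stack'')(s ''height'' 0 := u) \<and> s' ''height'' 0 = Suc (s ''height'' 0) \<and>
    s' ''call'' = (s ''call'')(s ''depth'' 0 := u) \<and> s' ''depth'' 0 = Suc (s ''depth'' 0))"
  unfolding explore_arc_def
  using assms by (simp, intro runs_conseq[OF runs_visit_equations[where u = u]]) simp_all

lemma runs_explore_visited_equations:
  assumes "s ''e'' 0 = e" "s ''v'' 0 = v" "s ''target'' e = u" "s ''num'' u \<noteq> 0"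
  shows "runs explore_arc s (\<lambda>t s'. t \<le> 40 \<and>
    s' ''todo'' = (s ''todo'')(v := s ''next'' e) \<and>
    s' ''low'' = (if s ''comp'' u = 0 \<and> s ''num'' u < s ''low'' v then (s ''low'')(v := s ''num'' u) else s ''low'') \<and>
    s' ''clock'' = s ''clock'' \<and> s' ''num'' = s ''num'' \<and> s' ''stack'' = s ''stack'' \<and>
    s' ''height'' = s ''height'' \<and> s' ''call'' = s ''call'' \<and> s' ''depth'' = s ''depth'')"
proof (cases "s ''comp'' u = 0")
  case True
  then show ?thesis unfolding explore_arc_def lower_def
    using assms by (cases "s ''num'' u < s ''low'' v") simp_all
next
  case False
  then show ?thesis unfolding explore_arc_def lower_def using assms by simp
qed

lemma mods_explore:
  "mods explore_arc = {''u'', ''todo'', ''low'', ''clock'', ''num'', ''stack'', ''height'', ''call'', ''depth''}"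
  by (auto simp: explore_arc_def lower_def)

context tarjan_input
begin

lemma runs_explore:
  assumes t: "tinv s" and d: "s ''depth'' 0 = Suc d" "s ''call'' d = v" "s ''v'' 0 = v"
    and e: "s ''todo'' v = e" "0 < e" "s ''e'' 0 = e"
  shows "runs explore_arc s (\<lambda>t s'. tinv s' \<and> (\<forall>w. s ''num'' w \<noteq> 0 \<longrightarrow> s' ''num'' w \<noteq> 0) \<and>
    t + 20 + potential s' \<le> potential s)"
proof -
  let ?cs = "map (s ''call'') [0..<d]"
  interpret T: tarjan_state verts succs "s ''num''" "s ''low''" "s ''comp''" "rest s" "calls s"
    using t by (simp add: tinv_def)
  have v: "calls s = ?cs @ [v]" using d by (simp add: calls_def)
  have v_open: "s ''num'' v \<noteq> 0" "s ''comp'' v = 0" using T.call_open[of v] v by auto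
  have v_verts: "v \<in> verts" using T.visited_V[OF v_open(1)] .
  have todo: "s ''todo'' w \<le> a" if "s ''num'' w \<noteq> 0" for w using t that by (simp add: tinv_def)
  have const: "s ''first'' = first" "s ''next'' = nxt" "s ''target'' = tgt" using t by (simp_all add: tinv_def)
  have "e \<le> a" using todo[OF v_open(1)] e(1) by simp
  note cons = targets_from_Cons[OF e(2) this]
  define u where "u = tgt e"
  have rest_v: "rest s v = insert u (set (targets_from (nxt e)))" using cons by (simp add: rest_def e u_def)
  have uE: "u \<in> succs v" using T.todo_sub[OF v_open(1)] rest_v by blast
  then have u_verts: "u \<in> verts" using succs_verts v_verts by blast
  \<comment> \<open>Advancing the list of \<open>v\<close> releases 60 units, whatever the state of
    the target.\<close>
  have pot: "pot (s ''num'') ((s ''todo'')(v := nxt e)) + 60 = pot (s ''num'') (s ''todo'')"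
    using pot_next[of v "s ''num''" "s ''todo''"] v_verts v_open e \<open>e \<le> a\<close> by (simp add: verts_def)
  show ?thesis
  proof (cases "s ''num'' u = 0")
    case True
    let ?todo = "(s ''todo'')(v := nxt e)"
    have cu: "s ''comp'' u = 0" using T.comp_visited True by blast
    show ?thesis
    proof (rule runs_conseq[OF runs_explore_visit_equations[OF e(3) d(3) _ True cu]], goal_cases)
      case 1
      then show ?case by (simp add: const u_def)
    next
      case (2 t s')
      have "tinv s'"
      proof (rule tinv_visit[OF t u_verts True, where s' = s' and ?todo1.0 = ?todo])
        fix x assume "x \<in> {''first'', ''next'', ''target'', ''comp'', ''comps'', ''members'', ''start'', ''member''}"
        then show "s' x = s x" by (intro 2(2)) (auto simp: mods_explore)
      next
        fix c assume c: "c \<in> set (calls s)"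
        have "s ''num'' c \<le> s ''num'' v" using T.call_sorted c v by (auto simp: sorted_wrt_append)
        then have "(c,v) \<in> (edges succs)\<^sup>*" using T.call_reach[OF c v_open] by simp
        with uE show "(c,u) \<in> (edges succs)\<^sup>*"
          by (auto simp: edges_def intro: rtrancl_into_rtrancl)
      next
        fix w
        show "set (targets_from (?todo w)) \<subseteq> rest s w" "rest s w \<subseteq> insert u (set (targets_from (?todo w)))"
          using rest_v by (auto simp: rest_def)
        show "s ''num'' w \<noteq> 0 \<Longrightarrow> ?todo w \<le> a" using todo[of w] cons by simp
      qed (use 2(1) const in auto)
      moreover have "pot (s' ''num'') (s' ''todo'') + 200 = pot (s ''num'') ?todo"
        using 2(1) pot_visit[of u "s ''num''" _ ?todo] True u_verts by (simp add: verts_def const)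
      ultimately show ?case using 2(1) pot by (auto simp: potential_def)
    qed
  next
    case False
    show ?thesis
    proof (rule runs_conseq[OF runs_explore_visited_equations[OF e(3) d(3) _ False]], goal_cases)
      case 1
      then show ?case by (simp add: const u_def)
    next
      case (2 t s')
      have "tinv s'"
      proof (rule tinv_explore_visited[OF t v e(1,2) u_def False, where s' = s'])
        fix x assume "x \<notin> {''todo'', ''low'', ''e'', ''u'', ''v''}"
        then show "s' x = s x"
          using 2(1) 2(2)[of x]
          by (cases "x \<in> {''clock'', ''num'', ''stack'', ''height'', ''call'', ''depth''}") (auto simp: mods_explore)
      qed (use 2(1) const in auto)
      then show ?case using 2(1) pot by (auto simp: potential_def const)
    qed
  qed
qed

end

section \<open>The complete search\<close>

context tarjan_input
begin

definition search_step :: com where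
  "search_step = (''v'' ::= ''call''\<langle>V ''depth'' \<boxminus> N 1\<rangle>;;
             ''e'' ::= ''todo''\<langle>V ''v''\<rangle>;;
             IF V ''e'' \<doteq> N 0 THEN finish_vertex ELSE explore_arc)"

lemma potential_upd [simp]:
  assumes "x \<notin> {''num'', ''todo'', ''depth'', ''height''}"
  shows "potential (s(x := f)) = potential s"
proof -
  from assms have "''num'' \<noteq> x" "''todo'' \<noteq> x" "''depth'' \<noteq> x" "''height'' \<noteq> x" by auto
  then show ?thesis by (simp add: potential_def del: char.inject)
qed

lemma tinv_upd [simp]: "x \<in> {''r'', ''v'', ''e'', ''u'', ''p''} \<Longrightarrow> tinv (s(x := f)) = tinv s"
  by (rule tinv_cong) auto

lemma runs_search_step:
  assumes t: "tinv s" and d: "0 < s ''depth'' 0"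
  shows "runs search_step s (\<lambda>t s'. tinv s' \<and> (\<forall>v. s ''num'' v \<noteq> 0 \<longrightarrow> s' ''num'' v \<noteq> 0) \<and>
    4 + t + potential s' \<le> potential s)"
proof -
  obtain d' where d': "s ''depth'' 0 = Suc d'" using d by (cases "s ''depth'' 0") auto
  define v e where "v = s ''call'' d'" "e = s ''todo'' v"
  define s1 where "s1 = s(''v'' := (s ''v'')(0 := v), ''e'' := (s ''e'')(0 := e))"
  have t1: "tinv s1" using t by (simp add: s1_def)
  have s1: "s1 ''depth'' 0 = Suc d'" "s1 ''call'' d' = v" "s1 ''v'' 0 = v" "s1 ''todo'' v = e" "s1 ''e'' 0 = e"
    "s1 ''num'' = s ''num''"
    by (simp_all add: s1_def d' v_e_def)
  have pot: "potential s1 = potential s" by (simp add: s1_def)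
  \<comment> \<open>The 16 units are 4 for the guard of the loop and 7 + 5 for loading
    \<open>v\<close> and \<open>e\<close>.\<close>
  have "runs (IF V ''e'' \<doteq> N 0 THEN finish_vertex ELSE explore_arc) s1
    (\<lambda>t s'. tinv s' \<and> (\<forall>v. s ''num'' v \<noteq> 0 \<longrightarrow> s' ''num'' v \<noteq> 0) \<and> 16 + t + potential s' \<le> potential s)"
  proof (cases "e = 0")
    case True
    have "runs finish_vertex s1 (\<lambda>t s'. tinv s' \<and> s' ''num'' = s1 ''num'' \<and> t + 24 + potential s' \<le> potential s1)"
    proof (cases "s1 ''low'' v = s1 ''num'' v")
      case low: True
      show ?thesis by (rule runs_finish_root[OF t1 s1(1-3) _ low]) (simp add: s1 True)
    next
      case low: False
      show ?thesis by (rule runs_finish_low[OF t1 s1(1-3) _ low]) (simp add: s1 True)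
    qed
    then show ?thesis using True s1 pot by (auto elim!: runs_conseq)
  next
    case False
    from runs_explore[OF t1 s1(1-4) _ s1(5)] False s1 pot show ?thesis by (auto elim!: runs_conseq)
  qed
  then show ?thesis
    unfolding search_step_def s1_def v_e_def using d' by (simp del: runs_If, elim runs_conseq) auto
qed

lemma runs_search:
  assumes t: "tinv s"
  shows "runs (WHILE N 0 \<prec> V ''depth'' DO search_step) s (\<lambda>t s'. tinv s' \<and> s' ''depth'' 0 = 0 \<and>
    (\<forall>v. s ''num'' v \<noteq> 0 \<longrightarrow> s' ''num'' v \<noteq> 0) \<and> t + potential s' \<le> potential s + 4)"
proof (rule runs_conseq[OF runs_While[where \<Phi> = potential and
      I = "\<lambda>s'. tinv s' \<and> (\<forall>v. s ''num'' v \<noteq> 0 \<longrightarrow> s' ''num'' v \<noteq> 0)"]], goal_cases)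
  case (2 s')
  then show ?case using runs_search_step[of s'] by (auto elim!: runs_conseq)
qed (use t in auto)

text \<open>The initial potential is 200 \<open>m\<close> plus 60 per list entry. The loop over the
  roots adds 80 + 11 per round and 8 in total, the five initial stores 15. Between rounds the call
  stack is empty, and since visited vertices stay visited, all vertices below the counter have been
  reached.\<close>

lemma runs_tarjan:
  assumes size: "s ''size'' 0 = m"
    and s: "s ''adj'' = adj" "s ''first'' = first" "s ''next'' = nxt" "s ''target'' = tgt"
      "s ''num'' = (\<lambda>_. 0)" "s ''comp'' = (\<lambda>_. 0)"
  shows "runs tarjan s (\<lambda>t s'. tarjan_state verts succs (s' ''num'') (s' ''low'') (s' ''comp'') (rest s') [] \<and>
    (\<forall>v. s' ''comp'' v \<noteq> 0 \<longleftrightarrow> v \<in> verts) \<and>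
    comps_ok (s' ''comp'') (s' ''comps'' 0) (s' ''members'' 0) (s' ''start'') (s' ''member'') \<and>
    s' ''members'' 0 \<le> m \<and> t \<le> 23 + 300 * m + 60 * (\<Sum>v<m. length (targets_from (first v))))"
proof -
  let ?s = "s(''clock'' := (s ''clock'')(0 := 0), ''height'' := (s ''height'')(0 := 0),
    ''depth'' := (s ''depth'')(0 := 0), ''comps'' := (s ''comps'')(0 := 0), ''members'' := (s ''members'')(0 := 0))"
  let ?body = "IF ''adj''\<langle>V ''r''\<rangle> \<doteq> N 1 AND ''num''\<langle>V ''r''\<rangle> \<doteq> N 0 THEN
    (visit ''r'';; WHILE N 0 \<prec> V ''depth'' DO search_step) ELSE SKIP"
  let ?P = "\<lambda>k s'. tinv s' \<and> s' ''depth'' 0 = 0 \<and> (\<forall>v<k. v \<in> verts \<longrightarrow> s' ''num'' v \<noteq> 0)"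
  have init: "tinv ?s" "potential ?s = 200 * m + 60 * (\<Sum>v<m. length (targets_from (first v)))"
    by (simp_all add: tinv_def s calls_def stck_def tarjan_state_init comps_ok_init potential_def pot_def
        sum.distrib sum_distrib_left)
  have mods_body: "mods search_step \<inter> {''adj'', ''size'', ''r''} = {}"
    by (simp add: search_step_def mods_finish mods_explore)
  have "runs (FOR ''r'' (V ''size'') ?body) ?s
    (\<lambda>t s'. ?P m s' \<and> s' ''r'' 0 = m \<and> t + potential s' \<le> potential ?s + 8 + m * (80 + 11))"
  proof (rule runs_FOR[where T = 80 and P = ?P and \<Phi> = potential], goal_cases)
    case (6 k s')
    note step = 6
    have adj: "s' ''adj'' = adj" using step(5)[of "''adj''"] mods_body s by simp
    show ?case
    proof (cases "adj k = 1 \<and> s' ''num'' k = 0")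
      case True
      then have k: "k \<in> verts" using step(3) by (simp add: verts_def)
      have "runs (visit ''r'';; WHILE N 0 \<prec> V ''depth'' DO search_step) s'
        (\<lambda>t s''. s'' ''r'' 0 = k \<and> ?P (Suc k) s'' \<and> 11 + t + potential s'' \<le> potential s' + 80)"
        unfolding runs_Seq
      proof (rule runs_conseq[OF runs_visit_root[of s' k]], goal_cases)
        case (6 t1 s1)
        note s1 = 6
        show ?case
        proof (rule runs_conseq[OF runs_search], goal_cases)
          case (2 t2 s2)
          have "s2 ''r'' 0 = k" using 2(2)[of "''r''"] s1(2)[of "''r''"] mods_body step(2) by auto
          moreover have "\<forall>v<Suc k. v \<in> verts \<longrightarrow> s2 ''num'' v \<noteq> 0"
            using 2(1) s1(1) step(1) by (auto simp: less_Suc_eq)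
          ultimately show ?case using 2(1) s1(1) by auto
        qed (use s1 in blast)
      qed (use step k True in auto)
      then show ?thesis using step(2) True by (simp add: adj, elim runs_conseq) simp
    next
      case False
      then have "v \<in> verts \<longrightarrow> s' ''num'' v \<noteq> 0" if "v < Suc k" for v
        using step(1) that by (auto simp: less_Suc_eq verts_def)
      then show ?thesis using step(1,2) adj False by auto
    qed
  qed (use size init mods_body in auto)
  from this have run: "runs tarjan s (\<lambda>t s'. ?P m s' \<and> t + potential s' \<le> potential ?s + 23 + m * 91)"
    unfolding tarjan_def search_step_def[symmetric] by (simp, elim runs_conseq) auto
  show ?thesis
  proof (rule runs_conseq[OF run], goal_cases)
    case (1 t s')
    have calls: "calls s' = []" using 1(1) by (simp add: calls_def)
    with 1(1) have ts: "tarjan_state verts succs (s' ''num'') (s' ''low'') (s' ''comp'') (rest s') []"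
      by (simp add: tinv_def)
    interpret T: tarjan_state verts succs "s' ''num''" "s' ''low''" "s' ''comp''" "rest s'" "[]" by fact
    have comp: "s' ''comp'' v \<noteq> 0 \<longleftrightarrow> v \<in> verts" for v
      using T.all_done[OF refl, of v] T.visited_V[of v] 1(1) by (auto simp: verts_def)
    have "card {v. s' ''num'' v \<noteq> 0} \<le> card {..<m}"
      by (rule card_mono) (use T.visited_V in \<open>auto simp: verts_def\<close>)
    then have "s' ''members'' 0 \<le> m" using 1(1) by (auto simp: tinv_def)
    with ts comp 1(1) init(2) show ?case by (auto simp: tinv_def)
  qed
qed

end

section \<open>Processing the strong components\<close>

text \<open>Marks 1 and 2 are written alternately. Disjointness of the component from its dual
  ensures that neither overwrites the other, so the order of the members is irrelevant.\<close>

lemma runs_mark_component: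
  assumes k: "s ''k'' 0 = k" and st: "s ''start'' k \<le> s ''start'' (Suc k)"
    and A: "s ''member'' ` {s ''start'' k..<s ''start'' (Suc k)} = A" "A \<inter> s ''rev'' ` A = {}"
  shows "runs mark_component s (\<lambda>t s'.
    s' ''mark'' = (\<lambda>w. if w \<in> A then 1 else if w \<in> s ''rev'' ` A then 2 else s ''mark'' w) \<and>
    t \<le> 20 + 40 * (s ''start'' (Suc k) - s ''start'' k))"
proof -
  let ?a = "s ''start'' k" and ?b = "s ''start'' (Suc k)"
  let ?X = "\<lambda>i. s ''member'' ` {?a..<i}"
  let ?mark = "\<lambda>X w. if w \<in> X then 1 else if w \<in> s ''rev'' ` X then 2 else s ''mark'' w"
  let ?I = "\<lambda>s'. ?a \<le> s' ''i'' 0 \<and> s' ''i'' 0 \<le> ?b \<and> s' ''mark'' = ?mark (?X (s' ''i'' 0))"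
  let ?body = "''v'' ::= ''member''\<langle>V ''i''\<rangle>;; ''mark''\<langle>V ''v''\<rangle> ::= N 1;;
        ''mark''\<langle>''rev''\<langle>V ''v''\<rangle>\<rangle> ::= N 2;; ''i'' ::= V ''i'' \<boxplus> N 1"
  let ?g = "V ''i'' \<prec> ''start''\<langle>V ''k'' \<boxplus> N 1\<rangle>"
  let ?s = "s(''i'' := (s ''i'')(0 := ?a))"
  have "runs (WHILE ?g DO ?body) ?s (\<lambda>t s'. ?I s' \<and> \<not> bval ?g s' \<and>
      t + 40 * (?b - s' ''i'' 0) \<le> 40 * (?b - ?s ''i'' 0) + bcost unit_cost ?g s')"
  proof (rule runs_While, goal_cases)
    case 1
    show ?case using st by auto
  next
    case (2 s')
    from 2(3) have fr: "s' ''k'' = s ''k''" "s' ''start'' = s ''start''" "s' ''member'' = s ''member''" "s' ''rev'' = s ''rev''"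
      by simp_all
    define i where "i = s' ''i'' 0"
    have i: "?a \<le> i" "i < ?b" using 2 k by (simp_all add: fr i_def)
    define u where "u = s ''member'' i"
    have X: "?X (Suc i) = insert u (?X i)" using i by (simp add: atLeastLessThanSuc u_def)
    have sub: "insert u (?X i) \<subseteq> A" using i unfolding A(1)[symmetric] u_def by auto
    have "(s' ''mark'')(u := 1, s ''rev'' u := 2) = ?mark (?X (Suc i))"
    proof
      fix w
      have "s ''rev'' u \<notin> insert u (?X i)" "u \<notin> s ''rev'' ` ?X i" using sub A(2) by blast+
      then show "((s' ''mark'')(u := 1, s ''rev'' u := 2)) w = ?mark (?X (Suc i)) w"
        using 2(1) unfolding X i_def[symmetric] by simp
    qed
    moreover have "40 * (?b - i) = 40 + 40 * (?b - Suc i)" using i(2) by simp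
    ultimately show ?case using i k unfolding u_def by (simp add: fr i_def[symmetric] cong: if_cong)
  qed
  then have "runs (WHILE ?g DO ?body) ?s (\<lambda>t s'. s' ''mark'' = ?mark A \<and> t \<le> 40 * (?b - ?a) + 10)"
  proof (rule runs_conseq, goal_cases)
    case (1 t s')
    have "s' ''i'' 0 = ?b" using 1(1) 1(2)[of "''k''"] 1(2)[of "''start''"] k by auto
    with 1(1) show ?case by (simp add: A(1) cong: if_cong)
  qed
  then show ?thesis
    unfolding mark_component_def by (simp add: k, elim runs_conseq) auto
qed

section \<open>From component numbers to sets of pairs\<close>

definition decode :: "nat \<Rightarrow> nat \<Rightarrow> nat \<times> nat" where
  "decode n v = (v div n, v mod n)"

definition read_marks :: "nat \<Rightarrow> (nat \<Rightarrow> nat) \<Rightarrow> (nat \<times> nat) \<rightharpoonup> bool" where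
  "read_marks n mark = (\<lambda>(x,y). if x < n \<and> y < n \<and> mark (x * n + y) \<noteq> 0
     then Some (mark (x * n + y) = 1) else None)"

lemma decode_encode [simp]: "y < n \<Longrightarrow> decode n (x * n + y) = (x,y)"
  by (simp add: decode_def)

lemma less_square_cases:
  fixes v :: nat
  assumes "v < n * n"
  obtains x y where "v = x * n + y" "x < n" "y < n"
proof
  show "v = (v div n) * n + v mod n" by simp
  show "v div n < n" using assms by (simp add: less_mult_imp_div_less)
  show "v mod n < n" using assms by (cases n) auto
qed

text \<open>What processing requires of the numbering: reversal maps vertices with a component to
  such vertices, and vertices of the same component to vertices of the same component.\<close>

locale process_input =
  fixes n :: nat and cmp rv member start :: "nat \<Rightarrow> nat" and comps members :: nat
  assumes ok: "comps_ok cmp comps members start member"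
    and cmp_less: "cmp v \<noteq> 0 \<Longrightarrow> v < n * n"
    and rv: "x < n \<Longrightarrow> y < n \<Longrightarrow> rv (x * n + y) = y * n + x"
    and dual_cmp: "cmp u \<noteq> 0 \<Longrightarrow> cmp u = cmp v \<Longrightarrow> cmp (rv u) = cmp (rv v)"
    and dual_ne_0: "cmp u \<noteq> 0 \<Longrightarrow> cmp (rv u) \<noteq> 0"
begin

definition component :: "nat \<Rightarrow> (nat \<times> nat) set" where
  "component k = decode n ` {v. cmp v = k}"

definition components :: "(nat \<times> nat) set list" where
  "components = map component [1..<Suc comps]"

lemma mem_component_iff: "0 < k \<Longrightarrow> (x,y) \<in> component k \<longleftrightarrow> x < n \<and> y < n \<and> cmp (x * n + y) = k"
  unfolding component_def
proof (safe, goal_cases)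
  case (1 v)
  then have "v < n * n" using cmp_less by simp
  then show ?case using 1 by (elim less_square_cases) auto
next
  case (2 v)
  then have "v < n * n" using cmp_less by simp
  then show ?case using 2 by (elim less_square_cases) auto
next
  case (3 v)
  then have "v < n * n" using cmp_less by simp
  then show ?case using 3 by (elim less_square_cases) auto
next
  case 4
  then show ?case by (intro image_eqI[of _ _ "x * n + y"]) auto
qed

lemma rv_rv: "v < n * n \<Longrightarrow> rv (rv v) = v"
  by (elim less_square_cases) (simp add: rv)

text \<open>Reversal is an involution, so the one-sided \<open>dual_cmp\<close> can be applied back
  and forth.\<close>

lemma cmp_rv_iff:
  assumes "cmp v \<noteq> 0"
  shows "cmp w = cmp (rv v) \<longleftrightarrow> w < n * n \<and> cmp (rv w) = cmp v"
proof
  assume "cmp w = cmp (rv v)"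
  then have "w < n * n" "cmp (rv w) = cmp (rv (rv v))"
    using dual_cmp[of w "rv v"] dual_ne_0[OF assms] cmp_less[of w] by auto
  then show "w < n * n \<and> cmp (rv w) = cmp v" using rv_rv[OF cmp_less[OF assms]] by simp
next
  assume w: "w < n * n \<and> cmp (rv w) = cmp v"
  then have "cmp (rv (rv w)) = cmp (rv v)" using dual_cmp[of "rv w" v] assms by simp
  then show "cmp w = cmp (rv v)" using rv_rv w by simp
qed

lemma dual_component:
  assumes "cmp v \<noteq> 0"
  shows "dual (component (cmp v)) = component (cmp (rv v))"
proof (intro set_eqI)
  fix p :: "nat \<times> nat"
  obtain x y where p: "p = (x,y)" by (cases p)
  have pos: "0 < cmp v" "0 < cmp (rv v)" using assms dual_ne_0[OF assms] by auto
  show "p \<in> dual (component (cmp v)) \<longleftrightarrow> p \<in> component (cmp (rv v))"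
  proof (cases "x < n \<and> y < n")
    case True
    then have e: "rv (x * n + y) = y * n + x" and l: "x * n + y < n * n"
      using rv encode_less by blast+
    have "cmp (x * n + y) = cmp (rv v) \<longleftrightarrow> cmp (y * n + x) = cmp v"
      using cmp_rv_iff[OF assms, of "x * n + y", unfolded e] l by argo
    with True show ?thesis
      unfolding mem_dual_iff p swap_simp mem_component_iff[OF pos(1)] mem_component_iff[OF pos(2)] by blast
  next
    case False
    then show ?thesis
      unfolding mem_dual_iff p swap_simp mem_component_iff[OF pos(1)] mem_component_iff[OF pos(2)] by blast
  qed
qed

lemma image_rv:
  assumes "cmp v \<noteq> 0"
  shows "rv ` {w. cmp w = cmp v} = {w. cmp w = cmp (rv v)}"
proof (intro set_eqI iffI)
  fix w assume "w \<in> rv ` {w. cmp w = cmp v}"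
  then obtain u where u: "w = rv u" "cmp u = cmp v" by blast
  with assms have "cmp (rv u) = cmp (rv v)" by (intro dual_cmp) simp_all
  with u(1) show "w \<in> {w. cmp w = cmp (rv v)}" by simp
next
  fix w assume "w \<in> {w. cmp w = cmp (rv v)}"
  then have "w < n * n" "cmp (rv w) = cmp v" using cmp_rv_iff[OF assms, of w] by auto
  then show "w \<in> rv ` {w. cmp w = cmp v}" by (intro image_eqI[of _ _ "rv w"]) (auto simp: rv_rv)
qed

text \<open>Reversal permutes the components. Whether a component is fixed can therefore be tested
  on any one member.\<close>

lemma component_self_dual_iff:
  assumes "cmp v \<noteq> 0"
  shows "component (cmp v) = dual (component (cmp v)) \<longleftrightarrow> cmp (rv v) = cmp v"
proof
  assume "component (cmp v) = dual (component (cmp v))"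
  then have "component (cmp v) = component (cmp (rv v))" by (simp add: dual_component[OF assms])
  moreover obtain x y where v: "v = x * n + y" "x < n" "y < n"
    using cmp_less[OF assms] by (elim less_square_cases)
  then have "(x,y) \<in> component (cmp v)" using assms by (simp add: mem_component_iff)
  ultimately have "(x,y) \<in> component (cmp (rv v))" by simp
  then show "cmp (rv v) = cmp v" using dual_ne_0[OF assms] v(1) by (simp add: mem_component_iff)
qed (simp add: dual_component[OF assms])

text \<open>The abstract run, continued from the current marks, still produces the result of the
  whole run. Components are counted from 1 and list positions from 0, hence \<open>k - 1\<close>.
  Marks vanish on all of a component or nowhere on it, so that the program may inspect a single
  member. Once \<open>fail\<close> is set, the result is settled.\<close>

definition proc_inv :: "mem \<Rightarrow> bool" where
  "proc_inv s \<longleftrightarrow> 1 \<le> s ''k'' 0 \<and> s ''k'' 0 \<le> Suc comps \<and>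
    (if s ''fail'' 0 = 0 then
       process_components components Map.empty =
         process_components (drop (s ''k'' 0 - 1) components) (read_marks n (s ''mark'')) \<and>
       (\<forall>u v. cmp u \<noteq> 0 \<longrightarrow> cmp u = cmp v \<longrightarrow> (s ''mark'' u = 0 \<longleftrightarrow> s ''mark'' v = 0))
     else s ''fail'' 0 \<le> comps \<and> process_components components Map.empty = Self_Dual (component (s ''fail'' 0)))"

definition proc_potential :: "mem \<Rightarrow> nat" where
  "proc_potential s = 80 * (Suc comps - s ''k'' 0) + 40 * (members - start (s ''k'' 0))"

definition process_step :: com where
  "process_step = (''v'' ::= ''member''\<langle>''start''\<langle>V ''k''\<rangle>\<rangle>;;
        (IF ''comp''\<langle>''rev''\<langle>V ''v''\<rangle>\<rangle> \<doteq> V ''k'' THEN ''fail'' ::= V ''k''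
         ELSE IF ''mark''\<langle>V ''v''\<rangle> \<doteq> N 0 THEN mark_component
         ELSE SKIP);;
        ''k'' ::= V ''k'' \<boxplus> N 1)"

lemma mods_mark_component [simp]: "mods mark_component = {''i'', ''v'', ''mark''}"
  by (auto simp: mark_component_def)

text \<open>The first member \<open>v\<close> decides for its component in both tests: the component
  equals its dual iff it contains the reverse of \<open>v\<close>, and it is unmarked iff
  \<open>v\<close> is.\<close>

lemma runs_process_step:
  assumes const: "s ''comp'' = cmp" "s ''rev'' = rv" "s ''member'' = member" "s ''start'' = start"
    and inv: "proc_inv s" and k: "s ''k'' 0 = k" "k \<le> comps" and fail: "s ''fail'' 0 = 0"
  shows "runs process_step s (\<lambda>t s'. proc_inv s' \<and> 15 + t + proc_potential s' \<le> proc_potential s)"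
proof -
  have k1: "1 \<le> k" using inv k by (simp add: proc_inv_def)
  then have st: "start k < start (Suc k)" "start (Suc k) \<le> members"
    "member ` {start k..<start (Suc k)} = {v. cmp v = k}"
    using ok k(2) by (simp_all add: comps_ok_def)
  define v where "v = member (start k)"
  have "member (start k) \<in> member ` {start k..<start (Suc k)}" using st(1) by (intro imageI) simp
  then have v: "cmp v = k" unfolding st(3) v_def by simp
  have v0: "cmp v \<noteq> 0" using v k1 by simp
  have drop: "drop (k - 1) components = component k # drop k components"
  proof -
    have "k - 1 < length components" "components ! (k - 1) = component k"
      using k1 k(2) by (simp_all add: components_def del: upt_Suc)
    then show ?thesis using k1 Cons_nth_drop_Suc[of "k - 1" components] by simp
  qed
  have pc: "process_components components Map.empty =
      process_components (component k # drop k components) (read_marks n (s ''mark''))"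
    and unif: "\<And>u v. cmp u \<noteq> 0 \<Longrightarrow> cmp u = cmp v \<Longrightarrow> (s ''mark'' u = 0 \<longleftrightarrow> s ''mark'' v = 0)"
  proof -
    have "process_components components Map.empty =
        process_components (drop (k - 1) components) (read_marks n (s ''mark'')) \<and>
      (\<forall>u v. cmp u \<noteq> 0 \<longrightarrow> cmp u = cmp v \<longrightarrow> (s ''mark'' u = 0 \<longleftrightarrow> s ''mark'' v = 0))"
      using inv unfolding proc_inv_def k if_P[OF fail] by blast
    then show "process_components components Map.empty =
        process_components (component k # drop k components) (read_marks n (s ''mark''))"
      "\<And>u v. cmp u \<noteq> 0 \<Longrightarrow> cmp u = cmp v \<Longrightarrow> (s ''mark'' u = 0 \<longleftrightarrow> s ''mark'' v = 0)"
      unfolding drop by blast+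
  qed
  have inv_Suc: "proc_inv (s'(''k'' := (s' ''k'')(0 := Suc k)))"
    if "s' ''fail'' 0 = 0" "process_components components Map.empty =
          process_components (drop k components) (read_marks n (s' ''mark''))"
      "\<And>u v. cmp u \<noteq> 0 \<Longrightarrow> cmp u = cmp v \<Longrightarrow> (s' ''mark'' u = 0 \<longleftrightarrow> s' ''mark'' v = 0)" for s'
  proof -
    let ?t = "s'(''k'' := (s' ''k'')(0 := Suc k))"
    have "?t ''k'' 0 = Suc k" "?t ''fail'' = s' ''fail''" "?t ''mark'' = s' ''mark''" by simp_all
    note eqs = this
    have "process_components components Map.empty =
        process_components (drop (Suc k - 1) components) (read_marks n (s' ''mark''))"
      using that(2) by (simp only: diff_Suc_1)
    show ?thesis
      unfolding proc_inv_def eqs if_P[OF that(1)]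
    proof (intro conjI allI impI)
      show "1 \<le> Suc k" "Suc k \<le> Suc comps" using k(2) by simp_all
      show "process_components components Map.empty =
        process_components (drop (Suc k - 1) components) (read_marks n (s' ''mark''))" by fact
      fix u w assume "cmp u \<noteq> 0" "cmp u = cmp w"
      then show "s' ''mark'' u = 0 \<longleftrightarrow> s' ''mark'' w = 0" by (rule that(3))
    qed
  qed
  have sd: "component k = dual (component k) \<longleftrightarrow> cmp (rv v) = k"
    using component_self_dual_iff[OF v0] v by simp
  obtain x y where xy: "v = x * n + y" "x < n" "y < n"
    using cmp_less[OF v0] by (elim less_square_cases)
  then have dv: "(x,y) \<in> component k" using v k1 by (simp add: mem_component_iff)
  \<comment> \<open>What one round releases: 80 units for the component and 40 for each member. The
    slices lie within the listed members, so the truncated differences telescope.\<close>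
  have pot: "80 * (Suc comps - k) + 40 * (members - start k) =
      80 + 40 * (start (Suc k) - start k) + (80 * (Suc comps - Suc k) + 40 * (members - start (Suc k)))"
    using st(1,2) k(2) by simp
  let ?s = "s(''v'' := (s ''v'')(0 := v))"
  have step: "runs (IF ''comp''\<langle>''rev''\<langle>V ''v''\<rangle>\<rangle> \<doteq> V ''k'' THEN ''fail'' ::= V ''k''
         ELSE IF ''mark''\<langle>V ''v''\<rangle> \<doteq> N 0 THEN mark_component ELSE SKIP) ?s
      (\<lambda>t s'. s' ''k'' 0 = k \<and> proc_inv (s'(''k'' := (s' ''k'')(0 := Suc k))) \<and>
        t \<le> 40 + 40 * (start (Suc k) - start k))"
  proof (cases "cmp (rv v) = k")
    case True
    then show ?thesis using const k k1 sd pc fail by (simp add: proc_inv_def)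
  next
    case nd: False
    show ?thesis
    proof (cases "s ''mark'' v = 0")
      case False
      then have "read_marks n (s ''mark'') (x,y) \<noteq> None" using xy by (simp add: read_marks_def)
      with dv have "\<not> (\<forall>p \<in> component k. read_marks n (s ''mark'') p = None)" by metis
      with nd have "process_components components Map.empty =
          process_components (drop k components) (read_marks n (s ''mark''))"
        unfolding pc process_components.simps sd by (simp only: if_False)
      note pc' = this
      have eqs: "?s ''fail'' = s ''fail''" "?s ''mark'' = s ''mark''" by simp_all
      have "proc_inv (?s(''k'' := (?s ''k'')(0 := Suc k)))"
        by (rule inv_Suc; unfold eqs) (rule fail, rule pc', rule unif)
      then show ?thesis using False nd const k by simp
    next
      case True
      let ?A = "{w. cmp w = k}" and ?B = "{w. cmp w = cmp (rv v)}"
      have B: "rv ` ?A = ?B" using image_rv[OF v0] v by simp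
      have disj: "?A \<inter> ?B = {}" using nd by auto
      let ?mark = "\<lambda>w. if cmp w = k then 1 else if cmp w = cmp (rv v) then 2 else s ''mark'' w"
      have none: "\<forall>p \<in> component k. read_marks n (s ''mark'') p = None"
      proof
        fix p assume "p \<in> component k"
        moreover obtain x' y' where p: "p = (x',y')" by (cases p)
        ultimately have "x' < n" "y' < n" "cmp (x' * n + y') = k" using k1 by (auto simp: mem_component_iff)
        then show "read_marks n (s ''mark'') p = None"
          using unif[of "x' * n + y'" v] v k1 True by (simp add: p read_marks_def)
      qed
      have dual: "dual (component k) = component (cmp (rv v))" using dual_component[OF v0] v by simp
      have kr: "0 < k" "0 < cmp (rv v)" using k1 dual_ne_0[OF v0] by auto
      have "read_marks n ?mark = (\<lambda>p. if p \<in> component k then Some True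
          else if p \<in> dual (component k) then Some False else read_marks n (s ''mark'') p)"
        unfolding dual
        by (rule ext) (use kr in \<open>auto simp: read_marks_def mem_component_iff split: prod.splits\<close>)
      then have pc': "process_components components Map.empty =
          process_components (drop k components) (read_marks n ?mark)"
        using pc sd nd none by simp
      have unif': "?mark u = 0 \<longleftrightarrow> ?mark w = 0" if "cmp u \<noteq> 0" "cmp u = cmp w" for u w
        using unif[OF that] that by simp
      have "runs mark_component ?s (\<lambda>t s'. s' ''mark'' = ?mark \<and> t \<le> 20 + 40 * (start (Suc k) - start k))"
        by (rule runs_conseq[OF runs_mark_component[of ?s k ?A]])
          (use const k st disj B in \<open>auto simp: fun_eq_iff\<close>)
      then have "runs mark_component ?s (\<lambda>t s'. s' ''k'' 0 = k \<and> proc_inv (s'(''k'' := (s' ''k'')(0 := Suc k))) \<and>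
          13 + t \<le> 40 + 40 * (start (Suc k) - start k))"
      proof (rule runs_conseq, goal_cases)
        case (1 t s')
        have k': "s' ''k'' = s ''k''" and "s' ''fail'' = s ''fail''"
          using 1(2)[of "''k''"] 1(2)[of "''fail''"] by simp_all
        moreover have m: "s' ''mark'' = ?mark" using 1(1) by blast
        ultimately have "proc_inv (s'(''k'' := (s' ''k'')(0 := Suc k)))"
          using fail pc' unif' by (intro inv_Suc) (simp_all only: m)
        then show ?case using 1(1) k' k(1) by simp
      qed
      then show ?thesis using nd True const k by (simp add: v_def[symmetric], elim runs_conseq) simp
    qed
  qed
  have "runs process_step s (\<lambda>t s'. (s' ''k'' 0 = Suc k \<and> proc_inv s') \<and>
      t \<le> 60 + 40 * (start (Suc k) - start k))"
    unfolding process_step_def using step const k by (simp add: v_def[symmetric] del: runs_If, elim runs_conseq) auto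
  then show ?thesis
    by (rule runs_conseq) (use pot k in \<open>auto simp: proc_potential_def\<close>)
qed

lemma process_step_fold:
  "process = (''fail'' ::= N 0;; ''k'' ::= N 1;;
     WHILE V ''k'' \<prec> V ''comps'' \<boxplus> N 1 AND V ''fail'' \<doteq> N 0 DO process_step)"
  by (simp add: process_def process_step_def)

lemma mods_process_step: "mods process_step = {''v'', ''fail'', ''i'', ''mark'', ''k''}"
  by (auto simp: process_step_def)

lemma runs_process:
  assumes const: "s ''comp'' = cmp" "s ''rev'' = rv" "s ''member'' = member" "s ''start'' = start"
      "s ''comps'' 0 = comps"
    and mark: "\<And>v. v < n * n \<Longrightarrow> s ''mark'' v = 0"
  shows "runs process s (\<lambda>t s'. read_result n s' = process_components components Map.empty \<and>
    t \<le> 80 * comps + 40 * members + 20)"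
proof -
  let ?s = "s(''fail'' := (s ''fail'')(0 := 0), ''k'' := (s ''k'')(0 := 1))"
  let ?g = "V ''k'' \<prec> V ''comps'' \<boxplus> N 1 AND V ''fail'' \<doteq> N 0"
  have empty: "read_marks n (s ''mark'') = Map.empty"
    using mark encode_less by (auto simp: read_marks_def fun_eq_iff)
  have marks0: "s ''mark'' u = 0" if "cmp u \<noteq> 0" for u using mark cmp_less that by blast
  have "runs (WHILE ?g DO process_step) ?s (\<lambda>t s'. proc_inv s' \<and> \<not> bval ?g s' \<and>
      t + proc_potential s' \<le> proc_potential ?s + bcost unit_cost ?g s')"
  proof (rule runs_While, goal_cases)
    case 1
    have eqs: "?s ''k'' 0 = 1" "?s ''fail'' 0 = 0" "?s ''mark'' = s ''mark''" by simp_all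
    have unif: "\<forall>u v. cmp u \<noteq> 0 \<longrightarrow> cmp u = cmp v \<longrightarrow> (s ''mark'' u = 0 \<longleftrightarrow> s ''mark'' v = 0)"
      using marks0 by metis
    show ?case unfolding proc_inv_def eqs empty if_P[OF refl] by (intro conjI) (simp, simp, simp, rule unif)
  next
    case (2 s')
    from 2(3) const have fr: "s' ''comp'' = cmp" "s' ''rev'' = rv" "s' ''member'' = member" "s' ''start'' = start"
      and comps: "s' ''comps'' 0 = comps"
      by (simp_all add: mods_process_step)
    from 2(2) comps have "s' ''k'' 0 \<le> comps" "s' ''fail'' 0 = 0" by simp_all
    from runs_process_step[OF fr 2(1) refl this] show ?case by (rule runs_conseq) simp
  qed
  then have "runs (WHILE ?g DO process_step) ?s (\<lambda>t s'.
      read_result n s' = process_components components Map.empty \<and> t \<le> 80 * comps + 40 * members + 12)"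
  proof (rule runs_conseq, goal_cases)
    case (1 t s')
    from 1(2) const have fr: "s' ''comp'' = cmp" and comps: "s' ''comps'' 0 = comps"
      by (simp_all add: mods_process_step)
    have inv: "proc_inv s'" using 1(1) by blast
    have "read_result n s' = process_components components Map.empty"
    proof (cases "s' ''fail'' 0 = 0")
      case True
      \<comment> \<open>The counter has passed the last component; nothing is left to process and
        the marks are the result.\<close>
      with 1(1) comps have "s' ''k'' 0 = Suc comps" by (auto simp: proc_inv_def)
      moreover have "process_components components Map.empty =
          process_components (drop (s' ''k'' 0 - 1) components) (read_marks n (s' ''mark''))"
        using inv unfolding proc_inv_def if_P[OF True] by blast
      ultimately show ?thesis using True
        by (simp add: components_def read_result_def read_marks_def del: upt_Suc)
    next
      case False
      then have "process_components components Map.empty = Self_Dual (component (s' ''fail'' 0))"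
        using inv unfolding proc_inv_def by simp
      with False show ?thesis by (auto simp: read_result_def fr mem_component_iff)
    qed
    moreover have "proc_potential ?s \<le> 80 * comps + 40 * members" by (simp add: proc_potential_def)
    ultimately show ?case using 1(1) by simp
  qed
  then show ?thesis unfolding process_step_fold by (simp, elim runs_conseq) auto
qed

lemma components_nth: "i < comps \<Longrightarrow> components ! i = component (Suc i)"
  by (simp add: components_def del: upt_Suc)

lemma length_components: "length components = comps"
  by (simp add: components_def)

lemma set_components: "set components = component ` {1..comps}"
  by (auto simp: components_def simp del: upt_Suc)

end

section \<open>Correctness and running time of the algorithm\<close>

definition encode_pair :: "nat \<Rightarrow> nat \<times> nat \<Rightarrow> nat" where
  "encode_pair n p = fst p * n + snd p"

lemma encode_pair_inj: "snd p < n \<Longrightarrow> snd q < n \<Longrightarrow> encode_pair n p = encode_pair n q \<longleftrightarrow> p = q"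
  unfolding encode_pair_def by (subst encode_eq_iff) (auto simp: prod_eq_iff)

text \<open>Identifies the arcs collected by the three nested loops with the constraint digraph
  under the numbering of pairs. The range of the loops loses nothing, since the ends of edges are
  below \<open>n\<close>.\<close>

lemma encoded_constraint_arcs:
  assumes G: "pair_graph G" "pverts G = {..<n}"
    and A: "\<And>x y. x < n \<Longrightarrow> y < n \<Longrightarrow> A x y \<longleftrightarrow> (x,y) \<in> parcs G"
    and f: "f 0 \<longleftrightarrow> B1 \<in> F" "f 1 \<longleftrightarrow> B2 \<in> F" "f 2 \<longleftrightarrow> B3 \<in> F" "f 3 \<longleftrightarrow> T3 \<in> F"
  shows "(\<Union>x<n. \<Union>y<n. \<Union>z<n. triple_arcs n A f x y z) =
    map_prod (encode_pair n) (encode_pair n) ` parcs (constraint_digraph G F)" (is "?L = ?R")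
proof (intro set_eqI iffI)
  have less: "x < n \<and> y < n" if "(x,y) \<in> parcs G" for x y using pair_graph_arcs(1)[OF G(1)] that G(2) by auto
  fix e
  {
    assume "e \<in> ?L"
    then obtain x y z where xyz: "x < n" "y < n" "z < n" and e: "e \<in> triple_arcs n A f x y z" by auto
    have A': "A x y" "A y z" "x \<noteq> z" using e unfolding triple_arcs_def by (auto split: if_splits)
    then have xy: "(x,y) \<in> parcs G" and yz: "(y,z) \<in> parcs G" using A xyz by auto
    \<comment> \<open>The program tests only \<open>x\<close> against \<open>z\<close>; the other
      two inequalities hold because the graph has no loops.\<close>
    then have dist: "distinct [x,y,z]" using A'(3) pair_graph_arcs(4)[OF G(1)] by auto
    have R: "(a * n + b, c * n + d) \<in> ?R" if "((a,b),(c,d)) \<in> parcs (constraint_digraph G F)" for a b c d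
      using imageI[OF that, of "map_prod (encode_pair n) (encode_pair n)"] by (simp add: encode_pair_def)
    show "e \<in> ?R"
    proof (cases "(z,x) \<in> parcs G")
      case True
      then have "e \<in> {(x * n + y, y * n + z), (y * n + x, x * n + z)}" "T3 \<in> F"
        using e A' A[OF xyz(3,1)] f(4) by (auto simp: triple_arcs_def split: if_splits)
      then show ?thesis
        using constraint_arcI(5)[OF dist xy yz _ True, THEN R] constraint_arcI(6)[OF dist xy yz _ True, THEN R]
        by (elim insertE emptyE) simp_all
    next
      case False
      then have "e = (x * n + y, y * n + z) \<and> B1 \<in> F \<or> e = (y * n + x, z * n + y) \<and> B2 \<in> F \<or>
          e = (x * n + y, z * n + y) \<and> B3 \<in> F \<or> e = (y * n + x, y * n + z) \<and> B3 \<in> F"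
        using e A' A[OF xyz(3,1)] f(1-3) by (auto simp: triple_arcs_def split: if_splits)
      then show ?thesis
        using constraint_arcI(1)[OF dist xy yz _ False, THEN R] constraint_arcI(2)[OF dist xy yz _ False, THEN R]
          constraint_arcI(3)[OF dist xy yz _ False, THEN R] constraint_arcI(4)[OF dist xy yz _ False, THEN R]
        by (elim disjE conjE) simp_all
    qed
  next
    assume "e \<in> ?R"
    then obtain a b c d where e: "e = (encode_pair n (a,b), encode_pair n (c,d))"
      and arc: "((a,b),(c,d)) \<in> parcs (constraint_digraph G F)" by auto
    have L: "e \<in> ?L" if "(x,y) \<in> parcs G" "(y,z) \<in> parcs G" "e \<in> triple_arcs n A f x y z" for x y z
      using that less[OF that(1)] less[OF that(2)] by blast
    have A': "A x y \<longleftrightarrow> (x,y) \<in> parcs G" if "x \<in> {p,q,r}" "y \<in> {p,q,r}" "(p,q) \<in> parcs G" "(q,r) \<in> parcs G"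
      for x y p q r
      using A that less[OF that(3)] less[OF that(4)] by auto
    from arc show "e \<in> ?L"
    proof (cases rule: constraint_arcE)
      case (1 x y z)
      show ?thesis by (rule L[OF 1(7,8)]) (use 1 f A'[OF _ _ 1(7,8)] in \<open>simp add: triple_arcs_def e encode_pair_def\<close>)
    next
      case (2 x y z)
      show ?thesis by (rule L[OF 2(7,8)]) (use 2 f A'[OF _ _ 2(7,8)] in \<open>simp add: triple_arcs_def e encode_pair_def\<close>)
    next
      case (3 x y z)
      show ?thesis by (rule L[OF 3(7,8)]) (use 3 f A'[OF _ _ 3(7,8)] in \<open>simp add: triple_arcs_def e encode_pair_def\<close>)
    next
      case (4 x y z)
      show ?thesis by (rule L[OF 4(7,8)]) (use 4 f A'[OF _ _ 4(7,8)] in \<open>simp add: triple_arcs_def e encode_pair_def\<close>)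
    next
      case (5 x y z)
      show ?thesis by (rule L[OF 5(7,8)]) (use 5 f A'[OF _ _ 5(7,8)] in \<open>simp add: triple_arcs_def e encode_pair_def\<close>)
    next
      case (6 x y z)
      show ?thesis by (rule L[OF 6(7,8)]) (use 6 f A'[OF _ _ 6(7,8)] in \<open>simp add: triple_arcs_def e encode_pair_def\<close>)
    qed
  }
qed

text \<open>Only the input banks, \<open>num\<close> and \<open>comp\<close> are prescribed. The
  remaining banks may hold leftovers, so the program can be run on its own as well as after the
  preprocessing of a word.\<close>

lemma runs_algorithm1:
  assumes G: "pair_graph G" "pverts G = {..<n}" and F: "F \<subseteq> {B1, B2, B3, T3}"
    and n: "s ''n'' 0 = n"
    and adj: "\<And>i. i < n * n \<Longrightarrow> s ''adj'' i = of_bool ((i div n, i mod n) \<in> parcs G)"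
    and flags: "\<And>i. i < 4 \<Longrightarrow> s ''F'' i = of_bool ([B1, B2, B3, T3] ! i \<in> F)"
    and zero: "s ''num'' = (\<lambda>_. 0)" "s ''comp'' = (\<lambda>_. 0)"
  shows "runs algorithm1 s (\<lambda>t s'. algorithm1_outcome G F (read_result n s') \<and> t \<le> 2000 * n ^ 3 + 500)"
proof -
  let ?enc = "encode_pair n" and ?D = "constraint_digraph G F"
  define E where "E = map_prod ?enc ?enc ` parcs ?D"
  note PG = pair_graph_arcs[OF G(1)]
  have less: "fst p < n" "snd p < n" if "p \<in> parcs G" for p using PG(1) that G(2) by auto
  have adj_iff: "s ''adj'' (x * n + y) = 1 \<longleftrightarrow> (x,y) \<in> parcs G" if "x < n" "y < n" for x y
    using adj[OF encode_less[OF that]] that(2) by simp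
  have flags_iff: "s ''F'' 0 = 1 \<longleftrightarrow> B1 \<in> F" "s ''F'' 1 = 1 \<longleftrightarrow> B2 \<in> F" "s ''F'' 2 = 1 \<longleftrightarrow> B3 \<in> F"
    "s ''F'' 3 = 1 \<longleftrightarrow> T3 \<in> F"
    using flags[of 0] flags[of 1] flags[of 2] flags[of 3] by simp_all

  from runs_initialise[of s n, OF n zero] obtain t1 s1 where e1: "exec unit_cost initialise s t1 s1"
    and q1: "\<forall>x<n. s1 ''row'' x = x * n" "s1 ''size'' 0 = n * n"
      "\<forall>x<n. \<forall>y<n. s1 ''rev'' (x * n + y) = y * n + x"
      "\<forall>v < n * n. s1 ''first'' v = 0" "\<forall>v < n * n. s1 ''mark'' v = 0"
      "s1 ''num'' = (\<lambda>_. 0)" "s1 ''comp'' = (\<lambda>_. 0)" "t1 \<le> 200 * n^2 + 100"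
    and f1: "\<And>x. x \<notin> mods initialise \<Longrightarrow> s1 x = s x"
    by (elim runsE) auto
  have m1: "mods initialise = {''size'', ''x'', ''row'', ''y'', ''rev'', ''v'', ''first'', ''num'', ''comp'', ''mark''}"
    by (auto simp: initialise_def)
  have ok1: "s1 ''n'' 0 = n \<and> (\<forall>x<n. s1 ''row'' x = x * n) \<and> s1 ''adj'' = s ''adj'' \<and> s1 ''F'' = s ''F''"
    using q1(1) f1[of "''n''"] f1[of "''adj''"] f1[of "''F''"] n by (simp add: m1)

  have S: "(\<Union>x<n. \<Union>y<n. \<Union>z<n. triple_arcs n (\<lambda>x y. s ''adj'' (x * n + y) = 1) (\<lambda>i. s ''F'' i = 1) x y z) = E"
    unfolding E_def by (rule encoded_constraint_arcs[OF G adj_iff flags_iff])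
  from runs_construct[OF ok1 q1(4)] obtain t2 s2 where
    e2: "exec unit_cost construct_constraint_digraph s1 t2 s2"
    and q2: "arc_lists (n * n) E (n * (n * (n * 4))) s2" "t2 \<le> 450 * n ^ 3 + 20"
    and f2: "\<And>x. x \<notin> mods construct_constraint_digraph \<Longrightarrow> s2 x = s1 x"
    unfolding S by (elim runsE) auto
  have m2: "mods construct_constraint_digraph = {''arcs'', ''x'', ''y'', ''z'', ''target'', ''next'', ''first''}"
    by (auto simp: construct_constraint_digraph_def)

  let ?a = "s2 ''arcs'' 0"
  have lists: "\<And>e. 0 < e \<Longrightarrow> e \<le> ?a \<Longrightarrow> s2 ''next'' e < e" "\<And>v. v < n * n \<Longrightarrow> s2 ''first'' v \<le> ?a"
    "\<And>v. v < n * n \<Longrightarrow> set (out_arcs s2 v) = {w. (v,w) \<in> E}"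
    "(\<Sum>v < n * n. length (out_arcs s2 v)) = ?a" "?a \<le> 4 * n ^ 3"
    using q2(1) by (auto simp: arc_lists_def power3_eq_cube)
  have S_arcs: "\<exists>p q. v = ?enc p \<and> w = ?enc q \<and> p \<in> parcs G \<and> q \<in> parcs G \<and> (p,q) \<in> parcs ?D"
    if "(v,w) \<in> E" for v w
  proof -
    from that obtain p q where pq: "v = ?enc p" "w = ?enc q" "(p,q) \<in> parcs ?D" unfolding E_def by auto
    moreover interpret D: pair_wf_digraph ?D by (rule constraint_digraph_props(1)[OF G(1)])
    have "p \<in> parcs G" "q \<in> parcs G"
      using pq(3) D.in_arcsD1 D.in_arcsD2 constraint_digraph_props(2)[OF G(1), of F] by blast+
    ultimately show ?thesis by blast
  qed
  have enc_verts: "?enc p < n * n \<and> s ''adj'' (?enc p) = 1" if "p \<in> parcs G" for p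
    using less[OF that] encode_less adj_iff that unfolding encode_pair_def by auto

  interpret T: tarjan_input "n * n" ?a "s2 ''next''" "s2 ''target''" "s2 ''first''" "s ''adj''"
  proof
    fix v u assume "v < n * n" "u \<in> set (out_arcs s2 v)"
    then have "(v,u) \<in> E" using lists(3) by blast
    then obtain q where "u = ?enc q" "q \<in> parcs G" using S_arcs by blast
    then show "u < n * n \<and> s ''adj'' u = 1" using enc_verts by blast
  next
    fix e assume "0 < e" "e \<le> ?a" then show "s2 ''next'' e < e" by (rule lists(1))
  next
    fix v assume "v < n * n" then show "s2 ''first'' v \<le> ?a" by (rule lists(2))
  qed
  have verts: "T.verts = ?enc ` parcs G"
  proof (intro set_eqI iffI)
    fix v assume v: "v \<in> T.verts"
    then obtain x y where "v = x * n + y" "x < n" "y < n"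
      unfolding T.verts_def by (auto elim: less_square_cases)
    with v adj_iff show "v \<in> ?enc ` parcs G"
      by (intro image_eqI[of _ _ "(x,y)"]) (auto simp: T.verts_def encode_pair_def)
  qed (use enc_verts in \<open>auto simp: T.verts_def\<close>)
  have size2: "s2 ''size'' 0 = n * n" using f2[of "''size''"] q1(2) by (simp add: m2)
  have s2: "s2 ''adj'' = s ''adj''" "s2 ''num'' = (\<lambda>_. 0)" "s2 ''comp'' = (\<lambda>_. 0)"
    using f2[of "''adj''"] f2[of "''num''"] f2[of "''comp''"] ok1 q1(6,7) by (simp_all add: m2)
  from T.runs_tarjan[OF size2 s2(1) refl refl refl s2(2,3)] obtain t3 s3 where
    e3: "exec unit_cost tarjan s2 t3 s3"
    and q3: "tarjan_state T.verts T.succs (s3 ''num'') (s3 ''low'') (s3 ''comp'') (T.rest s3) []"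
      "\<And>v. s3 ''comp'' v \<noteq> 0 \<longleftrightarrow> v \<in> T.verts"
      "comps_ok (s3 ''comp'') (s3 ''comps'' 0) (s3 ''members'' 0) (s3 ''start'') (s3 ''member'')"
      "s3 ''members'' 0 \<le> n * n" "t3 \<le> 23 + 300 * (n * n) + 60 * ?a"
    and f3: "\<And>x. x \<notin> mods tarjan \<Longrightarrow> s3 x = s2 x"
    unfolding lists(4) by (elim runsE) auto
  have m3: "mods tarjan \<inter> {''mark'', ''rev''} = {}"
    by (auto simp: tarjan_def mods_finish mods_explore)
  let ?comp = "s3 ''comp''"
  interpret S: tarjan_state T.verts T.succs "s3 ''num''" "s3 ''low''" ?comp "T.rest s3" "[]" by fact

  have succs: "T.succs v = {w. (v,w) \<in> E}" if "v \<in> T.verts" for v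
    using lists(3)[of v] that unfolding T.succs_def T.verts_def by simp
  have reach1: "(?enc p, ?enc q) \<in> (edges T.succs)\<^sup>*" if "(p,q) \<in> (parcs ?D)\<^sup>*" for p q
    using that
  proof (induction rule: rtrancl_induct)
    case (step q r)
    have qr: "(?enc q, ?enc r) \<in> E" using imageI[OF step.hyps(2), of "map_prod ?enc ?enc"] by (simp add: E_def)
    then have "?enc q \<in> T.verts" using S_arcs unfolding verts by blast
    from succs[OF this] qr have "(?enc q, ?enc r) \<in> edges T.succs" by (simp only: edges_def) blast
    with step.IH show ?case by (rule rtrancl_into_rtrancl)
  qed simp
  \<comment> \<open>A path that starts at the number of an edge stays among numbers of edges.
    Injectivity of the numbering ensures that consecutive arcs meet in the same pair and not merely
    in the same number.\<close>
  have reach2: "\<exists>q \<in> parcs G. w = ?enc q \<and> (p,q) \<in> (parcs ?D)\<^sup>*"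
    if "(?enc p, w) \<in> (edges T.succs)\<^sup>*" "p \<in> parcs G" for p w
    using that
  proof (induction rule: rtrancl_induct)
    case (step v w)
    then obtain q where q: "q \<in> parcs G" "v = ?enc q" "(p,q) \<in> (parcs ?D)\<^sup>*" by blast
    have "(v,w) \<in> E" using step.hyps(2) succs[of v] q(1,2) verts by (auto simp: edges_def)
    then obtain q' r where r: "v = ?enc q'" "w = ?enc r" "q' \<in> parcs G" "r \<in> parcs G" "(q',r) \<in> parcs ?D"
      using S_arcs by blast
    have "q = q'" using r(1) q(2) encode_pair_inj less(2) q(1) r(3) by metis
    with r(5) q(3) have "(p,r) \<in> (parcs ?D)\<^sup>*" by (blast intro: rtrancl_into_rtrancl)
    with r(2,4) show ?case by blast
  qed blast
  have reach_iff: "(?enc p, ?enc q) \<in> (edges T.succs)\<^sup>* \<longleftrightarrow> (p,q) \<in> (parcs ?D)\<^sup>*"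
    if "p \<in> parcs G" "q \<in> parcs G" for p q
  proof
    assume "(?enc p, ?enc q) \<in> (edges T.succs)\<^sup>*"
    from reach2[OF this that(1)] obtain q' where q': "q' \<in> parcs G" "?enc q = ?enc q'" "(p,q') \<in> (parcs ?D)\<^sup>*"
      by blast
    then have "q = q'" using encode_pair_inj less(2) that(2) by metis
    with q'(3) show "(p,q) \<in> (parcs ?D)\<^sup>*" by simp
  qed (rule reach1)
  have comp_eq: "?comp (?enc p) = ?comp (?enc q) \<longleftrightarrow> (p,q) \<in> (parcs ?D)\<^sup>* \<and> (q,p) \<in> (parcs ?D)\<^sup>*"
    if "p \<in> parcs G" "q \<in> parcs G" for p q
  proof -
    have "?comp (?enc p) \<noteq> 0" using q3(2) that verts by blast
    from S.comp_eq_iff[OF this, of "?enc q"] show ?thesis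
      unfolding reach_iff[OF that] reach_iff[OF that(2,1)] by metis
  qed
  have comp_le: "?comp (?enc q) \<le> ?comp (?enc p)" if "(p,q) \<in> (parcs ?D)\<^sup>*" "p \<in> parcs G" for p q
    using S.comp_mono[OF reach1[OF that(1)]] q3(2)[of "?enc p"] that(2) verts by blast
  have comp0: "?comp (?enc p) \<noteq> 0" if "p \<in> parcs G" for p using q3(2) that verts by blast
  have comp_enc: "\<exists>p \<in> parcs G. v = ?enc p" if "?comp v \<noteq> 0" for v using q3(2) that verts by blast

  have rev3: "s3 ''rev'' = s1 ''rev''" and mark3: "s3 ''mark'' = s1 ''mark''"
    using f3[of "''rev''"] f2[of "''rev''"] f3[of "''mark''"] f2[of "''mark''"] m3 by (auto simp: m2)
  have rev_enc: "s3 ''rev'' (?enc p) = ?enc (prod.swap p)" if "p \<in> parcs G" for p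
    using q1(3) less[OF that] unfolding rev3 encode_pair_def by simp
  note swap = swap_in_arcs[OF G(1)]
  interpret P: process_input n ?comp "s3 ''rev''" "s3 ''member''" "s3 ''start''" "s3 ''comps'' 0" "s3 ''members'' 0"
  proof
    show "comps_ok ?comp (s3 ''comps'' 0) (s3 ''members'' 0) (s3 ''start'') (s3 ''member'')" by fact
  next
    fix v assume "?comp v \<noteq> 0" then show "v < n * n" using q3(2) unfolding T.verts_def by blast
  next
    fix x y assume "x < n" "y < n" then show "s3 ''rev'' (x * n + y) = y * n + x" using q1(3) rev3 by simp
  next
    fix u v assume uv: "?comp u \<noteq> 0" "?comp u = ?comp v"
    then have "?comp v \<noteq> 0" by simp
    with uv comp_enc obtain p q where pq: "p \<in> parcs G" "u = ?enc p" "q \<in> parcs G" "v = ?enc q" by blast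
    with uv(2) comp_eq have "(p,q) \<in> (parcs ?D)\<^sup>*" "(q,p) \<in> (parcs ?D)\<^sup>*" by blast+
    \<comment> \<open>Reversing the paths between \<open>p\<close> and \<open>q\<close> by skew
      symmetry yields paths between their duals.\<close>
    then have "?comp (?enc (prod.swap p)) = ?comp (?enc (prod.swap q))"
      using reach_skew[OF G(1)] comp_eq swap pq(1,3) by blast
    then show "?comp (s3 ''rev'' u) = ?comp (s3 ''rev'' v)" using rev_enc pq by simp
  next
    fix u assume "?comp u \<noteq> 0"
    then obtain p where "p \<in> parcs G" "u = ?enc p" using comp_enc by blast
    then show "?comp (s3 ''rev'' u) \<noteq> 0" using rev_enc comp0 swap by simp
  qed
  from P.runs_process[of s3, OF refl refl refl refl refl] mark3 q1(5) obtain t4 s4 where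
    e4: "exec unit_cost process s3 t4 s4"
    and q4: "read_result n s4 = process_components P.components Map.empty"
      "t4 \<le> 80 * s3 ''comps'' 0 + 40 * s3 ''members'' 0 + 20"
    by (auto elim: runsE)

  have comp_iff: "p \<in> P.component k \<longleftrightarrow> p \<in> parcs G \<and> ?comp (?enc p) = k" if "0 < k" for p k
  proof -
    obtain x y where p: "p = (x,y)" by (cases p)
    have "(x,y) \<in> parcs G" if "?comp (x * n + y) \<noteq> 0" "x < n" "y < n"
      using q3(2)[of "x * n + y"] that adj_iff[of x y] by (simp add: T.verts_def)
    then show ?thesis using P.mem_component_iff[OF \<open>0 < k\<close>, of x y] less[of p] \<open>0 < k\<close>
      by (auto simp: p encode_pair_def)
  qed
  have comp_range: "1 \<le> ?comp (?enc p) \<and> ?comp (?enc p) \<le> s3 ''comps'' 0" if "p \<in> parcs G" for p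
    using comp0[OF that] q3(3) by (simp add: comps_ok_def Suc_le_eq)
  have comp_ne: "\<exists>p \<in> parcs G. ?comp (?enc p) = k" if "1 \<le> k" "k \<le> s3 ''comps'' 0" for k
  proof -
    from q3(3) that have "s3 ''member'' ` {s3 ''start'' k..<s3 ''start'' (Suc k)} = {v. ?comp v = k}"
      "s3 ''start'' k < s3 ''start'' (Suc k)" by (simp_all add: comps_ok_def)
    then have "s3 ''member'' (s3 ''start'' k) \<in> {v. ?comp v = k}"
      using imageI[of "s3 ''start'' k" "{s3 ''start'' k..<s3 ''start'' (Suc k)}" "s3 ''member''"] by simp
    then obtain v where v: "?comp v = k" by blast
    with that(1) obtain p where "p \<in> parcs G" "v = ?enc p" using comp_enc[of v] by auto
    with v show ?thesis by blast
  qed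
  have "reverse_topological ?D P.components"
    unfolding reverse_topological_def
  proof (intro conjI allI impI)
    show "distinct P.components"
      unfolding distinct_conv_nth P.length_components
    proof (intro allI impI notI)
      fix i j assume ij: "i < s3 ''comps'' 0" "j < s3 ''comps'' 0" "i \<noteq> j" "P.components ! i = P.components ! j"
      obtain p where "p \<in> parcs G" "?comp (?enc p) = Suc i" using comp_ne[of "Suc i"] ij(1) by auto
      with ij show False using comp_iff[of "Suc i" p] comp_iff[of "Suc j" p] by (simp add: P.components_nth)
    qed
    show "set P.components = pre_digraph.sccs_verts (with_proj ?D)"
    proof (intro set_eqI)
      fix X
      have comp_scc: "P.component (?comp (?enc p)) = {q. (p,q) \<in> (parcs ?D)\<^sup>* \<and> (q,p) \<in> (parcs ?D)\<^sup>*}"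
        if "p \<in> parcs G" for p
      proof (intro set_eqI)
        fix q
        have "q \<in> parcs G" if "(p,q) \<in> (parcs ?D)\<^sup>*"
          using that \<open>p \<in> parcs G\<close>
        proof (induction rule: rtrancl_induct)
          case (step y z)
          show ?case
            using step.hyps(2) constraint_digraph_props(1,2)[OF G(1), of F] pair_wf_digraph.in_arcsD2 by metis
        qed
        then show "q \<in> P.component (?comp (?enc p)) \<longleftrightarrow> q \<in> {q. (p,q) \<in> (parcs ?D)\<^sup>* \<and> (q,p) \<in> (parcs ?D)\<^sup>*}"
          using comp_iff[of "?comp (?enc p)" q] comp0[OF that] comp_eq[OF that, of q] by auto
      qed
      show "X \<in> set P.components \<longleftrightarrow> X \<in> pre_digraph.sccs_verts (with_proj ?D)"
        unfolding P.set_components in_constraint_sccs_iff[OF G(1)]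
      proof
        assume "X \<in> P.component ` {1..s3 ''comps'' 0}"
        then obtain k where "1 \<le> k" "k \<le> s3 ''comps'' 0" "X = P.component k" by auto
        then show "\<exists>u \<in> parcs G. X = {v. (u,v) \<in> (parcs ?D)\<^sup>* \<and> (v,u) \<in> (parcs ?D)\<^sup>*}"
          using comp_ne[of k] comp_scc by blast
      next
        assume "\<exists>u \<in> parcs G. X = {v. (u,v) \<in> (parcs ?D)\<^sup>* \<and> (v,u) \<in> (parcs ?D)\<^sup>*}"
        then show "X \<in> P.component ` {1..s3 ''comps'' 0}"
          using comp_scc comp_range by fastforce
      qed
    qed
  next
    fix i j
    assume "i < length P.components \<and> j < length P.components \<and>
      (\<exists>u \<in> P.components ! i. \<exists>v \<in> P.components ! j. u \<rightarrow>\<^sup>*\<^bsub>with_proj ?D\<^esub> v)"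
    then obtain p q where ij: "i < s3 ''comps'' 0" "j < s3 ''comps'' 0"
      and pq: "p \<in> P.component (Suc i)" "q \<in> P.component (Suc j)" "(p,q) \<in> (parcs ?D)\<^sup>*"
      by (auto simp: P.length_components P.components_nth
          reachable_with_proj_iff[OF constraint_digraph_props(1)[OF G(1), of F]])
    then show "j \<le> i" using comp_le[OF pq(3)] comp_iff[of "Suc i" p] comp_iff[of "Suc j" q] by simp
  qed
  then have outcome: "algorithm1_outcome G F (read_result n s4)"
    unfolding algorithm1_outcome_def q4(1) by blast

  have "t1 + (t2 + (t3 + t4)) \<le> 2000 * n ^ 3 + 500"
  proof -
    have "n ^ 2 \<le> n ^ 3" by (cases n; simp add: power_increasing)
    \<comment> \<open>So there are at most \<open>n * n\<close> components, and processing them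
      takes quadratic time.\<close>
    moreover have "s3 ''comps'' 0 \<le> s3 ''members'' 0" using q3(3) by (simp add: comps_ok_def)
    ultimately show ?thesis
      using q1(8) q2(2) q3(4,5) q4(2) lists(5) unfolding power2_eq_square by linarith
  qed
  with outcome show ?thesis
    unfolding algorithm1_def by (intro runsI[OF exec.Seq[OF e1 exec.Seq[OF e2 exec.Seq[OF e3 e4]]]]) simp
qed

section \<open>Membership in P\<close>

text \<open>Squares are generated by adding successive odd numbers; \<open>sq\<close> is kept 4
  larger than the square of \<open>n\<close> because of the four bits for the forbidden
  digraphs.\<close>

definition square_root :: com where
  "square_root = (''n'' ::= N 0;; ''sq'' ::= N 4;;
     WHILE V ''sq'' \<prec> V ''len'' DO
       (''sq'' ::= V ''sq'' \<boxplus> (V ''n'' \<boxplus> (V ''n'' \<boxplus> N 1));; ''n'' ::= V ''n'' \<boxplus> N 1))"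

definition copy_input :: com where
  "copy_input = (''F''\<langle>N 0\<rangle> ::= ''in''\<langle>N 0\<rangle>;; ''F''\<langle>N 1\<rangle> ::= ''in''\<langle>N 1\<rangle>;;
     ''F''\<langle>N 2\<rangle> ::= ''in''\<langle>N 2\<rangle>;; ''F''\<langle>N 3\<rangle> ::= ''in''\<langle>N 3\<rangle>;;
     ''size'' ::= V ''len'' \<boxminus> N 4;;
     FOR ''i'' (V ''size'') (''adj''\<langle>V ''i''\<rangle> ::= ''in''\<langle>V ''i'' \<boxplus> N 4\<rangle>))"

definition compute_rows :: com where
  "compute_rows = (''size'' ::= N 0;; FOR ''x'' (V ''n'')
     (''row''\<langle>V ''x''\<rangle> ::= V ''size'';; ''size'' ::= V ''size'' \<boxplus> V ''n''))"

definition check_graph :: com where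
  "check_graph = (''bad'' ::= N 0;; FOR ''x'' (V ''n'') (FOR ''y'' (V ''n'')
     (IF edge ''x'' ''y'' AND Neg (edge ''y'' ''x'' AND Neg (V ''x'' \<doteq> V ''y''))
      THEN ''bad'' ::= N 1 ELSE SKIP)))"

text \<open>Membership has to be decided for all words, so lengths other than 4 plus a square and
  matrices that are not symmetric and loopless are rejected explicitly.\<close>

definition decide_word :: com where
  "decide_word = (square_root;;
     IF V ''sq'' \<doteq> V ''len'' THEN
       (copy_input;; compute_rows;; check_graph;;
        IF V ''bad'' \<doteq> N 0 THEN
          (algorithm1;; IF V ''fail'' \<doteq> N 0 THEN ''out'' ::= N 1 ELSE ''out'' ::= N 0)
        ELSE ''out'' ::= N 0)
     ELSE ''out'' ::= N 0)"

text \<open>All smaller candidates were too small, so the loop stops at the least \<open>n\<close>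
  whose square plus 4 is at least the length. If the length has the required form at all, it is
  attained there.\<close>

lemma runs_square_root:
  assumes "s ''len'' 0 = l"
  shows "runs square_root s (\<lambda>t s'. s' ''sq'' 0 = s' ''n'' 0 * s' ''n'' 0 + 4 \<and> s' ''n'' 0 \<le> l \<and>
    (s' ''sq'' 0 = l \<longleftrightarrow> (\<exists>n. l = 4 + n * n)) \<and> t \<le> 40 * l + 20)"
proof -
  let ?s = "s(''n'' := (s ''n'')(0 := 0), ''sq'' := (s ''sq'')(0 := 4))"
  let ?g = "V ''sq'' \<prec> V ''len''"
  let ?c = "''sq'' ::= V ''sq'' \<boxplus> (V ''n'' \<boxplus> (V ''n'' \<boxplus> N 1));; ''n'' ::= V ''n'' \<boxplus> N 1"
  let ?I = "\<lambda>s'. s' ''sq'' 0 = s' ''n'' 0 * s' ''n'' 0 + 4 \<and> s' ''n'' 0 \<le> l \<and>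
    (\<forall>k < s' ''n'' 0. k * k + 4 < l)"
  have "runs (WHILE ?g DO ?c) ?s (\<lambda>t s'. ?I s' \<and> \<not> bval ?g s' \<and>
      t + 40 * (l - s' ''sq'' 0) \<le> 40 * (l - ?s ''sq'' 0) + bcost unit_cost ?g s')"
  proof (rule runs_While, goal_cases)
    case (2 s')
    define n where "n = s' ''n'' 0"
    have len: "s' ''len'' 0 = l" using 2(3)[of "''len''"] assms by simp
    have sq: "s' ''sq'' 0 = n * n + 4" and lt: "n * n + 4 < l" and all: "\<forall>k<n. k * k + 4 < l"
      using 2(1,2) len by (simp_all add: n_def)
    have "n < l" using lt le_square[of n] by linarith
    moreover have "\<forall>k < Suc n. k * k + 4 < l" using all lt by (simp add: less_Suc_eq)
    moreover have "40 * (l - (n * n + 4)) \<ge> 40 + 40 * (l - (n * n + 4 + (n + (n + 1))))" using lt by simp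
    ultimately show ?case using sq by (simp add: n_def[symmetric])
  qed simp
  then have "runs (WHILE ?g DO ?c) ?s (\<lambda>t s'. s' ''sq'' 0 = s' ''n'' 0 * s' ''n'' 0 + 4 \<and> s' ''n'' 0 \<le> l \<and>
    (s' ''sq'' 0 = l \<longleftrightarrow> (\<exists>n. l = 4 + n * n)) \<and> t \<le> 40 * l + 10)"
  proof (rule runs_conseq, goal_cases)
    case (1 t s')
    have len: "s' ''len'' 0 = l" using 1(2)[of "''len''"] assms by simp
    have "s' ''sq'' 0 = l" if "l = 4 + k * k" for k
    proof -
      have "\<not> k < s' ''n'' 0" using 1(1) that by auto
      then have "s' ''n'' 0 * s' ''n'' 0 \<le> k * k" by (intro mult_le_mono) simp_all
      then show ?thesis using 1(1) len that by simp
    qed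
    then show ?case using 1(1) by (auto simp: add.commute)
  qed
  then show ?thesis unfolding square_root_def
    by (simp, elim runs_conseq, elim conjE, intro conjI) (assumption | simp)+
qed

lemma runs_copy_input:
  assumes "s ''len'' 0 = 4 + m"
  shows "runs copy_input s (\<lambda>t s'. (\<forall>i<4. s' ''F'' i = s ''in'' i) \<and> (\<forall>i<m. s' ''adj'' i = s ''in'' (4 + i)) \<and>
    t \<le> 40 + 30 * m)"
proof -
  let ?s = "s(''F'' := (s ''F'')(0 := s ''in'' 0, 1 := s ''in'' 1, 2 := s ''in'' 2, 3 := s ''in'' 3),
    ''size'' := (s ''size'')(0 := m))"
  have "runs (FOR ''i'' (V ''size'') (''adj''\<langle>V ''i''\<rangle> ::= ''in''\<langle>V ''i'' \<boxplus> N 4\<rangle>)) ?s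
      (\<lambda>t s'. (\<forall>i<m. s' ''adj'' i = s ''in'' (4 + i)) \<and> t \<le> 8 + m * (19 + 11))"
  proof (rule runs_FOR'[where P = "\<lambda>k s'. \<forall>i<k. s' ''adj'' i = s ''in'' (4 + i)"], goal_cases)
    case (5 k s')
    have "s' ''in'' = s ''in''" using 5(5)[of "''in''"] by simp
    with 5 show ?case by (simp add: less_Suc_eq add.commute)
  qed simp_all
  then have "runs (FOR ''i'' (V ''size'') (''adj''\<langle>V ''i''\<rangle> ::= ''in''\<langle>V ''i'' \<boxplus> N 4\<rangle>)) ?s
      (\<lambda>t s'. (\<forall>i<4. s' ''F'' i = s ''in'' i) \<and> (\<forall>i<m. s' ''adj'' i = s ''in'' (4 + i)) \<and> t \<le> 8 + m * 30)"
  proof (rule runs_conseq, goal_cases)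
    case (1 t s')
    have F: "s' ''F'' = (s ''F'')(0 := s ''in'' 0, 1 := s ''in'' 1, 2 := s ''in'' 2, 3 := s ''in'' 3)"
      using 1(2)[of "''F''"] by simp
    have "s' ''F'' i = s ''in'' i" if "i < 4" for i
    proof -
      from that have "i = 0 \<or> i = 1 \<or> i = 2 \<or> i = 3" by arith
      then show ?thesis unfolding F by auto
    qed
    with 1(1) show ?case by simp
  qed
  then show ?thesis unfolding copy_input_def using assms by (simp, elim runs_conseq) auto
qed

lemma runs_compute_rows:
  assumes "s ''n'' 0 = n"
  shows "runs compute_rows s (\<lambda>t s'. (\<forall>x<n. s' ''row'' x = x * n) \<and> t \<le> 11 + n * 40)"
  unfolding compute_rows_def runs_Seq runs_Store
  by (rule runs_conseq[OF runs_row[of _ n]]) (use assms in auto)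

lemma runs_check_graph:
  assumes n: "s ''n'' 0 = n" and row: "\<forall>x<n. s ''row'' x = x * n"
  shows "runs check_graph s (\<lambda>t s'. (s' ''bad'' 0 = 0 \<longleftrightarrow> (\<forall>x<n. \<forall>y<n. s ''adj'' (x * n + y) = 1 \<longrightarrow>
      s ''adj'' (y * n + x) = 1 \<and> x \<noteq> y)) \<and> t \<le> 11 + n * (19 + n * 61))"
proof -
  let ?ok = "\<lambda>x y. s ''adj'' (x * n + y) = 1 \<longrightarrow> s ''adj'' (y * n + x) = 1 \<and> x \<noteq> y"
  let ?c = "IF edge ''x'' ''y'' AND Neg (edge ''y'' ''x'' AND Neg (V ''x'' \<doteq> V ''y''))
      THEN ''bad'' ::= N 1 ELSE SKIP"
  let ?s = "s(''bad'' := (s ''bad'')(0 := 0))"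
  have "runs (FOR ''x'' (V ''n'') (FOR ''y'' (V ''n'') ?c)) ?s
    (\<lambda>t s'. (s' ''bad'' 0 = 0 \<longleftrightarrow> (\<forall>x<n. \<forall>y<n. ?ok x y)) \<and> t \<le> 8 + n * ((8 + n * (50 + 11)) + 11))"
  proof (rule runs_FOR'[where P = "\<lambda>k s'. s' ''bad'' 0 = 0 \<longleftrightarrow> (\<forall>x<k. \<forall>y<n. ?ok x y)"], goal_cases)
    case (5 k s')
    note o = 5
    have "runs (FOR ''y'' (V ''n'') ?c) s' (\<lambda>t s''. (s'' ''bad'' 0 = 0 \<longleftrightarrow>
        (\<forall>x<k. \<forall>y<n. ?ok x y) \<and> (\<forall>y<n. ?ok k y)) \<and> t \<le> 8 + n * (50 + 11))"
    proof (rule runs_FOR'[where P = "\<lambda>l s''. s'' ''bad'' 0 = 0 \<longleftrightarrow>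
        (\<forall>x<k. \<forall>y<n. ?ok x y) \<and> (\<forall>y<l. ?ok k y)"], goal_cases)
      case (5 l s'')
      have fr: "s'' ''adj'' = s ''adj''" "s'' ''row'' = s ''row''" "s'' ''x'' 0 = k"
        using 5(5)[of "''adj''"] 5(5)[of "''row''"] 5(5)[of "''x''"] o(5)[of "''adj''"] o(5)[of "''row''"] o(2)
        by simp_all
      have kl: "s ''row'' k = k * n" "s ''row'' l = l * n" using row 5(3) o(3) by simp_all
      show ?case
        using 5(1) by (cases "?ok k l") (auto simp: edge_def pair_def fr kl 5(2) less_Suc_eq)
    qed (use o in auto)
    then show ?case
    proof (rule runs_conseq, goal_cases)
      case (1 t s'')
      have "s'' ''x'' 0 = k" using 1(2)[of "''x''"] o(2) by simp
      moreover have "s'' ''bad'' 0 = 0 \<longleftrightarrow> (\<forall>x<Suc k. \<forall>y<n. ?ok x y)"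
        unfolding All_less_Suc using conjunct1[OF 1(1)] by (simp only: conj_commute)
      ultimately show ?case using 1(1) by simp
    qed
  qed (use n in auto)
  then show ?thesis unfolding check_graph_def by (simp, elim runs_conseq) auto
qed

section \<open>Words as encodings of graphs and families\<close>

definition word_graph :: "nat \<Rightarrow> bool list \<Rightarrow> nat pair_pre_digraph" where
  "word_graph n u = \<lparr>pverts = {..<n}, parcs = {(x,y). x < n \<and> y < n \<and> u ! (4 + (x * n + y))}\<rparr>"

definition word_family :: "bool list \<Rightarrow> nat pair_pre_digraph set" where
  "word_family u = {[B1, B2, B3, T3] ! i | i. i < 4 \<and> u ! i}"

text \<open>The three arcs tested here tell the four digraphs apart. If two of them coincided, their
  bits could not be read back independently.\<close>

lemma digraphs_distinct: "distinct [B1, B2, B3, T3]"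
proof -
  have "distinct (map (\<lambda>H. ((2,1) \<in> parcs H, (1,0) \<in> parcs H, (0,2) \<in> parcs H)) [B1, B2, B3, T3])"
    by (simp add: B1_def B2_def B3_def T3_def)
  then show ?thesis unfolding distinct_map by blast
qed

lemma length_encode: "length (encode n G F) = 4 + n * n"
  by (simp add: encode_def)

lemma nth_encode:
  shows "i < 4 \<Longrightarrow> encode n G F ! i \<longleftrightarrow> [B1, B2, B3, T3] ! i \<in> F"
    and "x < n \<Longrightarrow> y < n \<Longrightarrow> encode n G F ! (4 + (x * n + y)) \<longleftrightarrow> (x,y) \<in> parcs G"
proof -
  assume "i < 4"
  then have "i = 0 \<or> i = 1 \<or> i = 2 \<or> i = 3" by arith
  then show "encode n G F ! i \<longleftrightarrow> [B1, B2, B3, T3] ! i \<in> F" by (auto simp: encode_def)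
next
  assume "x < n" "y < n"
  then show "encode n G F ! (4 + (x * n + y)) \<longleftrightarrow> (x,y) \<in> parcs G"
    using encode_less[of x n y] by (simp add: encode_def)
qed

lemma word_family_subset: "word_family u \<subseteq> {B1, B2, B3, T3}"
proof
  fix H assume "H \<in> word_family u"
  then obtain i where i: "i < 4" "H = [B1, B2, B3, T3] ! i" by (auto simp: word_family_def)
  then have "i < length [B1, B2, B3, T3]" by simp
  then have "H \<in> set [B1, B2, B3, T3]" unfolding i(2) by (rule nth_mem)
  then show "H \<in> {B1, B2, B3, T3}" by simp
qed

lemma nth_mem_word_family: "i < 4 \<Longrightarrow> [B1, B2, B3, T3] ! i \<in> word_family u \<longleftrightarrow> u ! i"
proof
  assume i: "i < 4" and "[B1, B2, B3, T3] ! i \<in> word_family u"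
  then obtain j where j: "j < 4" "u ! j" "[B1, B2, B3, T3] ! i = [B1, B2, B3, T3] ! j"
    by (auto simp: word_family_def)
  then have "i = j" using nth_eq_iff_index_eq[OF digraphs_distinct, of i j] i by simp
  with j show "u ! i" by simp
qed (auto simp: word_family_def)

text \<open>\<open>word_graph\<close> need not yield a graph, yet encoding it returns the word, as
  \<open>encode\<close> merely reads off the set of arcs.\<close>

lemma encode_word:
  assumes "length u = 4 + n * n"
  shows "encode n (word_graph n u) (word_family u) = u"
proof (rule nth_equalityI)
  fix i assume "i < length (encode n (word_graph n u) (word_family u))"
  then have i: "i < 4 + n * n" by (simp add: length_encode)
  show "encode n (word_graph n u) (word_family u) ! i = u ! i"
  proof (cases "i < 4")
    case True
    then show ?thesis by (simp add: nth_encode(1) nth_mem_word_family)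
  next
    case False
    with i have "i - 4 < n * n" by simp
    then obtain x y where xy: "i - 4 = x * n + y" "x < n" "y < n" by (elim less_square_cases)
    with False have "i = 4 + (x * n + y)" by simp
    then show ?thesis using xy by (simp add: nth_encode(2) word_graph_def)
  qed
qed (simp add: assms length_encode)

lemma word_encode:
  assumes "pair_graph G" "pverts G = {..<n}" "F \<subseteq> {B1, B2, B3, T3}"
  shows "word_graph n (encode n G F) = G" "word_family (encode n G F) = F"
proof -
  have "parcs (word_graph n (encode n G F)) = parcs G"
    using pair_graph_arcs(1)[OF assms(1)] assms(2) by (auto simp: word_graph_def nth_encode(2))
  then show "word_graph n (encode n G F) = G" using assms(2) by (simp add: word_graph_def)
  show "word_family (encode n G F) = F"
  proof (intro set_eqI iffI)
    fix H assume "H \<in> word_family (encode n G F)"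
    then show "H \<in> F" by (auto simp: word_family_def nth_encode(1))
  next
    fix H assume H: "H \<in> F"
    with assms(3) have "H \<in> set [B1, B2, B3, T3]" by auto
    then obtain i where i: "i < length [B1, B2, B3, T3]" "[B1, B2, B3, T3] ! i = H" unfolding in_set_conv_nth by blast
    then have "i < 4" by simp
    with H i(2) nth_encode(1)[OF this, of n G F] nth_mem_word_family[OF this, of "encode n G F"]
    show "H \<in> word_family (encode n G F)" by simp
  qed
qed

lemma free_orientation_problem_iff:
  assumes "length u = 4 + n * n"
  shows "u \<in> free_orientation_problem \<longleftrightarrow>
    pair_graph (word_graph n u) \<and> (\<exists>D. F_free_orientation (word_graph n u) (word_family u) D)"
proof
  assume "u \<in> free_orientation_problem"
  then obtain m G F where *: "u = encode m G F" "pair_graph G" "pverts G = {..<m}" "F \<subseteq> {B1, B2, B3, T3}"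
    "\<exists>D. F_free_orientation G F D" unfolding free_orientation_problem_def by blast
  have "m * m = n * n" using assms *(1) by (simp add: length_encode)
  then have "m = n" by (metis power2_eq_iff_nonneg power2_eq_square zero_le)
  with * word_encode[OF *(2-4)] show "pair_graph (word_graph n u) \<and>
      (\<exists>D. F_free_orientation (word_graph n u) (word_family u) D)" by simp
next
  assume *: "pair_graph (word_graph n u) \<and> (\<exists>D. F_free_orientation (word_graph n u) (word_family u) D)"
  have "pverts (word_graph n u) = {..<n}" by (simp add: word_graph_def)
  with * word_family_subset encode_word[OF assms] show "u \<in> free_orientation_problem"
    unfolding free_orientation_problem_def by (metis (mono_tags, lifting) mem_Collect_eq)
qed

lemma pair_graph_word_iff:
  "pair_graph (word_graph n u) \<longleftrightarrow> (\<forall>x<n. \<forall>y<n. u ! (4 + (x * n + y)) \<longrightarrow> u ! (4 + (y * n + x)) \<and> x \<noteq> y)"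
proof
  assume G: "pair_graph (word_graph n u)"
  show "\<forall>x<n. \<forall>y<n. u ! (4 + (x * n + y)) \<longrightarrow> u ! (4 + (y * n + x)) \<and> x \<noteq> y"
    using pair_graph_arcs(3,4)[OF G] by (auto simp: word_graph_def)
next
  assume *: "\<forall>x<n. \<forall>y<n. u ! (4 + (x * n + y)) \<longrightarrow> u ! (4 + (y * n + x)) \<and> x \<noteq> y"
  have "finite (parcs (word_graph n u))"
    by (rule finite_subset[of _ "{..<n} \<times> {..<n}"]) (auto simp: word_graph_def)
  moreover have "sym (parcs (word_graph n u))" using * by (auto simp: word_graph_def sym_def)
  ultimately show "pair_graph (word_graph n u)"
    using * by unfold_locales (auto simp: word_graph_def symmetric_def)
qed

lemma result_correct:
  assumes "pair_graph G" "F \<subseteq> {B1, B2, B3, T3}" "algorithm1_outcome G F (read_result n s)"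
  shows "s ''fail'' 0 = 0 \<longleftrightarrow> (\<exists>D. F_free_orientation G F D)"
  using algorithm1_outcome_correct[OF assms] by (auto simp: read_result_def split: if_splits)

lemma mods_square_root: "mods square_root = {''n'', ''sq''}"
  by (auto simp: square_root_def)

lemma runs_decide_word:
  "runs decide_word (word_mem u) (\<lambda>t s. s ''out'' 0 = (if u \<in> free_orientation_problem then 1 else 0) \<and>
    t \<le> 3000 * length u ^ 3 + 1000)"
proof -
  let ?s = "word_mem u" and ?l = "length u"
  have word: "?s ''len'' 0 = ?l" "\<And>i. i < ?l \<Longrightarrow> ?s ''in'' i = of_bool (u ! i)"
    "?s ''num'' = (\<lambda>_. 0)" "?s ''comp'' = (\<lambda>_. 0)"
    by (auto simp: word_mem_def)
  obtain t1 s1 where e1: "exec unit_cost square_root ?s t1 s1"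
    and q1: "s1 ''sq'' 0 = s1 ''n'' 0 * s1 ''n'' 0 + 4" "s1 ''n'' 0 \<le> ?l"
      "s1 ''sq'' 0 = ?l \<longleftrightarrow> (\<exists>n. ?l = 4 + n * n)" "t1 \<le> 40 * ?l + 20"
    and f1: "\<And>x. x \<notin> {''n'', ''sq''} \<Longrightarrow> s1 x = ?s x"
    by (rule runsE[OF runs_square_root[of ?s ?l, OF word(1)], unfolded mods_square_root]) blast
  define n where "n = s1 ''n'' 0"
  have len1: "s1 ''len'' 0 = ?l" using f1[of "''len''"] word(1) by simp
  have l3: "?l \<le> ?l ^ 3" by (cases ?l) (simp_all add: self_le_power)
  show ?thesis
  proof (cases "\<exists>n. ?l = 4 + n * n")
    case False
    then have "u \<notin> free_orientation_problem"
      unfolding free_orientation_problem_def using length_encode by auto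
    then have out: "(0 = (if u \<in> free_orientation_problem then 1 else (0::nat))) = True" by simp
    have "runs (IF V ''sq'' \<doteq> V ''len'' THEN c ELSE ''out'' ::= N 0) s1
        (\<lambda>t s. s ''out'' 0 = 0 \<and> t \<le> 20)" for c
      using False q1(3) len1 by simp
    note empty = this
    have "t1 + t \<le> 3000 * ?l ^ 3 + 1000" if "t \<le> 20" for t using that q1(4) l3 by linarith
    then show ?thesis
      unfolding decide_word_def runs_Seq[of square_root]
      by (intro runsI[OF e1], intro runs_conseq[OF empty]) (simp only: out)
  next
    case True
    then have l: "?l = 4 + n * n" using q1(1,3) by (simp add: n_def)
    let ?G = "word_graph n u" and ?F = "word_family u"
    have n1: "s1 ''n'' 0 = n" by (simp add: n_def)
    have sq1: "s1 ''sq'' 0 = ?l" using True q1(3) by blast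
    have len: "s1 ''len'' 0 = 4 + n * n" using len1 l by simp
    obtain t2 s2 where e2: "exec unit_cost copy_input s1 t2 s2"
      and q2: "\<forall>i<4. s2 ''F'' i = s1 ''in'' i" "\<forall>i < n * n. s2 ''adj'' i = s1 ''in'' (4 + i)" "t2 \<le> 40 + 30 * (n * n)"
      and f2: "\<And>x. x \<notin> {''F'', ''size'', ''i'', ''adj''} \<Longrightarrow> s2 x = s1 x"
      by (rule runsE[OF runs_copy_input[of s1 "n * n", OF len]]) (auto simp: copy_input_def)
    have n2: "s2 ''n'' 0 = n" using f2[of "''n''"] n1 by simp
    obtain t3 s3 where e3: "exec unit_cost compute_rows s2 t3 s3"
      and q3: "\<forall>x<n. s3 ''row'' x = x * n" "t3 \<le> 11 + n * 40"
      and f3: "\<And>x. x \<notin> {''size'', ''x'', ''row''} \<Longrightarrow> s3 x = s2 x"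
      by (rule runsE[OF runs_compute_rows[of s2 n, OF n2]]) (auto simp: compute_rows_def)
    have n3: "s3 ''n'' 0 = n" using f3[of "''n''"] n2 by simp
    obtain t4 s4 where e4: "exec unit_cost check_graph s3 t4 s4"
      and q4: "s4 ''bad'' 0 = 0 \<longleftrightarrow> (\<forall>x<n. \<forall>y<n. s3 ''adj'' (x * n + y) = 1 \<longrightarrow>
          s3 ''adj'' (y * n + x) = 1 \<and> x \<noteq> y)" "t4 \<le> 11 + n * (19 + n * 61)"
      and f4: "\<And>x. x \<notin> {''bad'', ''x'', ''y''} \<Longrightarrow> s4 x = s3 x"
      by (rule runsE[OF runs_check_graph[of s3 n, OF n3 q3(1)]]) (auto simp: check_graph_def)
    have keep: "s4 x = ?s x" if "x \<in> {''num'', ''comp''}" for x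
      using that f4[of x] f3[of x] f2[of x] f1[of x] by auto
    have adj: "s4 ''adj'' (x * n + y) = of_bool (u ! (4 + (x * n + y)))" if "x < n" "y < n" for x y
      using f4[of "''adj''"] f3[of "''adj''"] f1[of "''in''"] q2(2) encode_less[OF that] word(2) l by simp
    have adj3: "s3 ''adj'' = s4 ''adj''" using f4[of "''adj''"] by simp
    have flags: "s4 ''F'' i = of_bool (u ! i)" if "i < 4" for i
      using f4[of "''F''"] f3[of "''F''"] f1[of "''in''"] q2(1) word(2)[of i] l that by simp
    have n4: "s4 ''n'' 0 = n" using f4[of "''n''"] n3 by simp
    have good: "s4 ''bad'' 0 = 0 \<longleftrightarrow> pair_graph ?G"
    proof -
      have "s4 ''adj'' (x * n + y) = 1 \<longleftrightarrow> u ! (4 + (x * n + y))" if "x < n" "y < n" for x y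
        using adj[OF that] by simp
      then show ?thesis unfolding q4(1) pair_graph_word_iff adj3 by blast
    qed
    have G: "pverts ?G = {..<n}" by (simp add: word_graph_def)
    note L = free_orientation_problem_iff[OF l]
    let ?Q = "\<lambda>t s. s ''out'' 0 = (if u \<in> free_orientation_problem then 1 else 0) \<and> t \<le> 2000 * n ^ 3 + 530"
    have fin: "runs (IF V ''bad'' \<doteq> N 0 THEN
          (algorithm1;; IF V ''fail'' \<doteq> N 0 THEN ''out'' ::= N 1 ELSE ''out'' ::= N 0)
        ELSE ''out'' ::= N 0) s4 ?Q"
    proof (cases "pair_graph ?G")
      case False
      then show ?thesis using good L by simp
    next
      case pg: True
      have "runs algorithm1 s4 (\<lambda>t s. algorithm1_outcome ?G ?F (read_result n s) \<and> t \<le> 2000 * n ^ 3 + 500)"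
      proof (rule runs_algorithm1[of ?G n ?F s4, OF pg G word_family_subset n4])
        fix i assume "i < n * n"
        then obtain x y where xy: "i = x * n + y" "x < n" "y < n" by (elim less_square_cases)
        then show "s4 ''adj'' i = of_bool ((i div n, i mod n) \<in> parcs ?G)"
          using adj[OF xy(2,3)] by (simp add: word_graph_def)
      next
        fix i :: nat assume "i < 4"
        then show "s4 ''F'' i = of_bool ([B1, B2, B3, T3] ! i \<in> ?F)" using flags nth_mem_word_family by simp
      qed (use keep[of "''num''"] keep[of "''comp''"] word(3,4) in simp_all)
      then obtain t5 s5 where e5: "exec unit_cost algorithm1 s4 t5 s5"
        and q5: "algorithm1_outcome ?G ?F (read_result n s5)" "t5 \<le> 2000 * n ^ 3 + 500"
        by (auto elim: runsE)
      have "s5 ''fail'' 0 = 0 \<longleftrightarrow> u \<in> free_orientation_problem"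
        using result_correct[OF pg word_family_subset q5(1)] L pg by blast
      then have "runs (algorithm1;; IF V ''fail'' \<doteq> N 0 THEN ''out'' ::= N 1 ELSE ''out'' ::= N 0) s4
          (\<lambda>t s. s ''out'' 0 = (if u \<in> free_orientation_problem then 1 else 0) \<and> t \<le> 2000 * n ^ 3 + 515)"
        unfolding runs_Seq by (intro runsI[OF e5]) (use q5(2) in simp)
      then have "runs (algorithm1;; IF V ''fail'' \<doteq> N 0 THEN ''out'' ::= N 1 ELSE ''out'' ::= N 0) s4
          (\<lambda>t. ?Q (bcost unit_cost (V ''bad'' \<doteq> N 0) s4 + t))"
        by (rule runs_conseq) simp
      moreover have "bval (V ''bad'' \<doteq> N 0) s4" using good pg by simp
      ultimately show ?thesis by (simp only: runs_If if_True)
    qed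
    from fin obtain t6 s6 where e6: "exec unit_cost (IF V ''bad'' \<doteq> N 0 THEN
          (algorithm1;; IF V ''fail'' \<doteq> N 0 THEN ''out'' ::= N 1 ELSE ''out'' ::= N 0)
        ELSE ''out'' ::= N 0) s4 t6 s6" and q6: "?Q t6 s6"
      by (rule runsE)
    have eq: "bval (V ''sq'' \<doteq> V ''len'') s1" using sq1 len1 by simp
    have b: "bcost unit_cost (V ''sq'' \<doteq> V ''len'') s1 = 5" by simp
    \<comment> \<open>A bound cubic in the number of vertices thus becomes one cubic in the length
      of the word.\<close>
    have "n \<le> ?l" "n * n \<le> ?l" using q1(2) l by (simp_all add: n_def)
    then have "n ^ 3 \<le> ?l ^ 3" "n * n \<le> ?l ^ 3" using l3 by (auto intro: power_mono)
    then have "t1 + (5 + (t2 + (t3 + (t4 + t6)))) \<le> 3000 * ?l ^ 3 + 1000"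
      using q1(2,4) q2(3) q3(2) q4(2) q6 l3 unfolding add_mult_distrib2 n_def by linarith
    with q6 show ?thesis
      unfolding decide_word_def
      by (intro runsI[OF exec.Seq[OF e1 exec.IfTrue[OF eq exec.Seq[OF e2 exec.Seq[OF e3 exec.Seq[OF e4 e6]]]]]])
        (simp only: b)
  qed
qed

section \<open>The polynomial bound on bit operations\<close>

lemma word_mem_less: "word_mem u x i < 2 ^ (length u + 1)"
proof -
  have "length u < 2 ^ (length u + 1)" by (rule less_power_mono[OF less_exp]) simp
  moreover have "(1::nat) < 2 ^ (length u + 1)" by (rule one_less_power) simp_all
  ultimately show ?thesis by (auto simp: word_mem_def of_bool_def)
qed

lemma free_orientation_problem_in_P: "free_orientation_problem \<in> class_P"
proof -
  \<comment> \<open>The program is fixed, so its constants have a common bound. As \<open>C\<close>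
    < \<open>2 ^ C\<close>, it can be added to the exponent \<open>?K\<close> next to the one for
    the initial memory.\<close>
  obtain C where C: "\<forall>k \<in> cconsts decide_word. k < C"
    using finite_nat_set_iff_bounded[THEN iffD1, OF finite_cconsts[of decide_word]] by (rule exE)
  have C': "k < 2 ^ C" if "k \<in> cconsts decide_word" for k
    by (rule less_trans[OF bspec[OF C that] less_exp])
  \<comment> \<open>\<open>?q\<close> is the unit-cost bound. With \<open>?K\<close> equal to the
    length plus \<open>1 + C\<close>, the factor \<open>?K + t + 1\<close> is bounded by
    \<open>?q\<close> plus the length plus \<open>C + 2\<close>.\<close>
  let ?q = "[:1000, 0, 0, 3000:] :: nat poly"
  let ?p = "?q * (?q + [:C + 2, 1:])"
  have q: "poly ?q l = 3000 * l ^ 3 + 1000" for l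
    by (simp add: power3_eq_cube algebra_simps)
  have "\<exists>t s. exec log_cost decide_word (word_mem u) t s \<and> t \<le> poly ?p (length u) \<and>
      s ''out'' 0 = (if u \<in> free_orientation_problem then 1 else 0)" for u
  proof -
    let ?l = "length u"
    obtain t s where e: "exec unit_cost decide_word (word_mem u) t s"
      and s: "s ''out'' 0 = (if u \<in> free_orientation_problem then 1 else 0)" "t \<le> poly ?q ?l"
      using runs_decide_word[of u] unfolding runs_def q by blast
    let ?K = "?l + 1 + C"
    have "\<forall>x i. word_mem u x i < 2 ^ ?K" using word_mem_less by (blast intro: less_power_mono le_add1)
    moreover have "\<forall>k \<in> cconsts decide_word. k < 2 ^ ?K" using C' by (blast intro: less_power_mono le_add2)
    ultimately obtain t' where t': "exec log_cost decide_word (word_mem u) t' s" "t' \<le> t * (?K + t + 1)"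
      using exec_log_cost[OF e] by blast
    have "t * (?K + t + 1) \<le> poly ?q ?l * (?K + poly ?q ?l + 1)"
      using s(2) by (intro mult_le_mono add_le_mono) simp_all
    also have "\<dots> = poly ?p ?l" unfolding poly_mult poly_add by (simp add: algebra_simps)
    finally have "t' \<le> poly ?p ?l" using t'(2) by (rule order_trans[rotated])
    with t'(1) s(1) show ?thesis by blast
  qed
  then show ?thesis unfolding class_P_def by blast
qed

theorem corollary7:
  shows "free_orientation_problem \<in> class_P \<and>
    (\<exists>c. \<forall>n (G :: nat pair_pre_digraph) F.
       pair_graph G \<and> pverts G = {..<n} \<and> F \<subseteq> {B1, B2, B3, T3} \<longrightarrow>
       (\<exists>t s. exec unit_cost algorithm1 (input_mem n G F) t s \<and> t \<le> c * n ^ 3 + c \<and>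
          algorithm1_outcome G F (read_result n s) \<and>
          (case read_result n s of
             Self_Dual S \<Rightarrow> \<not> (\<exists>D. F_free_orientation G F D)
           | Colouring m \<Rightarrow> F_free_orientation G F (orient G m))))"
proof (intro conjI free_orientation_problem_in_P, rule exI[of _ 2000], intro allI impI)
  fix n :: nat and G :: "nat pair_pre_digraph" and F :: "nat pair_pre_digraph set"
  assume *: "pair_graph G \<and> pverts G = {..<n} \<and> F \<subseteq> {B1, B2, B3, T3}"
  then have "runs algorithm1 (input_mem n G F)
      (\<lambda>t s. algorithm1_outcome G F (read_result n s) \<and> t \<le> 2000 * n ^ 3 + 500)"
    by (intro runs_algorithm1) (auto simp: input_mem_def)
  then obtain t s where run: "exec unit_cost algorithm1 (input_mem n G F) t s"
    "algorithm1_outcome G F (read_result n s)" "t \<le> 2000 * n ^ 3 + 500"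
    unfolding runs_def by blast
  \<comment> \<open>One constant serves as factor and as summand, so the summand 500 is raised to
    2000.\<close>
  then have "t \<le> 2000 * n ^ 3 + 2000" by simp
  with run * algorithm1_outcome_correct[OF _ _ run(2)]
  show "\<exists>t s. exec unit_cost algorithm1 (input_mem n G F) t s \<and> t \<le> 2000 * n ^ 3 + 2000 \<and>
      algorithm1_outcome G F (read_result n s) \<and>
      (case read_result n s of
         Self_Dual S \<Rightarrow> \<not> (\<exists>D. F_free_orientation G F D)
       | Colouring m \<Rightarrow> F_free_orientation G F (orient G m))"
    by blast
qed

end
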